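(* Let $\{a_n/b_n\}$ be a sequence of rationals in $(0,1)$, each written in lowest terms with $a_n,b_n$ positive integers. Let $\mathcal{T}_n=\mathcal{T}(a_n+b_n\alpha)$ and $\mathcal{C}_n=\mathcal{C}(a_n+b_n\alpha)$, let $f_n$ be the fold count of $\mathcal{C}_n$, and let $F_n$ be the number of faces of $\mathcal{T}_n$. Then: (1) If $\{a_n/b_n\}$ converges to an irrational limit, then $\lim_{n\to\infty} f_n/F_n=0$. (2) If $\{a_n/b_n\}$ is the sequence of continued fraction approximants of a quadratic irrational in $(0,1)$, then $\lim_{n\to\infty} f_n^2/F_n$ exists and is finite.
   Context: Let $\alpha=\frac{1+i\sqrt3}{2}$ and let $\mathcal{E}=\{a+b\alpha: a,b\in\mathbb{Z}\}$ be the Eisenstein integers; they are the vertices of the tiling $\mathcal{T}$ of $\mathbb{C}$ by unit equilateral triangles. For nonzero $\beta\in\mathcal{E}$, let $G_\beta$ be the group generated by the order-$3$ rotations about the points of $\beta\mathcal{E}$, and let $\mathcal{T}(\beta)=\mathcal{T}/G_\beta$; this is a triangulation of the $2$-sphere in which all vertices have degree $6$ except three of degree $2$. A good coloring of a triangulation is a coloring of its faces black and white such that around each vertex the number of black faces is congruent mod $3$ to the number of white faces. The fold count of a good coloring is the number of edges whose two incident faces have different colors. Continued fraction colorings. Let $\mathcal{S}$ be the set of rationals in $(0,1]$. The slow Gauss map $\gamma$ sends $r\in(0,1)$ to whichever of $\frac1r-1$ and $\frac{1}{\frac1r-1}$ lies in $(0,1]$ (both give $1$ when $r=1/2$); iterating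 $\gamma$ on any $r\in\mathcal{S}$ eventually reaches $1$. An Eisenstein trapezoid is an isosceles trapezoid (allowing the degenerate case of an isosceles triangle, whose shorter parallel side has length $0$) whose edges lie in the $1$-skeleton of $\mathcal{T}$; its top is the longer parallel side, its bottom the shorter one, and the other two are its diagonal sides. If a diagonal side has length $a$ and the top has length $b$ with $\gcd(a,b)=1$, its aspect ratio is $a/b$. A trapezoid necklace of aspect ratio $a/b$ with center $c$ is a union of six Eisenstein trapezoids $X_1,\dots,X_6$ of aspect ratio $a/b$ with pairwise disjoint interiors, $X_i\cap X_{i+1}$ a single common vertex (indices mod 6), and an order-$6$ rotation about $c$ mapping $X_i$ to $X_{i+1}$; with $c=0$ one may take $X_1$ with vertices $a+b\alpha,\ (a-b)+b\alpha,\ (2a-b)+(b-a)\alpha,\ a+(b-a)\alpha$ and $X_{k+1}=\alpha X_k$. For a necklace $X$ of aspect ratio $r\neq 1$, $\gamma(X)$ is the necklace with the same center and aspect ratio $\gamma(r)$, lying inside $X$, such that the top side of each trapezoid of $\gamma(X)$ is a side of a trapezoid $X_j$ of $X$ and one of its diagonal sides is a side of a trapezoid of $X$ adjacent to $X_j$. For $a/b\in\mathcal{S}$ the empty $a/b$-flower is the union of the nested necklaces $X,\gamma(X),\gamma^2(X),\dots$ (ending with the necklace of aspect ratio $1/1$), where $X$ is the necklace of aspect ratio $a/b$ centered at $0$, with successive necklaces colored alternately black and white. The flower is filled by coloring the six remaining triangles around the center alternately black and white, and capped by taking its convex hull (a regular hexagon with Eisenstein-integer vertices) and coloring the triangles of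 the hull outside the flower with the color opposite to that of the outermost necklace. Translates of the capped $a/b$-flower tile the plane; the resulting coloring of $\mathcal{T}$ is invariant under $G_\beta$ for $\beta=a+b\alpha$, and the induced good coloring of $\mathcal{T}(\beta)$ is denoted $\mathcal{C}(\beta)$ (the continued fraction coloring). *)

theory Defs
  imports "HOL-Analysis.Analysis"
begin

section \<open>The Eisenstein triangulation and its quotients\<close>

definition \<alpha> :: complex where
  "\<alpha> = (1 + \<i> * complex_of_real (sqrt 3)) / 2"

definition eisenstein :: "complex set" where
  "eisenstein = {of_int x + of_int y * \<alpha> | x y. True}"

text \<open>Faces and edges of the tiling are closed point sets. The six units are the powers of
  \<open>\<alpha>\<close>, so each face arises from its three corners and each edge from both endpoints.\<close>

definition faces :: "complex set set" where
  "faces = {convex hull {v, v + \<alpha> ^ k, v + \<alpha> ^ Suc k} | v k. v \<in> eisenstein}"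

definition edges :: "complex set set" where
  "edges = {closed_segment v (v + \<alpha> ^ k) | v k. v \<in> eisenstein}"

definition skeleton :: "complex set" where
  "skeleton = \<Union> edges"

definition rot3 :: "complex \<Rightarrow> complex \<Rightarrow> complex" where
  "rot3 c z = c + \<alpha>\<^sup>2 * (z - c)"

text \<open>The group \<open>G\<^sub>\<beta>\<close>. Every generator has order 3, so closing under composition already
  yields inverses.\<close>

inductive_set rot_group :: "complex \<Rightarrow> (complex \<Rightarrow> complex) set" for \<beta> where
  id: "id \<in> rot_group \<beta>"
| rot: "g \<in> rot_group \<beta> \<Longrightarrow> e \<in> eisenstein \<Longrightarrow> rot3 (\<beta> * e) \<circ> g \<in> rot_group \<beta>"

definition orbit :: "complex \<Rightarrow> complex set \<Rightarrow> complex set set" where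
  "orbit \<beta> S = (\<lambda>g. g ` S) ` rot_group \<beta>"

text \<open>Faces and edges of \<open>\<T>(\<beta>) = \<T>/G\<^sub>\<beta>\<close>, as orbits of faces and edges of \<open>\<T>\<close>.\<close>

definition quot_faces :: "complex \<Rightarrow> complex set set set" where
  "quot_faces \<beta> = orbit \<beta> ` faces"

definition quot_edges :: "complex \<Rightarrow> complex set set set" where
  "quot_edges \<beta> = orbit \<beta> ` edges"

definition quot_incident :: "complex set set \<Rightarrow> complex set set \<Rightarrow> bool" where
  "quot_incident E F \<longleftrightarrow> (\<exists>e\<in>E. \<exists>t\<in>F. e \<subseteq> t)"

definition face_count :: "complex \<Rightarrow> nat" where
  "face_count \<beta> = card (quot_faces \<beta>)"

text \<open>A coloring of the faces of \<open>\<T>(\<beta>)\<close> is a predicate on face orbits, true meaning black.\<close>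

definition fold_count :: "complex \<Rightarrow> (complex set set \<Rightarrow> bool) \<Rightarrow> nat" where
  "fold_count \<beta> col =
     card {E \<in> quot_edges \<beta>. \<exists>F\<in>quot_faces \<beta>. \<exists>F'\<in>quot_faces \<beta>.
             quot_incident E F \<and> quot_incident E F' \<and> col F \<noteq> col F'}"


section \<open>Eisenstein trapezoids and necklaces\<close>

text \<open>A trapezoid is given by its vertices \<open>(p, q, r, s)\<close> in cyclic order: \<open>pq\<close> is the top,
  \<open>qr\<close> and \<open>sp\<close> are the diagonal sides, \<open>rs\<close> is the bottom.\<close>

type_synonym quad = "complex \<times> complex \<times> complex \<times> complex"

fun verts :: "quad \<Rightarrow> complex set" where
  "verts (p, q, r, s) = {p, q, r, s}"

fun map_quad :: "(complex \<Rightarrow> complex) \<Rightarrow> quad \<Rightarrow> quad" where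
  "map_quad f (p, q, r, s) = (f p, f q, f r, f s)"

fun top_side :: "quad \<Rightarrow> complex set" where
  "top_side (p, q, r, s) = closed_segment p q"

fun diagonal_sides :: "quad \<Rightarrow> complex set set" where
  "diagonal_sides (p, q, r, s) = {closed_segment q r, closed_segment s p}"

fun sides :: "quad \<Rightarrow> complex set set" where
  "sides (p, q, r, s) =
     {closed_segment p q, closed_segment q r, closed_segment r s, closed_segment s p}"

definition region :: "quad \<Rightarrow> complex set" where
  "region T = convex hull (verts T)"

text \<open>Isosceles trapezoid with edges in the 1-skeleton, diagonal sides of length \<open>a\<close> and top of
  length \<open>b\<close>, \<open>gcd(a,b) = 1\<close>. The bottom is parallel to the top and strictly shorter; \<open>t = 0\<close> is
  the degenerate case of a triangle.\<close>

fun eis_trapezoid :: "nat \<Rightarrow> nat \<Rightarrow> quad \<Rightarrow> bool" where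
  "eis_trapezoid a b (p, q, r, s) \<longleftrightarrow>
     coprime a b \<and>
     \<not> collinear {p, q, s} \<and>
     (\<exists>t::real. 0 \<le> t \<and> t < 1 \<and> r - s = t *\<^sub>R (q - p)) \<and>
     dist p q = real b \<and> dist q r = real a \<and> dist s p = real a \<and>
     \<Union> (sides (p, q, r, s)) \<subseteq> skeleton"

text \<open>The six trapezoids are the values at \<open>0, \<dots>, 5\<close>; the rotation condition makes the family
  6-periodic. The rotations of order 6 are those by \<open>\<alpha>\<close> and by its inverse \<open>cnj \<alpha>\<close>.\<close>

definition necklace :: "complex \<Rightarrow> nat \<Rightarrow> nat \<Rightarrow> (nat \<Rightarrow> quad) \<Rightarrow> bool" where
  "necklace c a b X \<longleftrightarrow>
     (\<forall>i. eis_trapezoid a b (X i)) \<and>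
     (\<exists>\<rho>\<in>{\<alpha>, cnj \<alpha>}. \<forall>i. X (Suc i) = map_quad (\<lambda>z. c + \<rho> * (z - c)) (X i)) \<and>
     (\<forall>i<6. \<forall>j<6. i \<noteq> j \<longrightarrow> interior (region (X i)) \<inter> interior (region (X j)) = {}) \<and>
     (\<forall>i. \<exists>v \<in> verts (X i) \<inter> verts (X (Suc i)). region (X i) \<inter> region (X (Suc i)) = {v})"

definition carrier :: "(nat \<Rightarrow> quad) \<Rightarrow> complex set" where
  "carrier X = (\<Union>i<6. region (X i))"

definition std_necklace :: "nat \<Rightarrow> nat \<Rightarrow> nat \<Rightarrow> quad" where
  "std_necklace a b k = map_quad (\<lambda>z. \<alpha> ^ k * z)
     (let a = of_nat a; b = of_nat b in
       (a + b * \<alpha>, (a - b) + b * \<alpha>, (2 * a - b) + (b - a) * \<alpha>, a + (b - a) * \<alpha>))"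

definition slow_gauss :: "real \<Rightarrow> real" where
  "slow_gauss r = (if 1 / r - 1 \<le> 1 then 1 / r - 1 else 1 / (1 / r - 1))"

text \<open>\<open>gauss_necklace c X Y\<close>: \<open>X\<close> is a necklace with center \<open>c\<close> and \<open>Y\<close> is the necklace
  \<open>\<gamma>(X)\<close>. The relation determines the point set of \<open>Y\<close>, but not the indexing of its trapezoids.\<close>

definition gauss_necklace :: "complex \<Rightarrow> (nat \<Rightarrow> quad) \<Rightarrow> (nat \<Rightarrow> quad) \<Rightarrow> bool" where
  "gauss_necklace c X Y \<longleftrightarrow> (\<exists>a b a' b'.
     necklace c a b X \<and> real a / real b \<noteq> 1 \<and>
     necklace c a' b' Y \<and> real a' / real b' = slow_gauss (real a / real b) \<and>
     (\<forall>i. interior (region (Y i)) \<subseteq> inside (carrier X)) \<and>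
     (\<forall>i. \<exists>j j'. (j' = Suc j \<or> j = Suc j') \<and>
        top_side (Y i) \<in> sides (X j) \<and> diagonal_sides (Y i) \<inter> sides (X j') \<noteq> {}))"


section \<open>Continued fraction colorings\<close>

text \<open>\<open>flower_layer a b k X\<close>: \<open>X\<close> is the \<open>k\<close>-th necklace of the empty \<open>a/b\<close>-flower. The chain
  stops at aspect ratio 1, where \<open>gauss_necklace\<close> admits no successor.\<close>

inductive flower_layer :: "nat \<Rightarrow> nat \<Rightarrow> nat \<Rightarrow> (nat \<Rightarrow> quad) \<Rightarrow> bool" for a b where
  outer: "flower_layer a b 0 (std_necklace a b)"
| inner: "flower_layer a b k X \<Longrightarrow> gauss_necklace 0 X Y \<Longrightarrow> flower_layer a b (Suc k) Y"

definition eis :: "nat \<Rightarrow> nat \<Rightarrow> complex" where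
  "eis a b = of_nat a + of_nat b * \<alpha>"

text \<open>The hull of the \<open>a/b\<close>-flower is the regular hexagon with vertices \<open>\<alpha>\<^sup>k\<beta>\<close>, \<open>\<beta> = a + b\<alpha>\<close>.
  Its translates tile the plane, with centers the lattice generated by \<open>\<beta> + \<alpha>\<beta>\<close> and its
  rotations.\<close>

definition flower_centers :: "nat \<Rightarrow> nat \<Rightarrow> complex set" where
  "flower_centers a b = {eis a b * (1 + \<alpha>) * e | e. e \<in> eisenstein}"

text \<open>The coloring of the faces of \<open>\<T>\<close> (true meaning black). The outermost necklace is taken
  black, so the necklaces of even index are black, those of odd index white, and the caps, which
  carry the color opposite to the outermost necklace, white. A tile is therefore black iff in one
  of the translated flowers it belongs to an even necklace or is one of three alternate triangles
  of the central hexagon. Interchanging the two colors of all faces, or those of the six central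
  triangles (which amounts to a rotation by \<open>\<alpha>\<close>), does not change the fold count.\<close>

definition cf_black :: "nat \<Rightarrow> nat \<Rightarrow> complex set \<Rightarrow> bool" where
  "cf_black a b t \<longleftrightarrow> (\<exists>c\<in>flower_centers a b.
     (\<exists>k X. flower_layer a b k X \<and> even k \<and> t \<subseteq> (+) c ` carrier X) \<or>
     (\<exists>j. even j \<and> t = (+) c ` (convex hull {0, \<alpha> ^ j, \<alpha> ^ Suc j})))"

text \<open>The induced coloring \<open>\<C>(a + b\<alpha>)\<close> of \<open>\<T>(a + b\<alpha>)\<close>. Since \<open>cf_black a b\<close> is invariant under
  \<open>G\<^sub>\<beta>\<close>, the choice of the representative is immaterial.\<close>

definition cf_coloring :: "nat \<Rightarrow> nat \<Rightarrow> complex set set \<Rightarrow> bool" where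
  "cf_coloring a b F \<longleftrightarrow> (\<exists>t\<in>F. cf_black a b t)"


section \<open>Quadratic irrationals and continued fraction approximants\<close>

definition quadratic_irrational :: "real \<Rightarrow> bool" where
  "quadratic_irrational x \<longleftrightarrow> x \<notin> \<rat> \<and>
     (\<exists>u v w :: int. u \<noteq> 0 \<and> of_int u * x\<^sup>2 + of_int v * x + of_int w = 0)"

text \<open>For irrational \<open>x = [c\<^sub>0; c\<^sub>1, c\<^sub>2, \<dots>]\<close> this is the \<open>n\<close>-th convergent
  \<open>[c\<^sub>0; c\<^sub>1, \<dots>, c\<^sub>n]\<close>.\<close>

fun cf_convergent :: "nat \<Rightarrow> real \<Rightarrow> real" where
  "cf_convergent 0 x = of_int \<lfloor>x\<rfloor>"
| "cf_convergent (Suc n) x = of_int \<lfloor>x\<rfloor> + 1 / cf_convergent n (1 / frac x)"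

end

theory Submission
  imports Defs
begin

text \<open>In coordinates \<open>z = X + Y\<alpha>\<close> the \<open>k\<close>-th necklace of the \<open>a/b\<close>-flower is the difference of two
  nested star polygons, and passing to the next star replaces the parameters \<open>(m\<^sub>k, n\<^sub>k)\<close>, starting
  with \<open>(b, a)\<close>, by a step of the subtractive Euclidean algorithm. The coloring changes exactly
  across the boundaries of the stars, which have \<open>6(m\<^sub>k + n\<^sub>k)\<close> edges each, and across nine edges at the
  center. Since the rotations of order 3 act freely on edges, the fold count is
  \<open>2 \<Sum>(m\<^sub>k + n\<^sub>k) + 3\<close>; the number of faces is \<open>2(a\<^sup>2 + ab + b\<^sup>2)\<close>.

  The sums \<open>s\<^sub>k = m\<^sub>k + n\<^sub>k\<close> decrease strictly, so those from index \<open>j\<close> on contribute at most \<open>s\<^sub>j\<^sup>2\<close>,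
  while \<open>s\<^sub>j/b\<close> is a continuous function of \<open>a/b\<close> that tends to 0 as \<open>j\<close> grows when \<open>a/b\<close> is replaced by an
  irrational limit; this gives (1). If \<open>a/b\<close> approximates a quadratic irrational to order \<open>1/b\<^sup>2\<close>,
  Liouville's inequality bounds the ratio of the two parameters uniformly, so \<open>s\<^sub>k/b\<close> decays
  geometrically uniformly in \<open>a/b\<close>, and the sum converges by Tannery's theorem; this gives (2).\<close>

section \<open>Coordinates\<close>

text \<open>The relation \<open>gauss_necklace\<close> fixes a necklace only as a point set: its
  trapezoids may be numbered from any position and in either direction, and each may have its
  vertices relabelled. The invariant \<open>necklace_state\<close> therefore records a single
  trapezoid up to these choices, and the coloring is read off from carriers alone. Faces are
  replaced by their centroids. These avoid all lines of the tiling, so that membership in closed and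
  in open stars becomes one and the same condition on integers. Edges are replaced by their
  midpoints. These are not Eisenstein integers, hence avoid the corners where neighboring flowers
  touch, and each lies in at most one flower; this makes both the coloring near an edge and the
  orbit of an edge computable inside the flower at 0. In (2) convergence of each s_k/b is not
  enough, because the number of layers is unbounded along the sequence. The Liouville bound has to
  be carried over from the limit to the rationals a_n/b_n with a constant that does not depend on
  n.\<close>

lemma \<alpha>_sq: "\<alpha>\<^sup>2 = \<alpha> - 1"
  by (simp add: \<alpha>_def power2_eq_square complex_eq_iff field_simps)

text \<open>The second form catches right-nested products, so that rewriting reduces every power of
  \<alpha> to a linear expression.\<close>

lemma \<alpha>_mult_self: "\<alpha> * \<alpha> = \<alpha> - 1" "\<alpha> * (\<alpha> * z) = \<alpha> * z - z"
proof -
  show *: "\<alpha> * \<alpha> = \<alpha> - 1"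
    using \<alpha>_sq by (simp add: power2_eq_square)
  show "\<alpha> * (\<alpha> * z) = \<alpha> * z - z"
    unfolding mult.assoc[symmetric] * by (simp add: left_diff_distrib)
qed

lemma \<alpha>_pow_expand: "\<alpha> ^ 0 = 1" "\<alpha> ^ 1 = \<alpha>" "\<alpha> ^ 2 = \<alpha> - 1" "\<alpha> ^ 3 = -1" "\<alpha> ^ 4 = -\<alpha>" "\<alpha> ^ 5 = 1 - \<alpha>"
  by (simp_all add: eval_nat_numeral \<alpha>_mult_self right_diff_distrib)

lemma \<alpha>_pow6: "\<alpha> ^ 6 = 1"
  using power_mult[of \<alpha> 3 2] by (simp add: \<alpha>_pow_expand)

lemma \<alpha>_pow_mod: "\<alpha> ^ (k mod 6) = \<alpha> ^ k"
proof -
  have "\<alpha> ^ k = \<alpha> ^ (6 * (k div 6) + k mod 6)" by simp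
  also have "\<dots> = \<alpha> ^ (k mod 6)" by (simp only: power_add power_mult \<alpha>_pow6) simp
  finally show ?thesis by simp
qed

lemma norm_\<alpha> [simp]: "norm \<alpha> = 1"
  by (simp add: \<alpha>_def norm_divide cmod_def power_divide)

lemma \<alpha>_nonzero [simp]: "\<alpha> \<noteq> 0" using norm_\<alpha> by force

lemma cnj_\<alpha>: "cnj \<alpha> = 1 - \<alpha>" "cnj \<alpha> = \<alpha> ^ 5"
proof -
  show "cnj \<alpha> = 1 - \<alpha>" by (simp add: \<alpha>_def complex_eq_iff)
  then show "cnj \<alpha> = \<alpha> ^ 5" by (simp only: \<alpha>_pow_expand)
qed

definition pX :: "complex \<Rightarrow> real" where "pX z = Re z - Im z / sqrt 3"
definition pY :: "complex \<Rightarrow> real" where "pY z = 2 * Im z / sqrt 3"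
definition cx :: "real \<Rightarrow> real \<Rightarrow> complex" where "cx x y = of_real x + of_real y * \<alpha>"

lemma Re_\<alpha>: "Re \<alpha> = 1/2" and Im_\<alpha>: "Im \<alpha> = sqrt 3 / 2"
  by (auto simp: \<alpha>_def)

lemma pX_linear [simp]: "pX (z + w) = pX z + pX w" "pX (z - w) = pX z - pX w" "pX (- z) = - pX z"
    "pX 0 = 0" "pX 1 = 1" "pX (of_real r * z) = r * pX z" "pX (r *\<^sub>R z) = r * pX z"
    "pX (of_real r) = r" "pX (of_int i) = of_int i" "pX (of_nat i') = of_nat i'"
  and pY_linear [simp]: "pY (z + w) = pY z + pY w" "pY (z - w) = pY z - pY w" "pY (- z) = - pY z"
    "pY 0 = 0" "pY 1 = 0" "pY (of_real r * z) = r * pY z" "pY (r *\<^sub>R z) = r * pY z"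
    "pY (of_real r) = 0" "pY (of_int i) = 0" "pY (of_nat i') = 0"
  by (auto simp: pX_def pY_def field_simps)

lemma pX_numeral [simp]: "pX (numeral w * z) = numeral w * pX z" "pX (z / numeral w) = pX z / numeral w"
   "pX (of_nat i * z) = of_nat i * pX z" "pX (of_int k * z) = of_int k * pX z" "pX (numeral w) = numeral w"
  and pY_numeral [simp]: "pY (numeral w * z) = numeral w * pY z" "pY (z / numeral w) = pY z / numeral w"
   "pY (of_nat i * z) = of_nat i * pY z" "pY (of_int k * z) = of_int k * pY z" "pY (numeral w) = 0"
  by (auto simp: pX_def pY_def field_simps)

lemma pXY_\<alpha> [simp]: "pX \<alpha> = 0" "pY \<alpha> = 1"
  by (auto simp: pX_def pY_def Re_\<alpha> Im_\<alpha>)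

lemma pX_\<alpha>_mult [simp]: "pX (\<alpha> * z) = - pY z"
  and pY_\<alpha>_mult [simp]: "pY (\<alpha> * z) = pX z + pY z"
  by (simp_all add: pX_def pY_def Re_\<alpha> Im_\<alpha> field_simps)

lemma cx_pX_pY: "cx (pX z) (pY z) = z"
  by (simp add: cx_def pX_def pY_def complex_eq_iff Re_\<alpha> Im_\<alpha>)

lemma pXY_cx [simp]: "pX (cx x y) = x" "pY (cx x y) = y"
  by (simp_all add: cx_def)

lemma pXY_eqI: "pX z = pX w \<Longrightarrow> pY z = pY w \<Longrightarrow> z = w"
  by (metis cx_pX_pY)

lemma pXY_eq_iff: "z = w \<longleftrightarrow> pX z = pX w \<and> pY z = pY w"
  by (metis cx_pX_pY)

lemma cx_eq_iff [simp]: "cx x y = cx x' y' \<longleftrightarrow> x = x' \<and> y = y'"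
  by (metis pXY_cx)

lemma \<alpha>_mult_cx: "\<alpha> * cx x y = cx (-y) (x + y)"
  by (rule pXY_eqI) auto

lemma cx_arith: "cx x y + cx x' y' = cx (x + x') (y + y')" "cx x y - cx x' y' = cx (x - x') (y - y')"
  "- cx x y = cx (-x) (-y)" "r *\<^sub>R cx x y = cx (r * x) (r * y)"
  by (auto simp: pXY_eq_iff)

text \<open>The norm form of the Eisenstein integers; Re z = X + Y/2 and Im z = sqrt 3/2 * Y
  complete its square.\<close>

lemma norm_sq: "(norm z)\<^sup>2 = (pX z)\<^sup>2 + pX z * pY z + (pY z)\<^sup>2"
proof -
  have "Re z = pX z + pY z / 2" "Im z = sqrt 3 / 2 * pY z"
    by (simp_all add: pX_def pY_def)
  then have "(norm z)\<^sup>2 = (pX z + pY z / 2)\<^sup>2 + (sqrt 3 / 2 * pY z)\<^sup>2"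
    by (simp only: cmod_power2)
  then show ?thesis by (simp add: power_mult_distrib power2_eq_square algebra_simps)
qed

lemma inner_coords: "2 * (z \<bullet> w) = 2 * pX z * pX w + 2 * pY z * pY w + pX z * pY w + pY z * pX w"
proof -
  have "2 * (z \<bullet> w) = (norm (z + w))\<^sup>2 - (norm z)\<^sup>2 - (norm w)\<^sup>2"
    by (simp add: power2_norm_eq_inner inner_add inner_commute)
  then show ?thesis unfolding norm_sq by (simp add: power2_eq_square algebra_simps)
qed

lemma eisenstein_iff: "z \<in> eisenstein \<longleftrightarrow> pX z \<in> \<int> \<and> pY z \<in> \<int>"
proof
  assume "z \<in> eisenstein"
  then show "pX z \<in> \<int> \<and> pY z \<in> \<int>" by (auto simp: eisenstein_def)
next
  assume "pX z \<in> \<int> \<and> pY z \<in> \<int>"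
  then obtain i j where "pX z = of_int i" "pY z = of_int j" by (auto elim!: Ints_cases)
  then have "z = of_int i + of_int j * \<alpha>" by (intro pXY_eqI) auto
  then show "z \<in> eisenstein" by (auto simp: eisenstein_def)
qed

lemma eisenstein_closed:
  "z \<in> eisenstein \<Longrightarrow> w \<in> eisenstein \<Longrightarrow> z + w \<in> eisenstein"
  "z \<in> eisenstein \<Longrightarrow> w \<in> eisenstein \<Longrightarrow> z - w \<in> eisenstein"
  "z \<in> eisenstein \<Longrightarrow> - z \<in> eisenstein"
  "z \<in> eisenstein \<Longrightarrow> \<alpha> * z \<in> eisenstein"
  "0 \<in> eisenstein" "1 \<in> eisenstein" "\<alpha> \<in> eisenstein"
  "of_int i \<in> eisenstein" "of_nat k \<in> eisenstein"
  by (auto simp: eisenstein_iff)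

lemma pXY_mult: "pX (z * w) = pX z * pX w - pY z * pY w"
    "pY (z * w) = pX z * pY w + pY z * pX w + pY z * pY w"
proof -
  have *: "z * w = of_real (pX z) * w + of_real (pY z) * (\<alpha> * w)"
    by (subst (1) cx_pX_pY[of z, symmetric]) (simp add: cx_def algebra_simps)
  show "pX (z * w) = pX z * pX w - pY z * pY w"
    using arg_cong[OF *, of pX] by simp
  show "pY (z * w) = pX z * pY w + pY z * pX w + pY z * pY w"
    using arg_cong[OF *, of pY] by (simp add: distrib_left)
qed

lemma eisenstein_mult: "z \<in> eisenstein \<Longrightarrow> w \<in> eisenstein \<Longrightarrow> z * w \<in> eisenstein"
  unfolding eisenstein_iff pXY_mult by (metis Ints_add Ints_diff Ints_mult)

lemma eisenstein_\<alpha>_pow: "\<alpha> ^ k \<in> eisenstein"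
  by (induction k) (auto simp: eisenstein_closed)

lemma eisenstein_cxI: "x \<in> \<int> \<Longrightarrow> y \<in> \<int> \<Longrightarrow> cx x y \<in> eisenstein"
  by (simp add: eisenstein_iff)

section \<open>Star polygons\<close>

text \<open>The six forms \<open>X, X + Y, Y, -X, -(X + Y), -Y\<close> are permuted cyclically by multiplication
  by \<open>\<alpha>\<close>; a point lies in the star iff no consecutive pair of them exceeds \<open>(n, m)\<close>. The outer
  corners of this star are \<open>\<alpha>\<^sup>k(n + m\<alpha>)\<close>, and in the degenerate case \<open>m = 0\<close> it is a hexagon.\<close>

definition star :: "real \<Rightarrow> real \<Rightarrow> real \<Rightarrow> real \<Rightarrow> bool" where
  "star m n X Y \<longleftrightarrow> (X \<le> n \<or> X + Y \<le> m) \<and> (X + Y \<le> n \<or> Y \<le> m) \<and> (Y \<le> n \<or> - X \<le> m) \<and>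
     (- X \<le> n \<or> - (X + Y) \<le> m) \<and> (- (X + Y) \<le> n \<or> - Y \<le> m) \<and> (- Y \<le> n \<or> X \<le> m)"

text \<open>Necklaces are closed sets, so the star that is cut out of another one has to be
  open.\<close>

definition ostar :: "real \<Rightarrow> real \<Rightarrow> real \<Rightarrow> real \<Rightarrow> bool" where
  "ostar m n X Y \<longleftrightarrow> (X < n \<or> X + Y < m) \<and> (X + Y < n \<or> Y < m) \<and> (Y < n \<or> - X < m) \<and>
     (- X < n \<or> - (X + Y) < m) \<and> (- (X + Y) < n \<or> - Y < m) \<and> (- Y < n \<or> X < m)"

text \<open>One system of half-planes for both orientations. For n \<le> m the bottom lies on Y = m
  - n and the slanted side on X + Y = n; for m < n the bottom lies on X = n - m and the slanted side
  on X + Y = m.\<close>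

definition trap :: "real \<Rightarrow> real \<Rightarrow> real \<Rightarrow> real \<Rightarrow> bool" where
  "trap m n X Y \<longleftrightarrow> n - m \<le> X \<and> X \<le> n \<and> m - n \<le> Y \<and> Y \<le> m \<and> min m n \<le> X + Y"

definition traps :: "real \<Rightarrow> real \<Rightarrow> real \<Rightarrow> real \<Rightarrow> bool" where
  "traps m n X Y \<longleftrightarrow> trap m n X Y \<or> trap m n (X + Y) (- X) \<or> trap m n Y (- X - Y) \<or>
      trap m n (- X) (- Y) \<or> trap m n (- X - Y) X \<or> trap m n (- Y) (X + Y)"

lemma star_rot: "star m n (- Y) (X + Y) \<longleftrightarrow> star m n X Y"
  unfolding star_def by (auto simp: algebra_simps)

lemma star_mono: "star m n X Y \<Longrightarrow> m \<le> m' \<Longrightarrow> n \<le> n' \<Longrightarrow> star m' n' X Y"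
  unfolding star_def by (meson order_trans)

lemma trap_star: "trap m n X Y \<Longrightarrow> 0 \<le> m \<Longrightarrow> 0 \<le> n \<Longrightarrow> star m n X Y"
  unfolding trap_def star_def min_def by (auto split: if_splits)
lemma trap_not_ostar1: "trap m n X Y \<Longrightarrow> n \<le> m \<Longrightarrow> \<not> ostar (m - n) n X Y"
  unfolding trap_def ostar_def by auto
lemma trap_not_ostar2: "trap m n X Y \<Longrightarrow> m \<le> n \<Longrightarrow> \<not> ostar m (n - m) X Y"
  unfolding trap_def ostar_def by auto

text \<open>The last two premises negate one clause of the next star, \<open>ostar (m - n) n\<close>
  here and \<open>ostar m (n - m)\<close> below. The part of the star beyond that clause is covered
  by two neighboring trapezoids; the other clauses are rotations of this one.\<close>

lemma star_cases1: "n \<le> m \<Longrightarrow> 0 < n \<Longrightarrow> star m n X Y \<Longrightarrow> n \<le> X + Y \<Longrightarrow> m - n \<le> Y \<Longrightarrow>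
  trap m n X Y \<or> trap m n (X + Y) (- X)"
  unfolding trap_def star_def by (smt (verit))
lemma star_cases2: "m < n \<Longrightarrow> 0 < m \<Longrightarrow> star m n X Y \<Longrightarrow> n - m \<le> X \<Longrightarrow> m \<le> X + Y \<Longrightarrow>
  trap m n X Y \<or> trap m n (- Y) (X + Y)"
  unfolding trap_def star_def by (smt (verit))

text \<open>Every edge of the tiling is \<open>\<alpha>\<^sup>j\<close> times a segment from \<open>N + y\<alpha>\<close> to \<open>N + (y + 1)\<alpha>\<close> with
  \<open>N \<ge> 0\<close>. The predicate \<open>arms\<close> singles out those on the boundary of the star, and \<open>istar\<close> is
  membership in the star for the triangle whose coordinates \<open>X, Y, X + Y\<close> have integer parts
  \<open>i, j, i + j + s\<close>.\<close>

definition arms :: "int \<Rightarrow> int \<Rightarrow> int \<Rightarrow> int \<Rightarrow> bool" where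
  "arms m n N y \<longleftrightarrow> N = n \<and> m - n \<le> y \<and> y < m \<or> N = m \<and> - (m + n) \<le> y \<and> y < - n"

definition istar :: "int \<Rightarrow> int \<Rightarrow> int \<Rightarrow> int \<Rightarrow> int \<Rightarrow> bool" where
  "istar m n i j s \<longleftrightarrow> (i < n \<or> i + j + s < m) \<and> (i + j + s < n \<or> j < m) \<and> (j < n \<or> - i \<le> m) \<and>
     (- i \<le> n \<or> - (i + j + s) \<le> m) \<and> (- (i + j + s) \<le> n \<or> - j \<le> m) \<and> (- j \<le> n \<or> i < m)"

text \<open>The triangles (N, y, 0) and (N - 1, y, 1) are the two that share the segment from N +
  y\<alpha> to N + (y + 1)\<alpha>. Nonnegative parameters with positive sum also admit the central
  hexagon (0, 1).\<close>

lemma istar_arms: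
  assumes "0 \<le> m" "0 \<le> n" "0 < m + n" "0 \<le> N"
  shows "(istar m n N y 0 \<noteq> istar m n (N - 1) y 1) \<longleftrightarrow> arms m n N y"
  using assms unfolding istar_def arms_def by (smt (verit))

text \<open>For N \<ge> 0 the triangle on the side X \<le> N is the one nearer to the center, so the
  star can only be left by crossing the line outward.\<close>

lemma istar_arms':
  assumes "0 \<le> m" "0 \<le> n" "0 < m + n" "0 \<le> N"
  shows "istar m n N y 0 \<Longrightarrow>  istar m n (N - 1) y 1"
  using assms unfolding istar_def by (smt (verit))

text \<open>In the sector X, Y \<ge> 0 the first two clauses of \<open>star\<close> leave three
  cases. The right-hand side is the squared norm of the outer corners \<alpha>^k (n +
  m\<alpha>).\<close>

lemma star_norm_bound0:
  assumes "star m n X Y" "0 \<le> X" "0 \<le> Y" "0 \<le> m" "0 \<le> n"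
  shows "X\<^sup>2 + X * Y + Y\<^sup>2 \<le> m\<^sup>2 + m * n + n\<^sup>2"
proof -
  have le: "X\<^sup>2 + X * Y + Y\<^sup>2 \<le> (X + Y)\<^sup>2"
    using assms by (simp add: power2_sum)
  consider "X \<le> n" "Y \<le> m" | "X + Y \<le> m" | "X + Y \<le> n"
    using assms unfolding star_def by linarith
  then show ?thesis
  proof cases
    case 1
    then have "X\<^sup>2 \<le> n\<^sup>2" "Y\<^sup>2 \<le> m\<^sup>2" "X * Y \<le> n * m"
      using assms by (auto intro: power_mono mult_mono)
    then show ?thesis by (simp add: mult.commute)
  next
    case 2
    then have "(X + Y)\<^sup>2 \<le> m\<^sup>2" using assms by (intro power_mono) auto
    moreover have "0 \<le> m * n" "0 \<le> n\<^sup>2" using assms by auto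
    ultimately show ?thesis using le by linarith
  next
    case 3
    then have "(X + Y)\<^sup>2 \<le> n\<^sup>2" using assms by (intro power_mono) auto
    moreover have "0 \<le> m * n" "0 \<le> m\<^sup>2" using assms by auto
    ultimately show ?thesis using le by linarith
  qed
qed

lemma sector_cases:
  fixes X Y :: real
  obtains "0 \<le> X" "0 \<le> Y" | "0 \<le> X + Y" "0 \<le> - X" | "0 \<le> Y" "0 \<le> - X - Y"
    | "0 \<le> - X" "0 \<le> - Y" | "0 \<le> - X - Y" "0 \<le> X" | "0 \<le> - Y" "0 \<le> X + Y"
  by linarith

lemma star_rots:
  "star m n (X + Y) (- X) \<longleftrightarrow> star m n X Y" "star m n Y (- X - Y) \<longleftrightarrow> star m n X Y"
  "star m n (- X) (- Y) \<longleftrightarrow> star m n X Y" "star m n (- X - Y) X \<longleftrightarrow> star m n X Y"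
  unfolding star_def by (auto simp: algebra_simps)

lemma ostar_rots:
  "ostar m n (X + Y) (- X) \<longleftrightarrow> ostar m n X Y" "ostar m n Y (- X - Y) \<longleftrightarrow> ostar m n X Y"
  "ostar m n (- X) (- Y) \<longleftrightarrow> ostar m n X Y" "ostar m n (- X - Y) X \<longleftrightarrow> ostar m n X Y"
  "ostar m n (- Y) (X + Y) \<longleftrightarrow> ostar m n X Y"
  unfolding ostar_def by (auto simp: algebra_simps)

lemma star_norm_bound:
  assumes "star m n X Y" "0 \<le> m" "0 \<le> n"
  shows "X\<^sup>2 + X * Y + Y\<^sup>2 \<le> m\<^sup>2 + m * n + n\<^sup>2"
proof (cases X Y rule: sector_cases)
  case 1 then show ?thesis using star_norm_bound0 assms by blast
next
  case 2 then show ?thesis using star_norm_bound0[of m n "X + Y" "- X"] assms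
    by (simp add: star_rots power2_eq_square algebra_simps)
next
  case 3 then show ?thesis using star_norm_bound0[of m n Y "- X - Y"] assms
    by (simp add: star_rots power2_eq_square algebra_simps)
next
  case 4 then show ?thesis using star_norm_bound0[of m n "- X" "- Y"] assms
    by (simp add: star_rots power2_eq_square algebra_simps)
next
  case 5 then show ?thesis using star_norm_bound0[of m n "- X - Y" X] assms
    by (simp add: star_rots power2_eq_square algebra_simps)
next
  case 6 then show ?thesis using star_norm_bound0[of m n "- Y" "X + Y"] assms
    by (simp add: star_rot power2_eq_square algebra_simps)
qed

text \<open>The right-hand side is invariant under the six rotations, so one inclusion concerns a
  single trapezoid. Conversely, a point outside the open inner star violates one of its six clauses,
  and \<open>star_cases1\<close> applied to the right rotation of the point gives a
  trapezoid.\<close>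

lemma traps_eq_ge:
  assumes "n \<le> m" "0 < n"
  shows "traps m n X Y \<longleftrightarrow> star m n X Y \<and> \<not> ostar (m - n) n X Y"
proof -
  define Q where "Q = (\<lambda>X Y. star m n X Y \<and> \<not> ostar (m - n) n X Y)"
  have Q_rots: "Q (X + Y) (- X) = Q X Y" "Q Y (- X - Y) = Q X Y" "Q (- X) (- Y) = Q X Y"
    "Q (- X - Y) X = Q X Y" "Q (- Y) (X + Y) = Q X Y" for X Y
    unfolding Q_def ostar_rots star_rots star_rot by (rule refl)+
  have *: "trap m n X Y \<Longrightarrow> Q X Y" for X Y
    unfolding Q_def using trap_star[of m n X Y] trap_not_ostar1[of m n X Y] assms by simp
  have **: "star m n X Y \<Longrightarrow> n \<le> X + Y \<Longrightarrow> m - n \<le> Y \<Longrightarrow> trap m n X Y \<or> trap m n (X + Y) (- X)" for X Y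
    using star_cases1[OF assms, of X Y] by blast
  show ?thesis
  proof
    assume "traps m n X Y"
    then have "Q X Y"
      unfolding traps_def using *[of X Y] *[of "X + Y" "- X"] *[of Y "- X - Y"] *[of "- X" "- Y"]
        *[of "- X - Y" X] *[of "- Y" "X + Y"] unfolding Q_rots by blast
    then show "star m n X Y \<and> \<not> ostar (m - n) n X Y" by (simp add: Q_def)
  next
    assume asm: "star m n X Y \<and> \<not> ostar (m - n) n X Y"
    then have st: "star m n X Y" by simp
    note st' = iffD2[OF star_rots(1) st] iffD2[OF star_rots(2) st] iffD2[OF star_rots(3) st]
      iffD2[OF star_rots(4) st] iffD2[OF star_rot st]
    show "traps m n X Y"
      using conjunct2[OF asm] **[OF st] **[OF st'(1)] **[OF st'(2)] **[OF st'(3)] **[OF st'(4)] **[OF st'(5)]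
      unfolding traps_def ostar_def by (simp add: not_less) argo
  qed
qed

lemma traps_eq_less:
  assumes "m < n" "0 < m"
  shows "traps m n X Y \<longleftrightarrow> star m n X Y \<and> \<not> ostar m (n - m) X Y"
proof -
  define Q where "Q = (\<lambda>X Y. star m n X Y \<and> \<not> ostar m (n - m) X Y)"
  have Q_rots: "Q (X + Y) (- X) = Q X Y" "Q Y (- X - Y) = Q X Y" "Q (- X) (- Y) = Q X Y"
    "Q (- X - Y) X = Q X Y" "Q (- Y) (X + Y) = Q X Y" for X Y
    unfolding Q_def ostar_rots star_rots star_rot by (rule refl)+
  have *: "trap m n X Y \<Longrightarrow> Q X Y" for X Y
    unfolding Q_def using trap_star[of m n X Y] trap_not_ostar2[of m n X Y] assms by simp
  have **: "star m n X Y \<Longrightarrow> n - m \<le> X \<Longrightarrow> m \<le> X + Y \<Longrightarrow> trap m n X Y \<or> trap m n (- Y) (X + Y)" for X Y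
    using star_cases2[OF assms, of X Y] by blast
  show ?thesis
  proof
    assume "traps m n X Y"
    then have "Q X Y"
      unfolding traps_def using *[of X Y] *[of "X + Y" "- X"] *[of Y "- X - Y"] *[of "- X" "- Y"]
        *[of "- X - Y" X] *[of "- Y" "X + Y"] unfolding Q_rots by blast
    then show "star m n X Y \<and> \<not> ostar m (n - m) X Y" by (simp add: Q_def)
  next
    assume asm: "star m n X Y \<and> \<not> ostar m (n - m) X Y"
    then have st: "star m n X Y" by simp
    note st' = iffD2[OF star_rots(1) st] iffD2[OF star_rots(2) st] iffD2[OF star_rots(3) st]
      iffD2[OF star_rots(4) st] iffD2[OF star_rot st]
    show "traps m n X Y"
      using conjunct2[OF asm] **[OF st] **[OF st'(1)] **[OF st'(2)] **[OF st'(3)] **[OF st'(4)] **[OF st'(5)]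
      unfolding traps_def ostar_def by (simp add: not_less) argo
  qed
qed

lemma arms_disjoint1: "0 < n \<Longrightarrow> n \<le> m \<Longrightarrow> arms m n N y \<Longrightarrow> \<not> arms (m - n) n N y"
  and arms_disjoint2: "0 < m \<Longrightarrow> m < n \<Longrightarrow> arms m n N y \<Longrightarrow> \<not> arms m (n - m) N y"
  unfolding arms_def by auto

section \<open>Trapezoids and necklaces\<close>

lemma linear_pX: "linear pX" and linear_pY: "linear pY"
  by (auto intro!: linearI)

lemma convex_trap: "convex {z. trap m n (pX z) (pY z)}"
proof -
  have "linear (\<lambda>z. pX z + pY z)"
    by (intro linear_compose_add linear_pX linear_pY)
  then have "convex (pX -` {n - m..n} \<inter> pY -` {m - n..m} \<inter> (\<lambda>z. pX z + pY z) -` {min m n..})"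
    by (intro convex_Int convex_linear_vimage linear_pX linear_pY convex_real_interval)
  also have "pX -` {n - m..n} \<inter> pY -` {m - n..m} \<inter> (\<lambda>z. pX z + pY z) -` {min m n..}
      = {z. trap m n (pX z) (pY z)}"
    by (auto simp: trap_def)
  finally show ?thesis .
qed

text \<open>For \<open>n \<le> m\<close> this is the trapezoid \<open>X\<^sub>1\<close> of the standard necklace of aspect ratio \<open>n/m\<close>, for
  \<open>m < n\<close> its mirror image; the necklaces of a flower alternate irregularly between the two.\<close>

definition tz :: "real \<Rightarrow> real \<Rightarrow> quad" where
  "tz m n = (if n \<le> m then (cx n m, cx (n - m) m, cx (2 * n - m) (m - n), cx n (m - n))
     else (cx n m, cx n (m - n), cx (n - m) (2 * m - n), cx (n - m) m))"

lemma convex_hull_segmentI: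
  assumes "p \<in> convex hull S" "q \<in> convex hull S" "0 \<le> u" "u \<le> (1::real)" "z = (1 - u) *\<^sub>R p + u *\<^sub>R q"
  shows "z \<in> convex hull S"
  using convexD_alt[OF convex_convex_hull assms(1,2,3,4)] assms(5) by simp

text \<open>Two interpolations exhibit a point of the half-plane description as a convex
  combination: first along the two non-parallel sides up to the parallel to the top through z (the
  points of A and B), then along this parallel.\<close>

lemma region_tz:
  assumes "0 < m" "0 < n"
  shows "region (tz m n) = {z. trap m n (pX z) (pY z)}"
proof
  show "region (tz m n) \<subseteq> {z. trap m n (pX z) (pY z)}"
    unfolding region_def tz_def
    by (rule hull_minimal) (use assms convex_trap in \<open>auto simp: trap_def\<close>)
  show "{z. trap m n (pX z) (pY z)} \<subseteq> region (tz m n)"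
  proof clarify
    fix z assume z: "trap m n (pX z) (pY z)"
    define X Y where "X = pX z" and "Y = pY z"
    note z = z[folded X_def Y_def]
    have z': "n - m \<le> X" "X \<le> n" "m - n \<le> Y" "Y \<le> m" "m \<le> X + Y \<or> n \<le> X + Y"
      "n \<le> m \<Longrightarrow> n \<le> X + Y" "m \<le> n \<Longrightarrow> m \<le> X + Y"
      using z by (auto simp: trap_def)
    \<comment> \<open>For d = 0 also c = 0, and the quotient c / d = 0 still serves; this occurs at
      the tip of the degenerate triangle.\<close>
    have unit: "\<exists>u\<ge>0. u \<le> 1 \<and> u * d = c" if "0 \<le> c" "c \<le> d" for c d :: real
      using that by (intro exI[of _ "c / d"]) (auto simp: divide_le_eq)
    show "z \<in> region (tz m n)"
    proof (cases "n \<le> m")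
      case True
      define H where "H = convex hull {cx n m, cx (n - m) m, cx (2 * n - m) (m - n), cx n (m - n)}"
      have v: "cx n m \<in> H" "cx (n - m) m \<in> H" "cx (2 * n - m) (m - n) \<in> H" "cx n (m - n) \<in> H"
        unfolding H_def by (auto intro: hull_inc)
      obtain u where u: "0 \<le> u" "u \<le> 1" "u * n = m - Y" using unit[of "m - Y" n] z' by auto
      have A: "cx n Y \<in> H"
        unfolding H_def
        by (rule convex_hull_segmentI[OF v(1)[unfolded H_def] v(4)[unfolded H_def] u(1,2)])
           (rule pXY_eqI; use u(3) in \<open>simp add: algebra_simps\<close>)
      have B: "cx (n - Y) Y \<in> H"
        unfolding H_def
        by (rule convex_hull_segmentI[OF v(2)[unfolded H_def] v(3)[unfolded H_def] u(1,2)])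
           (rule pXY_eqI; use u(3) in \<open>simp add: algebra_simps\<close>)
      obtain t where t: "0 \<le> t" "t \<le> 1" "t * Y = n - X" using unit[of "n - X" Y] z' True by auto
      have "z \<in> H"
        unfolding H_def
        by (rule convex_hull_segmentI[OF A[unfolded H_def] B[unfolded H_def] t(1,2)])
           (rule pXY_eqI; use t(3) in \<open>simp add: algebra_simps flip: X_def Y_def\<close>)
      then show ?thesis using True by (simp add: region_def tz_def H_def)
    next
      case False
      define H where "H = convex hull {cx n m, cx n (m - n), cx (n - m) (2 * m - n), cx (n - m) m}"
      have v: "cx n m \<in> H" "cx n (m - n) \<in> H" "cx (n - m) (2 * m - n) \<in> H" "cx (n - m) m \<in> H"
        unfolding H_def by (auto intro: hull_inc)
      obtain u where u: "0 \<le> u" "u \<le> 1" "u * m = n - X" using unit[of "n - X" m] z' by auto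
      have A: "cx X m \<in> H"
        unfolding H_def
        by (rule convex_hull_segmentI[OF v(1)[unfolded H_def] v(4)[unfolded H_def] u(1,2)])
           (rule pXY_eqI; use u(3) in \<open>simp add: algebra_simps\<close>)
      have B: "cx X (m - X) \<in> H"
        unfolding H_def
        by (rule convex_hull_segmentI[OF v(2)[unfolded H_def] v(3)[unfolded H_def] u(1,2)])
           (rule pXY_eqI; use u(3) in \<open>simp add: algebra_simps\<close>)
      obtain t where t: "0 \<le> t" "t \<le> 1" "t * X = m - Y" using unit[of "m - Y" X] z' False by auto
      have "z \<in> H"
        unfolding H_def
        by (rule convex_hull_segmentI[OF A[unfolded H_def] B[unfolded H_def] t(1,2)])
           (rule pXY_eqI; use t(3) in \<open>simp add: algebra_simps flip: X_def Y_def\<close>)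
      then show ?thesis using False by (simp add: region_def tz_def H_def)
    qed
  qed
qed

lemma region_map_mult: "region (map_quad ((*) w) T) = (*) w ` region T"
proof -
  obtain p q r s where T: "T = (p, q, r, s)" by (cases T)
  have "linear ((*) w)" by (auto intro!: linearI simp: algebra_simps)
  then show ?thesis
    using convex_hull_linear_image[of "(*) w" "{p, q, r, s}"] by (simp add: region_def T)
qed

lemma map_quad_mult_mult: "map_quad ((*) v) (map_quad ((*) w) T) = map_quad ((*) (v * w)) T"
  by (cases T) (simp add: mult.assoc)

lemma image_mult_mult: "(*) v ` (*) w ` S = (*) (v * w) ` (S :: complex set)"
  by (simp add: image_image mult.assoc)

lemma \<alpha>_mult_inverse: "\<alpha> * (1 - \<alpha>) = 1" "(1 - \<alpha>) * \<alpha> = 1"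
  by (simp_all add: right_diff_distrib left_diff_distrib \<alpha>_mult_self)

lemma pX_inv_mult [simp]: "pX ((1 - \<alpha>) * z) = pX z + pY z" "pY ((1 - \<alpha>) * z) = - pX z"
  by (simp_all add: left_diff_distrib)

text \<open>As 1 - \<alpha> is the inverse of \<alpha>, membership in a rotated region becomes, with
  \<open>coords_inv_pow\<close>, one of the disjuncts of \<open>traps\<close>.\<close>

lemma mem_image_\<alpha>: "z \<in> (*) (\<alpha> ^ i) ` S \<longleftrightarrow> (1 - \<alpha>) ^ i * z \<in> S"
proof -
  have 1: "(1 - \<alpha>) ^ i * \<alpha> ^ i = 1" "\<alpha> ^ i * (1 - \<alpha>) ^ i = 1"
    unfolding power_mult_distrib[symmetric] \<alpha>_mult_inverse by (rule power_one)+
  have 2: "(1 - \<alpha>) ^ i * (\<alpha> ^ i * s) = s" "\<alpha> ^ i * ((1 - \<alpha>) ^ i * s) = s" for s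
    unfolding mult.assoc[symmetric] 1 by (rule mult_1_left)+
  show ?thesis
  proof
    assume "z \<in> (*) (\<alpha> ^ i) ` S"
    then obtain s where "s \<in> S" "z = \<alpha> ^ i * s" by blast
    then show "(1 - \<alpha>) ^ i * z \<in> S" by (simp only: 2)
  next
    assume "(1 - \<alpha>) ^ i * z \<in> S"
    then show "z \<in> (*) (\<alpha> ^ i) ` S"
      using 2(2)[of z] by (metis image_eqI)
  qed
qed

lemma lessThan_6: "{..<6::nat} = {0, 1, 2, 3, 4, 5}" by auto

lemma coords_inv_pow:
  "pX ((1 - \<alpha>) ^ 0 * z) = pX z" "pY ((1 - \<alpha>) ^ 0 * z) = pY z"
  "pX ((1 - \<alpha>) ^ 1 * z) = pX z + pY z" "pY ((1 - \<alpha>) ^ 1 * z) = - pX z"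
  "pX ((1 - \<alpha>) ^ 2 * z) = pY z" "pY ((1 - \<alpha>) ^ 2 * z) = - pX z - pY z"
  "pX ((1 - \<alpha>) ^ 3 * z) = - pX z" "pY ((1 - \<alpha>) ^ 3 * z) = - pY z"
  "pX ((1 - \<alpha>) ^ 4 * z) = - pX z - pY z" "pY ((1 - \<alpha>) ^ 4 * z) = pX z"
  "pX ((1 - \<alpha>) ^ 5 * z) = - pY z" "pY ((1 - \<alpha>) ^ 5 * z) = pX z + pY z"
  by (simp_all add: eval_nat_numeral mult.assoc)

lemma Union_rotations:
  "(\<Union>i<6. (*) (\<alpha> ^ i) ` {z. trap m n (pX z) (pY z)}) = {z. traps m n (pX z) (pY z)}"
  unfolding lessThan_6
  by (simp only: Union_insert UN_insert UN_empty set_eq_iff Un_iff mem_image_\<alpha> mem_Collect_eq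
      coords_inv_pow traps_def empty_iff simp_thms)

text \<open>Whatever its direction \<rho> and its first position k, a necklace runs through all six
  powers of \<alpha>, so its carrier does not see the numbering. The witnesses use that 5 is -1
  modulo 6.\<close>

lemma \<alpha>_powers: "(\<lambda>i. \<rho> ^ i * \<alpha> ^ k) ` {..<6} = (\<lambda>i. \<alpha> ^ i) ` {..<6}"
  if "\<rho> \<in> {\<alpha>, cnj \<alpha>}"
proof -
  have *: "(\<lambda>i. \<alpha> ^ i) ` {..<6} = range (\<lambda>i. \<alpha> ^ i)"
    by (auto simp: image_iff) (metis \<alpha>_pow_mod lessThan_iff mod_less_divisor zero_less_numeral)
  have "\<alpha> ^ j \<in> (\<lambda>i. \<rho> ^ i * \<alpha> ^ k) ` {..<6}" for j
  proof (cases "\<rho> = \<alpha>")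
    case True
    have "\<alpha> ^ ((j + 5 * k) mod 6) * \<alpha> ^ k = \<alpha> ^ (j + 6 * k)"
      by (simp add: \<alpha>_pow_mod add.commute flip: power_add)
    also have "\<dots> = \<alpha> ^ j" by (simp add: power_add power_mult \<alpha>_pow6)
    finally show ?thesis
      using True by (intro image_eqI[of _ _ "(j + 5 * k) mod 6"]) auto
  next
    case False
    then have \<rho>: "\<rho> = \<alpha> ^ 5" using that cnj_\<alpha>(2) by simp
    have "\<rho> ^ ((5 * j + k) mod 6) * \<alpha> ^ k = (\<alpha> ^ ((5 * j + k) mod 6)) ^ 5 * \<alpha> ^ k"
      unfolding \<rho> by (simp add: mult.commute flip: power_mult)
    also have "\<dots> = \<alpha> ^ (25 * j + 6 * k)"
      by (simp add: \<alpha>_pow_mod algebra_simps flip: power_mult power_add)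
    also have "\<dots> = (\<alpha> ^ 6) ^ (4 * j + k) * \<alpha> ^ j"
      unfolding power_mult[symmetric] power_add[symmetric] by (simp add: algebra_simps)
    finally show ?thesis
      by (intro image_eqI[of _ _ "(5 * j + k) mod 6"]) (auto simp: \<alpha>_pow6)
  qed
  moreover have "\<rho> ^ i * \<alpha> ^ k \<in> range (\<lambda>i. \<alpha> ^ i)" for i
    using that unfolding cnj_\<alpha>(2) by (auto simp flip: power_mult power_add)
  ultimately show ?thesis unfolding * by auto
qed

lemma collinear_0_iff: "collinear {0, x, y} \<longleftrightarrow> pX x * pY y = pY x * pX y"
proof
  assume "collinear {0, x, y}"
  then show "pX x * pY y = pY x * pX y" by (auto simp: collinear_lemma)
next
  assume *: "pX x * pY y = pY x * pX y"
  show "collinear {0, x, y}"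
  proof (cases "pX x = 0")
    case True
    show ?thesis
    proof (cases "pY x = 0")
      case True
      with \<open>pX x = 0\<close> have "x = 0" by (simp add: pXY_eq_iff)
      then show ?thesis by simp
    next
      case False
      with True * have "y = (pY y / pY x) *\<^sub>R x" by (auto simp: pXY_eq_iff)
      then show ?thesis unfolding collinear_lemma by blast
    qed
  next
    case False
    with * have "y = (pX y / pX x) *\<^sub>R x" by (auto simp: pXY_eq_iff field_simps)
    then show ?thesis unfolding collinear_lemma by blast
  qed
qed

lemma collinear_iff: "collinear {p, q, s} \<longleftrightarrow> pX (q - p) * pY (s - p) = pY (q - p) * pX (s - p)"
proof -
  have "collinear {p, q, s} \<longleftrightarrow> collinear {0, q - p, s - p}"
    using collinear_3[of q p s] by (simp add: insert_commute)
  then show ?thesis by (simp only: collinear_0_iff)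
qed

section \<open>The rotated trapezoids form a necklace\<close>

definition tzk :: "nat \<Rightarrow> nat \<Rightarrow> nat \<Rightarrow> quad" where
  "tzk m n k = map_quad ((*) (\<alpha> ^ k)) (tz (real m) (real n))"

lemma segment_in_skeleton:
  assumes "v \<in> eisenstein"
  shows "closed_segment v (v + of_nat N * \<alpha> ^ k) \<subseteq> skeleton"
proof (induction N)
  case 0
  have "closed_segment v (v + \<alpha> ^ k) \<in> edges" using assms by (auto simp: edges_def)
  then show ?case by (auto simp: skeleton_def)
next
  case (Suc N)
  define w where "w = v + of_nat N * \<alpha> ^ k"
  have w: "w \<in> eisenstein"
    unfolding w_def using assms by (intro eisenstein_closed eisenstein_mult eisenstein_\<alpha>_pow)
  have "w \<in> closed_segment v (v + of_nat (Suc N) * \<alpha> ^ k)"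
  proof -
    define u where "u = real N / real (Suc N)"
    have u: "0 \<le> u" "u \<le> 1" "u * real (Suc N) = real N" by (auto simp: u_def)
    have eq: "(1 - u) *\<^sub>R v + u *\<^sub>R (v + of_nat (Suc N) * \<alpha> ^ k)
       = v + of_real (u * real (Suc N)) * \<alpha> ^ k"
      by (simp add: scaleR_conv_of_real algebra_simps)
    show ?thesis unfolding in_segment w_def
      by (rule exI[of _ u]) (use u(1,2) eq[unfolded u(3)] in \<open>simp del: of_nat_Suc\<close>)
  qed
  then have "closed_segment v (v + of_nat (Suc N) * \<alpha> ^ k)
     = closed_segment v w \<union> closed_segment w (v + of_nat (Suc N) * \<alpha> ^ k)"
    by (simp add: Un_closed_segment)
  moreover have e: "v + of_nat (Suc N) * \<alpha> ^ k = w + \<alpha> ^ k" by (simp add: w_def algebra_simps)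
  moreover have "closed_segment w (w + \<alpha> ^ k) \<in> edges" using w by (auto simp: edges_def)
  ultimately show ?case using Suc.IH[folded w_def] unfolding e skeleton_def by auto
qed

lemma segment_in_skeleton':
  assumes "v \<in> eisenstein" "w = v + of_nat N * \<alpha> ^ k"
  shows "closed_segment v w \<subseteq> skeleton" "closed_segment w v \<subseteq> skeleton"
  using segment_in_skeleton[OF assms(1)] assms(2) by (auto simp: closed_segment_commute)

lemma closed_segment_mult: "(*) w ` closed_segment p q = closed_segment (w * p) (w * q)"
  for w :: complex
proof -
  have "linear ((*) w)" by (auto intro!: linearI simp: algebra_simps)
  then show ?thesis by (simp add: closed_segment_linear_image)
qed

lemma sides_map_mult: "sides (map_quad ((*) w) T) = (\<lambda>S. (*) w ` S) ` sides T"
  and diagonal_sides_map_mult: "diagonal_sides (map_quad ((*) w) T) = (\<lambda>S. (*) w ` S) ` diagonal_sides T"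
  and top_side_map_mult: "top_side (map_quad ((*) w) T) = (*) w ` top_side T"
  and verts_map_mult: "verts (map_quad ((*) w) T) = (*) w ` verts T"
  by (cases T; simp add: closed_segment_mult)+

lemma skeleton_mult: "z \<in> skeleton \<Longrightarrow> \<alpha> ^ k * z \<in> skeleton"
proof -
  assume "z \<in> skeleton"
  then obtain v j where v: "v \<in> eisenstein" "z \<in> closed_segment v (v + \<alpha> ^ j)"
    by (auto simp: skeleton_def edges_def)
  then have "\<alpha> ^ k * z \<in> (*) (\<alpha> ^ k) ` closed_segment v (v + \<alpha> ^ j)" by blast
  then have "\<alpha> ^ k * z \<in> closed_segment (\<alpha> ^ k * v) (\<alpha> ^ k * v + \<alpha> ^ (k + j))"
    by (simp add: closed_segment_mult power_add distrib_left)
  moreover have "\<alpha> ^ k * v \<in> eisenstein" using v by (simp add: eisenstein_mult eisenstein_\<alpha>_pow)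
  ultimately show ?thesis by (auto simp: skeleton_def edges_def)
qed

lemma norm_\<alpha>_pow [simp]: "norm (\<alpha> ^ k) = 1" by (simp add: norm_power)

lemma \<alpha>_pow_nonzero [simp]: "\<alpha> ^ k \<noteq> 0" by simp

lemma dist_\<alpha>_pow: "dist (\<alpha> ^ k * p) (\<alpha> ^ k * q) = dist p q"
  unfolding dist_norm right_diff_distrib[symmetric] norm_mult by simp

lemma collinear_mult: "collinear {w * p, w * q, w * s} \<Longrightarrow> w \<noteq> 0 \<Longrightarrow> collinear {p, q, s}" for w :: complex
proof -
  assume "collinear {w * p, w * q, w * s}" and w: "w \<noteq> 0"
  then obtain u where u: "\<And>x y. x \<in> {p, q, s} \<Longrightarrow> y \<in> {p, q, s} \<Longrightarrow> \<exists>c. w * x - w * y = c *\<^sub>R u"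
    unfolding collinear_def by blast
  have "\<exists>c. x - y = c *\<^sub>R (u / w)" if "x \<in> {p, q, s}" "y \<in> {p, q, s}" for x y
  proof -
    obtain c where "w * x - w * y = c *\<^sub>R u" using u \<open>x \<in> _\<close> \<open>y \<in> _\<close> by metis
    then have "x - y = c *\<^sub>R (u / w)" using w
      by (simp add: field_simps scaleR_conv_of_real)
    then show ?thesis by blast
  qed
  then show ?thesis unfolding collinear_def by blast
qed

lemma eis_trapezoid_mult:
  assumes "eis_trapezoid a b T"
  shows "eis_trapezoid a b (map_quad ((*) (\<alpha> ^ k)) T)"
proof -
  obtain p q r s where T: "T = (p, q, r, s)" by (cases T)
  from assms obtain t where t: "0 \<le> t" "t < 1" "r - s = t *\<^sub>R (q - p)" by (auto simp: T)
  then have "\<alpha> ^ k * r - \<alpha> ^ k * s = t *\<^sub>R (\<alpha> ^ k * q - \<alpha> ^ k * p)"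
    by (metis mult_scaleR_right right_diff_distrib)
  moreover have "\<Union> (sides (map_quad ((*) (\<alpha> ^ k)) T)) \<subseteq> skeleton"
    using assms skeleton_mult unfolding sides_map_mult T eis_trapezoid.simps by blast
  ultimately show ?thesis
    using assms t collinear_mult[of "\<alpha> ^ k"] unfolding T eis_trapezoid.simps map_quad.simps dist_\<alpha>_pow by auto
qed

lemma dist_cx: "(dist (cx x y) (cx x' y'))\<^sup>2 = (x - x')\<^sup>2 + (x - x') * (y - y') + (y - y')\<^sup>2"
  unfolding dist_norm norm_sq by (simp add: cx_arith)

lemma dist_eqI: "(dist p q)\<^sup>2 = c\<^sup>2 \<Longrightarrow> 0 \<le> c \<Longrightarrow> dist p q = c"
  by (simp add: power2_eq_iff_nonneg)

lemma eis_trapezoid_tz: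
  assumes "0 < m" "0 < n" "coprime m n"
  shows "eis_trapezoid (min m n) (max m n) (tz (real m) (real n))"
proof (cases "n \<le> m")
  case True
  define M N where "M = real m" and "N = real n"
  have MN: "0 < N" "N \<le> M" "real (m - n) = M - N" using assms True by (auto simp: M_def N_def)
  have e: "cx N M \<in> eisenstein" "cx (N - M) M \<in> eisenstein" "cx (2 * N - M) (M - N) \<in> eisenstein"
    by (auto simp: M_def N_def intro!: eisenstein_cxI)
  have d: "dist (cx N M) (cx (N - M) M) = M" "dist (cx (N - M) M) (cx (2 * N - M) (M - N)) = N"
    "dist (cx N (M - N)) (cx N M) = N"
    by (rule dist_eqI; use MN in \<open>simp add: dist_cx\<close>; simp add: power2_eq_square algebra_simps)+
  have "closed_segment (cx N M) (cx (N - M) M) \<subseteq> skeleton"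
    by (rule segment_in_skeleton'[OF e(1), of _ m 3])
       (rule pXY_eqI; simp add: \<alpha>_pow_expand M_def)
  moreover have "closed_segment (cx (N - M) M) (cx (2 * N - M) (M - N)) \<subseteq> skeleton"
    by (rule segment_in_skeleton'[OF e(2), of _ n 5])
       (rule pXY_eqI; simp add: \<alpha>_pow_expand N_def)
  moreover have "closed_segment (cx (2 * N - M) (M - N)) (cx N (M - N)) \<subseteq> skeleton"
    by (rule segment_in_skeleton'[OF e(3), of _ "m - n" 0])
       (rule pXY_eqI; simp add: MN(3))
  moreover have "closed_segment (cx N (M - N)) (cx N M) \<subseteq> skeleton"
    by (rule segment_in_skeleton'(2)[OF e(1), of _ n 4])
       (rule pXY_eqI; simp add: \<alpha>_pow_expand N_def)
  moreover have "\<exists>t\<ge>0. t < 1 \<and> cx (2 * N - M) (M - N) - cx N (M - N) = t *\<^sub>R (cx (N - M) M - cx N M)"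
    using MN by (intro exI[of _ "(M - N) / M"]) (auto simp: cx_arith field_simps)
  moreover have "\<not> collinear {cx N M, cx (N - M) M, cx N (M - N)}"
    unfolding collinear_iff using MN by (auto simp: cx_arith)
  moreover have "tz (real m) (real n) = (cx N M, cx (N - M) M, cx (2 * N - M) (M - N), cx N (M - N))"
    using True by (simp add: tz_def M_def N_def)
  moreover have "min m n = n" "max m n = m" using True by auto
  ultimately show ?thesis
    using assms(3) d by (simp add: coprime_commute flip: M_def N_def)
next
  case False
  define M N where "M = real m" and "N = real n"
  have MN: "0 < M" "M < N" "real (n - m) = N - M" using assms False by (auto simp: M_def N_def)
  have e: "cx N M \<in> eisenstein" "cx N (M - N) \<in> eisenstein" "cx (N - M) (2 * M - N) \<in> eisenstein"
    by (auto simp: M_def N_def intro!: eisenstein_cxI)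
  have d: "dist (cx N M) (cx N (M - N)) = N" "dist (cx N (M - N)) (cx (N - M) (2 * M - N)) = M"
    "dist (cx (N - M) M) (cx N M) = M"
    by (rule dist_eqI; use MN in \<open>simp add: dist_cx\<close>; simp add: power2_eq_square algebra_simps)+
  have "closed_segment (cx N M) (cx N (M - N)) \<subseteq> skeleton"
    by (rule segment_in_skeleton'[OF e(1), of _ n 4])
       (rule pXY_eqI; simp add: \<alpha>_pow_expand N_def)
  moreover have "closed_segment (cx N (M - N)) (cx (N - M) (2 * M - N)) \<subseteq> skeleton"
    by (rule segment_in_skeleton'[OF e(2), of _ m 2])
       (rule pXY_eqI; simp add: \<alpha>_pow_expand M_def)
  moreover have "closed_segment (cx (N - M) (2 * M - N)) (cx (N - M) M) \<subseteq> skeleton"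
    by (rule segment_in_skeleton'[OF e(3), of _ "n - m" 1])
       (rule pXY_eqI; simp add: MN(3))
  moreover have "closed_segment (cx (N - M) M) (cx N M) \<subseteq> skeleton"
    by (rule segment_in_skeleton'(2)[OF e(1), of _ m 3])
       (rule pXY_eqI; simp add: \<alpha>_pow_expand M_def)
  moreover have "\<exists>t\<ge>0. t < 1 \<and> cx (N - M) (2 * M - N) - cx (N - M) M = t *\<^sub>R (cx N (M - N) - cx N M)"
    using MN by (intro exI[of _ "(N - M) / N"]) (auto simp: cx_arith field_simps)
  moreover have "\<not> collinear {cx N M, cx N (M - N), cx (N - M) M}"
    unfolding collinear_iff using MN by (auto simp: cx_arith)
  moreover have "tz (real m) (real n) = (cx N M, cx N (M - N), cx (N - M) (2 * M - N), cx (N - M) M)"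
    using False by (simp add: tz_def M_def N_def)
  moreover have "min m n = m" "max m n = n" using False by auto
  ultimately show ?thesis
    using assms(3) d by (simp add: coprime_commute flip: M_def N_def)
qed

text \<open>Decides both intersection conditions of \<open>necklace\<close>: a trapezoid meets its
  two neighbors in one vertex each and is disjoint from the other three.\<close>

lemma trap_rotated:
  assumes "0 < m" "0 < n" "trap m n X Y"
  shows "trap m n (X + Y) (- X) \<Longrightarrow> X = n - m \<and> Y = m"
    and "\<not> trap m n Y (- X - Y)" "\<not> trap m n (- X) (- Y)" "\<not> trap m n (- X - Y) X"
    and "trap m n (- Y) (X + Y) \<Longrightarrow> X = n \<and> Y = m - n"
  using assms unfolding trap_def min_def by (auto split: if_splits)

lemma region_tzk:
  assumes "0 < m" "0 < n"
  shows "region (tzk m n k) = (*) (\<alpha> ^ k) ` {z. trap (real m) (real n) (pX z) (pY z)}"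
  using assms by (simp add: tzk_def region_map_mult region_tz)

text \<open>The vertex shared by the trapezoids of index 0 and 1.\<close>

definition vtx :: "nat \<Rightarrow> nat \<Rightarrow> complex" where
  "vtx m n = cx (real n - real m) (real m)"

lemma inj_mult_\<alpha>: "inj ((*) (\<alpha> ^ k))" by (auto intro!: injI)

lemma region_tzk_inter:
  assumes "0 < m" "0 < n"
  shows "region (tzk m n k) \<inter> region (tzk m n (Suc k)) = {\<alpha> ^ k * vtx m n}"
proof -
  let ?R = "{z. trap (real m) (real n) (pX z) (pY z)}"
  have "?R \<inter> (*) (\<alpha> ^ 1) ` ?R = {vtx m n}"
  proof -
    have "z = vtx m n" if "trap m n (pX z) (pY z)" "trap m n (pX z + pY z) (- pX z)" for z
      using trap_rotated(1)[OF _ _ that] assms by (simp add: vtx_def pXY_eq_iff)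
    moreover have "trap m n (pX (vtx m n)) (pY (vtx m n))"
      "trap m n (pX (vtx m n) + pY (vtx m n)) (- pX (vtx m n))"
      by (auto simp: vtx_def trap_def)
    ultimately show ?thesis unfolding set_eq_iff Int_iff mem_image_\<alpha> mem_Collect_eq coords_inv_pow by blast
  qed
  then have "(*) (\<alpha> ^ k) ` (?R \<inter> (*) (\<alpha> ^ 1) ` ?R) = {\<alpha> ^ k * vtx m n}" by simp
  moreover have "region (tzk m n (Suc k)) = (*) (\<alpha> ^ k) ` (*) (\<alpha> ^ 1) ` ?R"
    unfolding region_tzk[OF assms] image_mult_mult by (simp add: mult.commute)
  ultimately show ?thesis
    unfolding region_tzk[OF assms, of k] by (simp add: image_Int[OF inj_mult_\<alpha>])
qed

text \<open>Two regions meet in at most two points, and a finite set of points in the plane has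
  empty interior.\<close>

lemma region_tzk_interior:
  assumes "0 < m" "0 < n" "i < j" "j < 6"
  shows "interior (region (tzk m n i)) \<inter> interior (region (tzk m n j)) = {}"
proof -
  let ?R = "{z. trap (real m) (real n) (pX z) (pY z)}"
  have 0: "0 < real m" "0 < real n" using assms by auto
  obtain d where d: "j = i + d" "d \<in> {1,2,3,4,5}"
    using that[of "j - i"] assms by force
  have "?R \<inter> (*) (\<alpha> ^ d) ` ?R \<subseteq> {vtx m n, cx n (real m - real n)}"
  proof
    fix z assume "z \<in> ?R \<inter> (*) (\<alpha> ^ d) ` ?R"
    then have z: "trap m n (pX z) (pY z)" and zd: "trap m n (pX ((1 - \<alpha>) ^ d * z)) (pY ((1 - \<alpha>) ^ d * z))"
      by (auto simp only: mem_image_\<alpha> Int_iff mem_Collect_eq)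
    consider "d = 1" | "d = 2" | "d = 3" | "d = 4" | "d = 5" using d(2) by auto
    then show "z \<in> {vtx m n, cx n (real m - real n)}"
    proof cases
      case 1
      have "pX z = real n - real m \<and> pY z = real m"
        using trap_rotated(1)[OF 0 z] zd[unfolded 1 coords_inv_pow] by blast
      then show ?thesis by (simp add: pXY_eq_iff vtx_def)
    next
      case 5
      have "pX z = real n \<and> pY z = real m - real n"
        using trap_rotated(5)[OF 0 z] zd[unfolded 5 coords_inv_pow] by blast
      then show ?thesis by (simp add: pXY_eq_iff)
    next
      case 2 then show ?thesis using trap_rotated(2)[OF 0 z] zd by (simp only: coords_inv_pow)
    next
      case 3 then show ?thesis using trap_rotated(3)[OF 0 z] zd by (simp only: coords_inv_pow)
    next
      case 4 then show ?thesis using trap_rotated(4)[OF 0 z] zd by (simp only: coords_inv_pow)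
    qed
  qed
  then have "(*) (\<alpha> ^ i) ` (?R \<inter> (*) (\<alpha> ^ d) ` ?R) \<subseteq> (*) (\<alpha> ^ i) ` {vtx m n, cx n (real m - real n)}"
    by blast
  moreover have "region (tzk m n j) = (*) (\<alpha> ^ i) ` (*) (\<alpha> ^ d) ` ?R"
    unfolding region_tzk[OF assms(1,2)] image_mult_mult d(1) by (simp add: power_add)
  ultimately have "region (tzk m n i) \<inter> region (tzk m n j) \<subseteq> (*) (\<alpha> ^ i) ` {vtx m n, cx n (real m - real n)}"
    unfolding region_tzk[OF assms(1,2), of i] by (simp add: image_Int[OF inj_mult_\<alpha>])
  then have "finite (region (tzk m n i) \<inter> region (tzk m n j))"
    by (rule finite_subset) simp
  then have "interior (region (tzk m n i) \<inter> region (tzk m n j)) = {}"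
    by (rule empty_interior_finite)
  then show ?thesis by (simp add: interior_Int)
qed

lemma tzk_Suc: "tzk m n (Suc k) = map_quad ((*) \<alpha>) (tzk m n k)"
  by (simp add: tzk_def map_quad_mult_mult)

lemma vtx_in_verts: "\<alpha> ^ k * vtx m n \<in> verts (tzk m n k)" "\<alpha> ^ k * vtx m n \<in> verts (tzk m n (Suc k))"
proof -
  have "vtx m n \<in> verts (tz m n)" by (auto simp: tz_def vtx_def)
  then show "\<alpha> ^ k * vtx m n \<in> verts (tzk m n k)" by (simp add: tzk_def verts_map_mult)
  have "vtx m n \<in> verts (map_quad ((*) \<alpha>) (tz m n))" by (auto simp: tz_def vtx_def \<alpha>_mult_cx)
  then have "\<alpha> ^ k * vtx m n \<in> (*) (\<alpha> ^ k) ` (*) \<alpha> ` verts (tz m n)" by (simp add: verts_map_mult)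
  then show "\<alpha> ^ k * vtx m n \<in> verts (tzk m n (Suc k))"
    unfolding image_mult_mult by (simp add: tzk_def verts_map_mult mult.commute)
qed

lemma necklace_tzk:
  assumes "0 < m" "0 < n" "coprime m n"
  shows "necklace 0 (min m n) (max m n) (tzk m n)"
  unfolding necklace_def
proof (intro conjI allI impI)
  show "eis_trapezoid (min m n) (max m n) (tzk m n i)" for i
    unfolding tzk_def by (intro eis_trapezoid_mult eis_trapezoid_tz assms)
  show "\<exists>\<rho>\<in>{\<alpha>, cnj \<alpha>}. \<forall>i. tzk m n (Suc i) = map_quad (\<lambda>z. 0 + \<rho> * (z - 0)) (tzk m n i)"
    by (intro bexI[of _ \<alpha>]) (auto simp: tzk_Suc)
  show "interior (region (tzk m n i)) \<inter> interior (region (tzk m n j)) = {}" if "i < 6" "j < 6" "i \<noteq> j" for i j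
    using region_tzk_interior[OF assms(1,2)] that by (metis Int_commute linorder_neqE_nat)
  show "\<exists>v\<in>verts (tzk m n i) \<inter> verts (tzk m n (Suc i)). region (tzk m n i) \<inter> region (tzk m n (Suc i)) = {v}" for i
    using region_tzk_inter[OF assms(1,2)] vtx_in_verts by blast
qed

lemma std_necklace_eq:
  assumes "a \<le> b"
  shows "std_necklace a b = tzk b a"
proof
  fix k
  have "tz (real b) (real a) = (let a = of_nat a; b = of_nat b in
       (a + b * \<alpha>, (a - b) + b * \<alpha>, (2 * a - b) + (b - a) * \<alpha>, a + (b - a) * \<alpha>))"
    using assms by (simp add: tz_def cx_def Let_def)
  then show "std_necklace a b k = tzk b a k" by (simp add: std_necklace_def tzk_def)
qed

section \<open>The map from a necklace to the next one\<close>

text \<open>The components keep their places, since their order encodes the orientation of the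
  trapezoids. The last necklace (1, 1) is sent to (0, 1), whose star is the central hexagon.\<close>

fun nxt :: "nat \<times> nat \<Rightarrow> nat \<times> nat" where
  "nxt (m, n) = (if n \<le> m then (m - n, n) else (m, n - m))"

definition starset :: "nat \<times> nat \<Rightarrow> complex set" where
  "starset mn = {z. star (real (fst mn)) (real (snd mn)) (pX z) (pY z)}"

definition ostarset :: "nat \<times> nat \<Rightarrow> complex set" where
  "ostarset mn = {z. ostar (real (fst mn)) (real (snd mn)) (pX z) (pY z)}"

lemma continuous_pX [continuous_intros]: "continuous_on S pX"
  and continuous_pY [continuous_intros]: "continuous_on S pY"
  unfolding pX_def pY_def by (intro continuous_intros; simp)+

lemma closed_starset: "closed (starset mn)"
  unfolding starset_def star_def
  by (intro closed_Collect_conj closed_Collect_disj closed_Collect_le continuous_intros)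

lemma open_ostarset: "open (ostarset mn)"
  unfolding ostarset_def ostar_def
  by (intro open_Collect_conj open_Collect_disj open_Collect_less continuous_intros)

lemma norm_starset: "z \<in> starset (m, n) \<Longrightarrow> (norm z)\<^sup>2 \<le> real m ^ 2 + real m * real n + real n ^ 2"
  unfolding starset_def norm_sq by (auto intro: star_norm_bound)

lemma bounded_starset: "bounded (starset mn)"
proof -
  obtain m n where mn: "mn = (m, n)" by (cases mn)
  have "norm z \<le> sqrt (real m ^ 2 + real m * real n + real n ^ 2)" if "z \<in> starset mn" for z
    using norm_starset that mn by (intro real_le_rsqrt) auto
  then show ?thesis by (auto simp: bounded_iff)
qed

lemma starset_mono: "m \<le> m' \<Longrightarrow> n \<le> n' \<Longrightarrow> starset (m, n) \<subseteq> starset (m', n')"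
  by (auto simp: starset_def intro: star_mono)

lemma starset_nxt: "starset (nxt mn) \<subseteq> starset mn"
  by (cases mn) (simp add: starset_mono)

lemma ostarset_subset: "ostarset mn \<subseteq> starset mn"
  unfolding starset_def ostarset_def star_def ostar_def by (simp add: Collect_mono_iff) (meson less_imp_le)

lemma star_scale:
  assumes "star m n ((1 + d) * X) ((1 + d) * Y)" "0 < d" "0 < m" "0 < n"
  shows "ostar m n X Y"
proof -
  have key: "y < c" if "(1 + d) * y \<le> c" "0 < c" for c y
  proof (cases "0 < y")
    case True
    then have "y < (1 + d) * y" using assms(2) by (simp add: distrib_right)
    then show ?thesis using that by linarith
  qed (use that in linarith)
  have e: "(1 + d) * X + (1 + d) * Y = (1 + d) * (X + Y)" "- ((1 + d) * X) = (1 + d) * (- X)"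
    "- ((1 + d) * Y) = (1 + d) * (- Y)" "- ((1 + d) * (X + Y)) = (1 + d) * (- (X + Y))"
    by (simp_all add: algebra_simps)
  show ?thesis
    using assms(1) key[OF _ assms(3)] key[OF _ assms(4)] unfolding star_def ostar_def e by blast
qed

text \<open>A neighborhood of z inside the star also contains a slight radial enlargement of z;
  scaling back makes all the inequalities strict.\<close>

lemma interior_starset:
  assumes "0 < fst mn" "0 < snd mn"
  shows "interior (starset mn) \<subseteq> ostarset mn"
proof
  fix z assume "z \<in> interior (starset mn)"
  then obtain e where e: "0 < e" "ball z e \<subseteq> starset mn" by (auto simp: mem_interior)
  \<comment> \<open>Chosen so that (1 + d) z stays within distance e/2 of z; adding 1 covers z =
    0.\<close>
  define d where "d = e / (2 * (norm z + 1))"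
  have d: "0 < d" unfolding d_def using e by (simp add: add_nonneg_pos)
  have "d * norm z < e"
  proof -
    have "d * norm z \<le> d * (norm z + 1)" using d by simp
    also have "\<dots> = e / 2" unfolding d_def by (simp add: field_simps add_nonneg_eq_0_iff)
    finally show ?thesis using e by linarith
  qed
  moreover have "dist z ((1 + d) *\<^sub>R z) = d * norm z"
    using d by (simp add: dist_norm scaleR_left_distrib)
  ultimately have "(1 + d) *\<^sub>R z \<in> starset mn" using e by auto
  then show "z \<in> ostarset mn"
    using star_scale[OF _ d] assms by (simp add: starset_def ostarset_def)
qed

lemma carrier_rotations:
  assumes "\<rho> \<in> {\<alpha>, cnj \<alpha>}" "\<And>i. X (Suc i) = map_quad ((*) \<rho>) (X i)"
    "region (X 0) = region (tzk m n k)" "0 < m" "0 < n"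
  shows "carrier X = starset (m, n) - ostarset (nxt (m, n))"
proof -
  let ?R = "{z. trap (real m) (real n) (pX z) (pY z)}"
  have "region (X i) = (*) (\<rho> ^ i * \<alpha> ^ k) ` ?R" for i
  proof (induction i)
    case 0
    then show ?case using assms(3) by (simp add: region_tzk assms)
  next
    case (Suc i)
    then show ?case unfolding assms(2) region_map_mult Suc image_mult_mult by (simp add: mult.assoc)
  qed
  then have "carrier X = \<Union> ((\<lambda>w. (*) w ` ?R) ` (\<lambda>i. \<rho> ^ i * \<alpha> ^ k) ` {..<6})"
    by (auto simp: carrier_def)
  also have "\<dots> = (\<Union>i<6. (*) (\<alpha> ^ i) ` ?R)"
    unfolding \<alpha>_powers[OF assms(1)] by (simp add: image_image)
  also have "\<dots> = {z. traps (real m) (real n) (pX z) (pY z)}" by (rule Union_rotations)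
  also have "\<dots> = starset (m, n) - ostarset (nxt (m, n))"
  proof (cases "n \<le> m")
    case True
    then show ?thesis using assms traps_eq_ge[of "real n" "real m"]
      by (auto simp: starset_def ostarset_def of_nat_diff)
  next
    case False
    then show ?thesis using assms traps_eq_less[of "real m" "real n"]
      by (auto simp: starset_def ostarset_def of_nat_diff)
  qed
  finally show ?thesis .
qed

lemma carrier_tzk: "0 < m \<Longrightarrow> 0 < n \<Longrightarrow> carrier (tzk m n) = starset (m, n) - ostarset (nxt (m, n))"
  by (rule carrier_rotations[of \<alpha> _ _ _ 0]) (auto simp: tzk_Suc)

text \<open>The open inner star and the exterior of the outer one separate the complement of the necklace,
  so components meeting the inner star are bounded.\<close>

lemma ostarset_subset_inside:
  assumes "S = starset mn - ostarset (nxt mn)"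
  shows "ostarset (nxt mn) \<subseteq> inside S"
proof
  fix z assume z: "z \<in> ostarset (nxt mn)"
  define C where "C = connected_component_set (- S) z"
  have sub: "ostarset (nxt mn) \<subseteq> starset mn" using ostarset_subset starset_nxt by blast
  have zS: "z \<in> - S" using z assms by auto
  have "connected C" by (simp add: C_def)
  moreover have "C \<subseteq> - S" unfolding C_def by (rule connected_component_subset)
  then have "C \<subseteq> ostarset (nxt mn) \<union> - starset mn" using assms by auto
  moreover have "z \<in> C" unfolding C_def using zS by (simp add: connected_component_refl)
  moreover have "open (- starset mn)" using closed_starset by (simp add: open_Compl)
  ultimately have "- starset mn \<inter> C = {}"
    using connectedD[of C "ostarset (nxt mn)" "- starset mn"] z sub open_ostarset by auto
  then have "C \<subseteq> starset mn" by auto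
  then have "bounded C" using bounded_starset bounded_subset by blast
  then show "z \<in> inside S" using zS by (auto simp: inside_def C_def)
qed

section \<open>Existence of the next necklace\<close>

lemma slow_gauss_nxt:
  assumes "0 < m" "0 < n" "m \<noteq> n" "nxt (m, n) = (m', n')"
  shows "real (min m' n') / real (max m' n') = slow_gauss (real (min m n) / real (max m n))"
proof -
  have *: "slow_gauss (real k / real l) = real (min k (l - k)) / real (max k (l - k))" if "0 < k" "k < l" for k l
  proof -
    have "1 / (real k / real l) - 1 = real (l - k) / real k" using that by (simp add: field_simps of_nat_diff)
    then show ?thesis using that by (cases "l - k \<le> k") (auto simp: slow_gauss_def divide_le_eq)
  qed
  show ?thesis
  proof (cases "n \<le> m")
    case True
    then show ?thesis using assms *[of n m] by (auto simp: min.commute max.commute)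
  next
    case False
    then show ?thesis using assms *[of m n] by (auto simp: min.commute max.commute)
  qed
qed

text \<open>Index of the trapezoid of the next necklace that sits in the corner between the
  trapezoids 0 and 1 of the present one.\<close>

definition shift :: "nat \<Rightarrow> nat \<Rightarrow> nat" where "shift m n = (if n < m then 1 else 0)"

lemma tzk_gt:
  assumes "n < m"
  defines "M \<equiv> real m" and "N \<equiv> real n"
  shows "tzk m n 0 = (cx N M, cx (N - M) M, cx (2 * N - M) (M - N), cx N (M - N))"
    and "tzk m n 1 = (cx (- M) (N + M), cx (- M) N, cx (N - M) N, cx (N - M) M)"
    and "n \<le> m - n \<Longrightarrow> tzk (m - n) n 1 =
       (cx (N - M) M, cx (N - M) N, cx (2 * N - M) N, cx (2 * N - M) (M - N))"
    and "m - n < n \<Longrightarrow> tzk (m - n) n 1 =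
       (cx (N - M) M, cx (2 * N - M) (M - N), cx (3 * N - 2 * M) (M - N), cx (N - M) N)"
  using assms by (auto simp add: tzk_def tz_def \<alpha>_mult_cx of_nat_diff)

lemma tzk_less:
  assumes "m < n"
  defines "M \<equiv> real m" and "N \<equiv> real n"
  shows "tzk m n 0 = (cx N M, cx N (M - N), cx (N - M) (2 * M - N), cx (N - M) M)"
    and "tzk m n 1 = (cx (- M) (N + M), cx (N - M) M, cx (N - 2 * M) M, cx (- M) N)"
    and "n - m \<le> m \<Longrightarrow> tzk m (n - m) 0 =
       (cx (N - M) M, cx (N - 2 * M) M, cx (2 * N - 3 * M) (2 * M - N), cx (N - M) (2 * M - N))"
    and "m < n - m \<Longrightarrow> tzk m (n - m) 0 =
       (cx (N - M) M, cx (N - M) (2 * M - N), cx (N - 2 * M) (3 * M - N), cx (N - 2 * M) M)"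
  using assms by (auto simp add: tzk_def tz_def \<alpha>_mult_cx of_nat_diff)

lemma segment_in_sides:
  assumes "closed_segment p q \<in> sides (A, B, C, D)"
  shows "(p, q) \<in> {(A, B), (B, A), (B, C), (C, B), (C, D), (D, C), (D, A), (A, D)}"
  using assms by (auto simp: doubleton_eq_iff)

lemma sides_nxt:
  assumes "0 < m" "0 < n" "m \<noteq> n" "nxt (m, n) = (m', n')"
  shows "top_side (tzk m' n' (shift m n)) \<in> sides (tzk m n 0) \<and>
           diagonal_sides (tzk m' n' (shift m n)) \<inter> sides (tzk m n 1) \<noteq> {}
       \<or> top_side (tzk m' n' (shift m n)) \<in> sides (tzk m n 1) \<and>
           diagonal_sides (tzk m' n' (shift m n)) \<inter> sides (tzk m n 0) \<noteq> {}"
proof (cases "n < m")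
  case True
  then have [simp]: "m' = m - n" "n' = n" "shift m n = 1" using assms by (auto simp: shift_def)
  show ?thesis
  proof (cases "n \<le> m - n")
    case t: True
    show ?thesis by (simp only: tzk_gt(1,2)[OF True] tzk_gt(3)[OF True t] \<open>m' = m - n\<close> \<open>n' = n\<close>  \<open>shift m n = 1\<close>)
       (simp del: closed_segment_eq add: closed_segment_commute)
  next
    case t: False
    then have t: "m - n < n" by simp
    show ?thesis by (simp only: tzk_gt(1,2)[OF True] tzk_gt(4)[OF True t] \<open>m' = m - n\<close> \<open>n' = n\<close>  \<open>shift m n = 1\<close>)
       (simp del: closed_segment_eq add: closed_segment_commute)
  qed
next
  case False
  then have less: "m < n" using assms by simp
  then have eqs: "m' = m" "n' = n - m" "shift m n = 0" using assms by (auto simp: shift_def)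
  show ?thesis
  proof (cases "n - m \<le> m")
    case t: True
    show ?thesis by (simp only: tzk_less(1,2)[OF less] tzk_less(3)[OF less t] eqs)
       (simp del: closed_segment_eq add: closed_segment_commute)
  next
    case t: False
    then have t: "m < n - m" by simp
    show ?thesis by (simp only: tzk_less(1,2)[OF less] tzk_less(4)[OF less t] eqs)
       (simp del: closed_segment_eq add: closed_segment_commute)
  qed
qed

lemma tzk_add: "tzk m n (k + j) = map_quad ((*) (\<alpha> ^ k)) (tzk m n j)"
  by (simp add: tzk_def map_quad_mult_mult power_add)

lemma tzk_mod: "tzk m n (k + 6) = tzk m n k"
  by (simp add: tzk_def power_add \<alpha>_pow6)

lemma coprime_nxt:
  assumes "coprime m n" "nxt (m, n) = (m', n')"
  shows "coprime m' n'"
proof (cases "n \<le> m")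
  case True
  then show ?thesis using assms gcd_diff1_nat[of n m] by (auto simp: coprime_iff_gcd_eq_1)
next
  case False
  then show ?thesis using assms gcd_diff1_nat[of m n] by (auto simp: coprime_iff_gcd_eq_1 gcd.commute)
qed

text \<open>By rotation the condition on sides has to be checked in one corner only, which is
  \<open>sides_nxt\<close>; the inclusion in the inside holds because the next necklace fills part
  of the inner star.\<close>

lemma gauss_necklace_tzk:
  assumes "0 < m" "0 < n" "m \<noteq> n" "coprime m n" "nxt (m, n) = (m', n')"
  shows "gauss_necklace 0 (tzk m n) (tzk m' n')"
proof -
  have pos: "0 < m'" "0 < n'" using assms by (auto split: if_splits)
  have cop: "coprime m' n'" using coprime_nxt assms(4,5) by metis
  have "real (min m n) / real (max m n) \<noteq> 1" using assms by (auto simp: min_def max_def)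
  moreover have "interior (region (tzk m' n' i)) \<subseteq> inside (carrier (tzk m n))" for i
  proof -
    have "region (tzk m' n' i) \<subseteq> carrier (tzk m' n')"
    proof -
      have "tzk m' n' i = tzk m' n' (i mod 6)" by (simp add: tzk_def \<alpha>_pow_mod)
      then show ?thesis unfolding carrier_def by (metis UN_upper lessThan_iff mod_less_divisor zero_less_numeral)
    qed
    then have "region (tzk m' n' i) \<subseteq> starset (m', n')" unfolding carrier_tzk[OF pos] by blast
    then have "interior (region (tzk m' n' i)) \<subseteq> ostarset (m', n')"
      using interior_starset[of "(m', n')"] pos interior_mono[of "region (tzk m' n' i)" "starset (m', n')"]
      by (simp only: fst_conv snd_conv) blast
    then show ?thesis
      using ostarset_subset_inside[OF carrier_tzk[OF assms(1,2)]] unfolding assms(5) by blast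
  qed
  moreover have "\<exists>j j'. (j' = Suc j \<or> j = Suc j') \<and> top_side (tzk m' n' i) \<in> sides (tzk m n j) \<and>
      diagonal_sides (tzk m' n' i) \<inter> sides (tzk m n j') \<noteq> {}" for i
  proof -
    \<comment> \<open>Makes l + \<open>shift m n\<close> congruent to i modulo 6; adding 5 stands
      for subtracting 1.\<close>
    define l where "l = (if n < m then i + 5 else i)"
    let ?f = "\<lambda>S. (*) (\<alpha> ^ l) ` S"
    have Y: "tzk m' n' i = map_quad ((*) (\<alpha> ^ l)) (tzk m' n' (shift m n))"
      using tzk_add[of m' n' l "shift m n"] tzk_mod[of m' n' i] by (auto simp: l_def shift_def add.commute)
    have X: "tzk m n l = map_quad ((*) (\<alpha> ^ l)) (tzk m n 0)" "tzk m n (Suc l) = map_quad ((*) (\<alpha> ^ l)) (tzk m n 1)"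
      using tzk_add[of m n l 0] tzk_add[of m n l 1] by simp_all
    from sides_nxt[OF assms(1-3,5)] show ?thesis
    proof
      assume "top_side (tzk m' n' (shift m n)) \<in> sides (tzk m n 0) \<and>
           diagonal_sides (tzk m' n' (shift m n)) \<inter> sides (tzk m n 1) \<noteq> {}"
      then have "top_side (tzk m' n' i) \<in> sides (tzk m n l) \<and>
           diagonal_sides (tzk m' n' i) \<inter> sides (tzk m n (Suc l)) \<noteq> {}"
        unfolding Y X sides_map_mult diagonal_sides_map_mult top_side_map_mult by blast
      then show ?thesis by blast
    next
      assume "top_side (tzk m' n' (shift m n)) \<in> sides (tzk m n 1) \<and>
           diagonal_sides (tzk m' n' (shift m n)) \<inter> sides (tzk m n 0) \<noteq> {}"
      then have "top_side (tzk m' n' i) \<in> sides (tzk m n (Suc l)) \<and>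
           diagonal_sides (tzk m' n' i) \<inter> sides (tzk m n l) \<noteq> {}"
        unfolding Y X sides_map_mult diagonal_sides_map_mult top_side_map_mult by blast
      then show ?thesis by blast
    qed
  qed
  ultimately show ?thesis
    unfolding gauss_necklace_def
    using necklace_tzk[OF assms(1,2,4)] necklace_tzk[OF pos cop] slow_gauss_nxt[OF assms(1-3,5)]
    by blast
qed

section \<open>Uniqueness of the next necklace\<close>

lemma square_solve: "0 < k \<Longrightarrow> k * k = k * d \<Longrightarrow> k = (d :: real)" by simp

lemma dist_coords: "(dist p q)\<^sup>2 = (pX p - pX q)\<^sup>2 + (pX p - pX q) * (pY p - pY q) + (pY p - pY q)\<^sup>2"
  unfolding dist_norm norm_sq by simp

text \<open>The top and the diagonal side of a trapezoid of \<open>\<gamma>(X)\<close> lie on sides of adjacent trapezoids of \<open>X\<close>,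
  hence meet at their common vertex \<open>v\<close>; lengths and non-collinearity leave one choice of the two
  sides, and equality of the diagonal sides then fixes the fourth vertex.\<close>

lemma gauss_quad_gt:
  assumes "n < m" "0 < n" and T: "eis_trapezoid (min (m - n) n) (max (m - n) n) (p, q, r, s)"
    and sides: "closed_segment p q \<in> sides (tzk m n 0) \<and> closed_segment s p \<in> sides (tzk m n 1) \<or>
       closed_segment p q \<in> sides (tzk m n 1) \<and> closed_segment s p \<in> sides (tzk m n 0)"
  shows "(p, q, r, s) = tzk (m - n) n 1 \<or> m - n = n \<and> region (p, q, r, s) = region (tzk (m - n) n 1)"
proof -
  define M N where "M = real m" and "N = real n"
  have MN: "0 < N" "N < M" using assms by (auto simp: M_def N_def)
  have len: "dist p q = max (M - N) N" "dist s p = min (M - N) N" "dist q r = min (M - N) N"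
    using T \<open>n < m\<close> by (auto simp: M_def N_def min_def max_def)
  have nc: "\<not> collinear {p, q, s}" using T by simp
  note tz = tzk_gt(1,2)[OF \<open>n < m\<close>, folded M_def N_def]
  define v where "v = cx (N - M) M"
  have d: "dist v (cx N M) = M" "dist v (cx (2 * N - M) (M - N)) = N" "dist v (cx (N - M) N) = M - N"
    "dist v (cx (- M) (N + M)) = N"
    unfolding v_def
    by (rule dist_eqI; use MN in \<open>simp add: dist_cx\<close>; simp add: power2_eq_square algebra_simps)+
  have *: "p = v \<and> (q \<in> {cx N M, cx (2 * N - M) (M - N)} \<and> s \<in> {cx (N - M) N, cx (- M) (N + M)} \<or>
     s \<in> {cx N M, cx (2 * N - M) (M - N)} \<and> q \<in> {cx (N - M) N, cx (- M) (N + M)})"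
    using sides unfolding tz
  proof (elim disjE conjE)
    assume a: "closed_segment p q \<in> sides (cx N M, cx (N - M) M, cx (2 * N - M) (M - N), cx N (M - N))"
      "closed_segment s p \<in> sides (cx (- M) (N + M), cx (- M) N, cx (N - M) N, cx (N - M) M)"
    show ?thesis
      using segment_in_sides[OF a(1)] segment_in_sides[OF a(2)] MN
      by (auto simp: v_def)
  next
    assume a: "closed_segment s p \<in> sides (cx N M, cx (N - M) M, cx (2 * N - M) (M - N), cx N (M - N))"
      "closed_segment p q \<in> sides (cx (- M) (N + M), cx (- M) N, cx (N - M) N, cx (N - M) M)"
    show ?thesis
      using segment_in_sides[OF a(1)] segment_in_sides[OF a(2)] MN
      by (auto simp: v_def)
  qed
  then have [simp]: "p = v" by simp
  have cl: "\<not> collinear {v, q, s}" using nc by simp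
  \<comment> \<open>These two sides leave v in opposite directions on one line, so they cannot be
    the top and a diagonal side. The side of length M is longer than any side of the new
    trapezoid.\<close>
  have "collinear {v, cx (2 * N - M) (M - N), cx (- M) (N + M)}"
    "collinear {v, cx (- M) (N + M), cx (2 * N - M) (M - N)}"
    unfolding collinear_iff v_def by simp_all
  with * cl have **: "q = cx (2 * N - M) (M - N) \<and> s = cx (N - M) N \<or> s = cx (2 * N - M) (M - N) \<and> q = cx (N - M) N"
    using len(1,2) d MN by (auto simp: dist_commute)
  from T obtain t where t: "0 \<le> t" "t < 1" "r - s = t *\<^sub>R (q - p)" by auto
  have "pX (r - s) = pX (t *\<^sub>R (q - v))" "pY (r - s) = pY (t *\<^sub>R (q - v))"
    by (simp_all only: t(3) \<open>p = v\<close>)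
  then have r: "pX r = pX s + t * (pX q - pX v)" "pY r = pY s + t * (pY q - pY v)"
    by (simp_all add: algebra_simps)
  from ** show ?thesis
  proof (elim disjE conjE)
    assume q: "q = cx (2 * N - M) (M - N)" and s: "s = cx (N - M) N"
    have ge: "M - N \<le> N" using len(1) d(2) q by auto
    \<comment> \<open>The difference between the lengths of top and bottom. The equation for the
      second diagonal side is quadratic in k; its root 0 is the parallelogram, which t < 1
      excludes.\<close>
    define k where "k = N * (1 - t)"
    have r': "pX r = 2 * N - M - k" "pY r = k"
      using r by (auto simp: q s v_def k_def algebra_simps)
    have "(dist q r)\<^sup>2 = (M - N)\<^sup>2" using len(3) ge by auto
    then have "k * k = k * (M - N)"
      unfolding dist_coords r' by (simp add: q power2_eq_square algebra_simps)
    moreover have "0 < k" using t MN by (simp add: k_def)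
    ultimately have "k = M - N" by (rule square_solve[rotated])
    then have "r = cx (3 * N - 2 * M) (M - N)" using r' by (intro pXY_eqI) auto
    show ?thesis
    proof (cases "m - n < n")
      case True
      then show ?thesis using tzk_gt(4)[OF \<open>n < m\<close> True, folded M_def N_def] \<open>r = _\<close> q s by (simp add: v_def)
    next
      case False
      then have "M = 2 * N" "m - n = n" using ge \<open>n < m\<close> by (auto simp: M_def N_def)
      then show ?thesis
        using tzk_gt(3)[OF \<open>n < m\<close>, folded M_def N_def] \<open>r = _\<close> q s
        by (simp add: v_def region_def insert_commute)
    qed
  next
    assume s: "s = cx (2 * N - M) (M - N)" and q: "q = cx (N - M) N"
    have ge: "N \<le> M - N" using len(1) d(3) q by auto
    define k where "k = (M - N) * (1 - t)"
    have r': "pX r = 2 * N - M" "pY r = k"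
      using r by (auto simp: q s v_def k_def algebra_simps)
    have "(dist q r)\<^sup>2 = N\<^sup>2" using len(3) ge by auto
    then have "k * k = k * N"
      unfolding dist_coords r' by (simp add: q power2_eq_square algebra_simps)
    moreover have "0 < k" using t MN by (simp add: k_def)
    ultimately have "k = N" by (rule square_solve[rotated])
    then have "r = cx (2 * N - M) N" using r' by (intro pXY_eqI) auto
    moreover have "n \<le> m - n" using ge \<open>n < m\<close> by (auto simp: M_def N_def)
    ultimately show ?thesis using tzk_gt(3)[OF \<open>n < m\<close>, folded M_def N_def] q s by (simp add: v_def)
  qed
qed

text \<open>Mirror image of the preceding case: for m < n the tops of the outer necklace are the
  sides on X = n and its rotations.\<close>

lemma gauss_quad_less:
  assumes "m < n" "0 < m" and T: "eis_trapezoid (min m (n - m)) (max m (n - m)) (p, q, r, s)"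
    and sides: "closed_segment p q \<in> sides (tzk m n 0) \<and> closed_segment s p \<in> sides (tzk m n 1) \<or>
       closed_segment p q \<in> sides (tzk m n 1) \<and> closed_segment s p \<in> sides (tzk m n 0)"
  shows "(p, q, r, s) = tzk m (n - m) 0 \<or> m = n - m \<and> region (p, q, r, s) = region (tzk m (n - m) 0)"
proof -
  define M N where "M = real m" and "N = real n"
  have MN: "0 < M" "M < N" using assms by (auto simp: M_def N_def)
  have len: "dist p q = max M (N - M)" "dist s p = min M (N - M)" "dist q r = min M (N - M)"
    using T \<open>m < n\<close> by (auto simp: M_def N_def min_def max_def)
  have nc: "\<not> collinear {p, q, s}" using T by simp
  note tz = tzk_less(1,2)[OF \<open>m < n\<close>, folded M_def N_def]
  define v where "v = cx (N - M) M"
  have d: "dist v (cx N M) = M" "dist v (cx (N - M) (2 * M - N)) = N - M" "dist v (cx (- M) (N + M)) = N"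
    "dist v (cx (N - 2 * M) M) = M"
    unfolding v_def
    by (rule dist_eqI; use MN in \<open>simp add: dist_cx\<close>; simp add: power2_eq_square algebra_simps)+
  have *: "p = v \<and> (q \<in> {cx N M, cx (N - M) (2 * M - N)} \<and> s \<in> {cx (- M) (N + M), cx (N - 2 * M) M} \<or>
     s \<in> {cx N M, cx (N - M) (2 * M - N)} \<and> q \<in> {cx (- M) (N + M), cx (N - 2 * M) M})"
    using sides unfolding tz
  proof (elim disjE conjE)
    assume a: "closed_segment p q \<in> sides (cx N M, cx N (M - N), cx (N - M) (2 * M - N), cx (N - M) M)"
      "closed_segment s p \<in> sides (cx (- M) (N + M), cx (N - M) M, cx (N - 2 * M) M, cx (- M) N)"
    show ?thesis
      using segment_in_sides[OF a(1)] segment_in_sides[OF a(2)] MN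
      by (auto simp: v_def)
  next
    assume a: "closed_segment s p \<in> sides (cx N M, cx N (M - N), cx (N - M) (2 * M - N), cx (N - M) M)"
      "closed_segment p q \<in> sides (cx (- M) (N + M), cx (N - M) M, cx (N - 2 * M) M, cx (- M) N)"
    show ?thesis
      using segment_in_sides[OF a(1)] segment_in_sides[OF a(2)] MN
      by (auto simp: v_def)
  qed
  then have [simp]: "p = v" by simp
  have cl: "\<not> collinear {v, q, s}" using nc by simp
  have "collinear {v, cx N M, cx (N - 2 * M) M}" "collinear {v, cx (N - 2 * M) M, cx N M}"
    unfolding collinear_iff v_def by simp_all
  with * cl have **: "q = cx (N - 2 * M) M \<and> s = cx (N - M) (2 * M - N) \<or> s = cx (N - 2 * M) M \<and> q = cx (N - M) (2 * M - N)"
    using len(1,2) d MN by (auto simp: dist_commute)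
  from T obtain t where t: "0 \<le> t" "t < 1" "r - s = t *\<^sub>R (q - p)" by auto
  have "pX (r - s) = pX (t *\<^sub>R (q - v))" "pY (r - s) = pY (t *\<^sub>R (q - v))"
    by (simp_all only: t(3) \<open>p = v\<close>)
  then have r: "pX r = pX s + t * (pX q - pX v)" "pY r = pY s + t * (pY q - pY v)"
    by (simp_all add: algebra_simps)
  from ** show ?thesis
  proof (elim disjE conjE)
    assume q: "q = cx (N - 2 * M) M" and s: "s = cx (N - M) (2 * M - N)"
    have ge: "N - M \<le> M" using len(1) d(4) q by auto
    define k where "k = M * (1 - t)"
    have r': "pX r = N - 2 * M + k" "pY r = 2 * M - N"
      using r by (auto simp: q s v_def k_def algebra_simps)
    have "(dist q r)\<^sup>2 = (N - M)\<^sup>2" using len(3) ge by auto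
    then have "k * k = k * (N - M)"
      unfolding dist_coords r' by (simp add: q power2_eq_square algebra_simps)
    moreover have "0 < k" using t MN by (simp add: k_def)
    ultimately have "k = N - M" by (rule square_solve[rotated])
    then have "r = cx (2 * N - 3 * M) (2 * M - N)" using r' by (intro pXY_eqI) auto
    moreover have "n - m \<le> m" using ge \<open>m < n\<close> by (auto simp: M_def N_def)
    ultimately show ?thesis using tzk_less(3)[OF \<open>m < n\<close>, folded M_def N_def] q s by (simp add: v_def)
  next
    assume s: "s = cx (N - 2 * M) M" and q: "q = cx (N - M) (2 * M - N)"
    have ge: "M \<le> N - M" using len(1) d(2) q by auto
    define k where "k = (N - M) * (1 - t)"
    have r': "pX r = N - 2 * M" "pY r = 2 * M - N + k"
      using r by (auto simp: q s v_def k_def algebra_simps)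
    have "(dist q r)\<^sup>2 = M\<^sup>2" using len(3) ge by auto
    then have "k * k = k * M"
      unfolding dist_coords r' by (simp add: q power2_eq_square algebra_simps)
    moreover have "0 < k" using t MN by (simp add: k_def)
    ultimately have "k = M" by (rule square_solve[rotated])
    then have "r = cx (N - 2 * M) (3 * M - N)" using r' by (intro pXY_eqI) auto
    show ?thesis
    proof (cases "m < n - m")
      case True
      then show ?thesis using tzk_less(4)[OF \<open>m < n\<close> True, folded M_def N_def] \<open>r = _\<close> q s by (simp add: v_def)
    next
      case False
      then have "N = 2 * M" "n - m = m" using ge \<open>m < n\<close> by (auto simp: M_def N_def)
      then show ?thesis
        using tzk_less(3)[OF \<open>m < n\<close>, folded M_def N_def] \<open>r = _\<close> q s
        by (simp add: v_def region_def insert_commute)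
    qed
  qed
qed

text \<open>Traverses the same trapezoid in the opposite sense. This exchanges the diagonal sides,
  so the one that lies on a side of the outer necklace may be taken to be \<open>sp\<close>.\<close>

fun rev_quad :: "quad \<Rightarrow> quad" where "rev_quad (p, q, r, s) = (q, p, s, r)"

lemma eis_trapezoid_rev: "eis_trapezoid a b T \<Longrightarrow> eis_trapezoid a b (rev_quad T)"
proof -
  assume *: "eis_trapezoid a b T"
  obtain p q r s where T: "T = (p, q, r, s)" by (cases T)
  from * obtain t where t: "0 \<le> t" "t < 1" "r - s = t *\<^sub>R (q - p)" by (auto simp: T)
  then have st: "s - r = t *\<^sub>R (p - q)" by (metis minus_diff_eq scaleR_minus_right)
  have "r = s + t *\<^sub>R (q - p)" using t(3) by (simp add: algebra_simps)
  then have r: "pX r = pX s + t * (pX q - pX p)" "pY r = pY s + t * (pY q - pY p)" by simp_all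
  have "\<not> collinear {p, q, s}" using * by (simp add: T)
  then have "\<not> collinear {q, p, r}"
    unfolding collinear_iff by (simp add: r) (simp add: algebra_simps)
  then show ?thesis
    using * t st by (auto simp: T dist_commute closed_segment_commute insert_commute)
qed

lemma region_rev [simp]: "region (rev_quad T) = region T"
  by (cases T) (simp add: region_def insert_commute)

lemma sides_rev [simp]: "sides (rev_quad T) = sides T"
proof -
  obtain p q r s where T: "T = (p, q, r, s)" by (cases T)
  show ?thesis
    unfolding T rev_quad.simps sides.simps closed_segment_commute[of q p]
      closed_segment_commute[of p s] closed_segment_commute[of s r] closed_segment_commute[of r q]
    by blast
qed

lemma rev_map_quad: "rev_quad (map_quad f T) = map_quad f (rev_quad T)"
  by (cases T) simp

lemma rev_rev [simp]: "rev_quad (rev_quad T) = T" by (cases T) simp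

text \<open>In aspect ratio 1 the trapezoid is a triangle, any side of which may serve as its top, so only
  its region is determined.\<close>

definition same_quad :: "nat \<Rightarrow> nat \<Rightarrow> nat \<Rightarrow> quad \<Rightarrow> bool" where
  "same_quad m n k T \<longleftrightarrow> T = tzk m n k \<or> T = rev_quad (tzk m n k) \<or> m = n \<and> region T = region (tzk m n k)"

lemma same_quad_region: "same_quad m n k T \<Longrightarrow> region T = region (tzk m n k)"
  by (auto simp: same_quad_def)

lemma same_quad_rev: "same_quad m n k (rev_quad T) \<Longrightarrow> same_quad m n k T"
  unfolding same_quad_def by (metis rev_rev region_rev)

lemma same_quad_map: "same_quad m n k T \<Longrightarrow> same_quad m n (j + k) (map_quad ((*) (\<alpha> ^ j)) T)"
  unfolding same_quad_def by (auto simp: tzk_add rev_map_quad region_map_mult)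

lemma gauss_quad0:
  assumes "0 < m" "0 < n" "m \<noteq> n" "nxt (m, n) = (m', n')" "eis_trapezoid (min m' n') (max m' n') (p, q, r, s)"
    and "closed_segment p q \<in> sides (tzk m n 0) \<and> closed_segment s p \<in> sides (tzk m n 1) \<or>
       closed_segment p q \<in> sides (tzk m n 1) \<and> closed_segment s p \<in> sides (tzk m n 0)"
  shows "same_quad m' n' (shift m n) (p, q, r, s)"
proof (cases "n < m")
  case True
  then have "m' = m - n" "n' = n" using assms by auto
  then show ?thesis
    using gauss_quad_gt[OF True assms(2) _ assms(6), of r] assms(5) True
    by (auto simp: same_quad_def shift_def)
next
  case False
  then have "m < n" using assms by simp
  moreover have "m' = m" "n' = n - m" using assms False by auto
  ultimately show ?thesis
    using gauss_quad_less[OF _ assms(1) _ assms(6), of r] assms(5)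
    by (auto simp: same_quad_def shift_def)
qed

lemma gauss_quad:
  assumes "0 < m" "0 < n" "m \<noteq> n" "nxt (m, n) = (m', n')" "eis_trapezoid (min m' n') (max m' n') T"
    and "top_side T \<in> sides (tzk m n 0) \<and> diagonal_sides T \<inter> sides (tzk m n 1) \<noteq> {} \<or>
       top_side T \<in> sides (tzk m n 1) \<and> diagonal_sides T \<inter> sides (tzk m n 0) \<noteq> {}"
  shows "same_quad m' n' (shift m n) T"
proof -
  obtain p q r s where T: "T = (p, q, r, s)" by (cases T)
  show ?thesis
  proof (cases "closed_segment p q \<in> sides (tzk m n 0) \<and> closed_segment s p \<in> sides (tzk m n 1) \<or>
       closed_segment p q \<in> sides (tzk m n 1) \<and> closed_segment s p \<in> sides (tzk m n 0)")
    case True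
    then show ?thesis using gauss_quad0[OF assms(1-4)] assms(5) T by blast
  next
    case False
    then have "closed_segment q p \<in> sides (tzk m n 0) \<and> closed_segment r q \<in> sides (tzk m n 1) \<or>
       closed_segment q p \<in> sides (tzk m n 1) \<and> closed_segment r q \<in> sides (tzk m n 0)"
      using assms(6) unfolding T by (simp del: closed_segment_eq add: closed_segment_commute) blast
    then have "same_quad m' n' (shift m n) (rev_quad T)"
      using gauss_quad0[OF assms(1-4)] eis_trapezoid_rev[OF assms(5)] unfolding T rev_quad.simps by blast
    then show ?thesis by (rule same_quad_rev)
  qed
qed

text \<open>Knowing \<open>X 0\<close> up to rotation and relabelling is enough, because the
  rotation in \<open>necklace\<close> produces the other trapezoids.\<close>

definition necklace_state :: "nat \<times> nat \<Rightarrow> (nat \<Rightarrow> quad) \<Rightarrow> bool" where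
  "necklace_state mn X \<longleftrightarrow> (case mn of (m, n) \<Rightarrow> 0 < m \<and> 0 < n \<and>
     necklace 0 (min m n) (max m n) X \<and> (\<exists>k. same_quad m n k (X 0)))"

lemma necklace_state_carrier:
  assumes "necklace_state mn X"
  shows "carrier X = starset mn - ostarset (nxt mn)"
proof -
  obtain m n where mn: "mn = (m, n)" by (cases mn)
  from assms obtain \<rho> k where "\<rho> \<in> {\<alpha>, cnj \<alpha>}" "\<And>i. X (Suc i) = map_quad ((*) \<rho>) (X i)" "0 < m" "0 < n"
    "same_quad m n k (X 0)"
    by (auto simp: necklace_state_def mn necklace_def)
  then show ?thesis unfolding mn using same_quad_region by (intro carrier_rotations) blast+
qed

lemma necklace_unique:
  assumes "necklace c a b X" "necklace c' a' b' X"
  shows "a = a' \<and> b = b'"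
proof -
  obtain p q r s where X: "X 0 = (p, q, r, s)" by (cases "X 0")
  have "eis_trapezoid a b (X 0)" "eis_trapezoid a' b' (X 0)" using assms by (simp_all only: necklace_def)
  then show ?thesis by (simp add: X)
qed

lemma coprime_fraction_unique:
  fixes a b c d :: nat
  assumes "coprime a b" "coprime c d" "real a / real b = real c / real d" "0 < b" "0 < d"
  shows "a = c \<and> b = d"
proof -
  have "real a * real d = real c * real b" using assms by (simp add: field_simps)
  then have "a * d = c * b" by (metis of_nat_eq_iff of_nat_mult)
  then show ?thesis using coprime_crossproduct_nat[OF assms(1,2)] by (simp add: mult.commute)
qed

text \<open>Consecutive trapezoids of X are consecutive in the standard necklace, but in reverse
  order if X runs clockwise (e = 5).\<close>

lemma adjacent_sides:
  assumes "\<rho> \<in> {\<alpha>, cnj \<alpha>}" "\<And>i. X (Suc i) = map_quad ((*) \<rho>) (X i)" "m \<noteq> n" "same_quad m n k (X 0)"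
  shows "\<exists>K. sides (X j) = sides (tzk m n K) \<and> sides (X (Suc j)) = sides (tzk m n (Suc K)) \<or>
      sides (X j) = sides (tzk m n (Suc K)) \<and> sides (X (Suc j)) = sides (tzk m n K)"
proof -
  obtain e where e: "\<rho> = \<alpha> ^ e" "e = 1 \<or> e = 5" using assms(1) cnj_\<alpha>(2) by (metis insertE power_one_right singletonD)
  have *: "same_quad m n (e * i + k) (X i)" for i
  proof (induction i)
    case 0
    then show ?case using assms by simp
  next
    case (Suc i)
    then show ?case using same_quad_map[OF Suc, of e] by (simp add: assms(2) e add.assoc)
  qed
  have s: "sides (X i) = sides (tzk m n (e * i + k))" for i
    using *[of i] assms(3) by (auto simp: same_quad_def)
  from e(2) show ?thesis
  proof
    assume "e = 1"
    then show ?thesis using s[of j] s[of "Suc j"] by (intro exI[of _ "j + k"]) simp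
  next
    assume "e = 5"
    have "5 * Suc j + k = 5 * j + k + 5" by simp
    \<comment> \<open>Adding 6 writes the index of \<open>X j\<close> as the successor of that of
      \<open>X (Suc j)\<close>.\<close>
    then have "sides (X j) = sides (tzk m n (5 * j + k + 6))" "sides (X (Suc j)) = sides (tzk m n (5 * j + k + 5))"
      using s[of j] s[of "Suc j"] \<open>e = 5\<close> by (simp_all only: tzk_mod)
    moreover have "Suc (5 * j + k + 5) = 5 * j + k + 6" by simp
    ultimately show ?thesis by metis
  qed
qed

text \<open>Converse to \<open>gauss_necklace_tzk\<close>: every necklace that satisfies the
  relation lies on the expected trapezoids. The length parameters follow from the aspect ratio in
  lowest terms, and only \<open>Y 0\<close> has to be located.\<close>

lemma necklace_state_step:
  assumes "necklace_state (m, n) X" "gauss_necklace 0 X Y"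
  shows "m \<noteq> n" "necklace_state (nxt (m, n)) Y"
proof -
  from assms(1) have mn: "0 < m" "0 < n" "necklace 0 (min m n) (max m n) X" and "\<exists>k. same_quad m n k (X 0)"
    by (auto simp: necklace_state_def)
  then obtain \<rho> k where \<rho>: "\<rho> \<in> {\<alpha>, cnj \<alpha>}" "\<And>i. X (Suc i) = map_quad ((*) \<rho>) (X i)" "same_quad m n k (X 0)"
    by (auto simp: necklace_def)
  from assms(2) obtain a b a' b' where ab: "necklace 0 a b X" "real a / real b \<noteq> 1" "necklace 0 a' b' Y"
     "real a' / real b' = slow_gauss (real a / real b)"
     and "\<exists>j j'. (j' = Suc j \<or> j = Suc j') \<and>
        top_side (Y 0) \<in> sides (X j) \<and> diagonal_sides (Y 0) \<inter> sides (X j') \<noteq> {}"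
    unfolding gauss_necklace_def by blast
  then obtain j j' where j: "j' = Suc j \<or> j = Suc j'" "top_side (Y 0) \<in> sides (X j)"
     "diagonal_sides (Y 0) \<inter> sides (X j') \<noteq> {}" by blast
  have ab_eq: "a = min m n" "b = max m n" using necklace_unique[OF ab(1) mn(3)] by auto
  then show "m \<noteq> n" using ab(2) mn by auto
  obtain m' n' where nxt: "nxt (m, n) = (m', n')" by (cases "nxt (m, n)")
  have pos: "0 < m'" "0 < n'" using nxt mn \<open>m \<noteq> n\<close> by (auto split: if_splits)
  obtain p q r s where Y: "Y 0 = (p, q, r, s)" by (cases "Y 0")
  have eY: "eis_trapezoid a' b' (Y 0)" using ab(3) by (simp only: necklace_def)
  have "eis_trapezoid (min m n) (max m n) (X 0)" using mn(3) by (simp only: necklace_def)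
  then have "coprime m n" by (cases "X 0") (auto simp: min_def max_def coprime_commute split: if_splits)
  then have "coprime m' n'" using coprime_nxt nxt by blast
  then have "coprime (min m' n') (max m' n')" by (auto simp: min_def max_def coprime_commute)
  \<comment> \<open>A zero denominator would give the ratio the value 0 by convention; it would also
    make the top a point, hence p, q, s collinear.\<close>
  moreover have "b' \<noteq> 0"
  proof
    assume "b' = 0"
    then have "p = q" using eY by (simp add: Y)
    then show False using eY by (simp add: Y)
  qed
  moreover have "real a' / real b' = real (min m' n') / real (max m' n')"
    using ab(4) slow_gauss_nxt[OF mn(1,2) \<open>m \<noteq> n\<close> nxt] unfolding ab_eq by simp
  moreover have "coprime a' b'" using eY by (simp add: Y)
  ultimately have a'b': "a' = min m' n'" "b' = max m' n'"
    using coprime_fraction_unique[of a' b' "min m' n'" "max m' n'"] pos by auto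
  obtain K where K: "top_side (Y 0) \<in> sides (tzk m n K) \<and> diagonal_sides (Y 0) \<inter> sides (tzk m n (Suc K)) \<noteq> {} \<or>
       top_side (Y 0) \<in> sides (tzk m n (Suc K)) \<and> diagonal_sides (Y 0) \<inter> sides (tzk m n K) \<noteq> {}"
    using adjacent_sides[OF \<rho>(1,2) \<open>m \<noteq> n\<close> \<rho>(3), of j] adjacent_sides[OF \<rho>(1,2) \<open>m \<noteq> n\<close> \<rho>(3), of j'] j by metis
  \<comment> \<open>The exponent 5K acts as -K and brings the corner between trapezoids K and K + 1
    to the one between 0 and 1.\<close>
  define T where "T = map_quad ((*) (\<alpha> ^ (5 * K))) (Y 0)"
  have T0: "tzk m n 0 = map_quad ((*) (\<alpha> ^ (5 * K))) (tzk m n K)"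
    "tzk m n 1 = map_quad ((*) (\<alpha> ^ (5 * K))) (tzk m n (Suc K))"
  proof -
    have *: "\<alpha> ^ (5 * K) * \<alpha> ^ K = 1"
    proof -
      have "\<alpha> ^ (5 * K) * \<alpha> ^ K = \<alpha> ^ (6 * K)" by (simp flip: power_add)
      then show ?thesis by (simp add: power_mult \<alpha>_pow6)
    qed
    then show "tzk m n 0 = map_quad ((*) (\<alpha> ^ (5 * K))) (tzk m n K)"
      unfolding tzk_def map_quad_mult_mult by simp
    have "\<alpha> ^ (5 * K) * \<alpha> ^ Suc K = \<alpha>"
      using * by (metis mult.assoc mult.commute mult_1_left power_Suc)
    then show "tzk m n 1 = map_quad ((*) (\<alpha> ^ (5 * K))) (tzk m n (Suc K))"
      by (simp only: tzk_def map_quad_mult_mult power_one_right)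
  qed
  have "same_quad m' n' (shift m n) T"
  proof (rule gauss_quad[OF mn(1,2) \<open>m \<noteq> n\<close> nxt])
    show "eis_trapezoid (min m' n') (max m' n') T" using eY a'b' eis_trapezoid_mult by (simp add: T_def)
    show "top_side T \<in> sides (tzk m n 0) \<and> diagonal_sides T \<inter> sides (tzk m n 1) \<noteq> {} \<or>
       top_side T \<in> sides (tzk m n 1) \<and> diagonal_sides T \<inter> sides (tzk m n 0) \<noteq> {}"
      unfolding T0 T_def sides_map_mult diagonal_sides_map_mult top_side_map_mult using K by blast
  qed
  then have "same_quad m' n' (K + shift m n) (map_quad ((*) (\<alpha> ^ K)) T)" by (rule same_quad_map)
  moreover have "map_quad ((*) (\<alpha> ^ K)) T = Y 0"
  proof -
    have "\<alpha> ^ K * \<alpha> ^ (5 * K) = \<alpha> ^ (6 * K)" by (simp flip: power_add)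
    then have "\<alpha> ^ K * \<alpha> ^ (5 * K) = 1" by (simp add: power_mult \<alpha>_pow6)
    then show ?thesis unfolding T_def map_quad_mult_mult by (simp add: Y)
  qed
  ultimately show "necklace_state (nxt (m, n)) Y"
    unfolding nxt necklace_state_def using ab(3) a'b' pos by auto
qed

section \<open>The chain of necklaces of a flower\<close>

definition layer :: "nat \<Rightarrow> nat \<Rightarrow> nat \<Rightarrow> nat \<times> nat" where
  "layer a b k = (nxt ^^ k) (b, a)"

definition alive :: "nat \<times> nat \<Rightarrow> bool" where
  "alive mn \<longleftrightarrow> 0 < fst mn \<and> 0 < snd mn"

lemma layer_0 [simp]: "layer a b 0 = (b, a)" and layer_Suc: "layer a b (Suc k) = nxt (layer a b k)"
  by (simp_all add: layer_def)

lemma alive_nxt: "alive (nxt mn) \<Longrightarrow> alive mn \<and> fst mn \<noteq> snd mn"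
  by (cases mn) (auto simp: alive_def split: if_splits)

lemma coprime_layer: "coprime a b \<Longrightarrow> coprime (fst (layer a b k)) (snd (layer a b k))"
proof (induction k)
  case (Suc k)
  then show ?case unfolding layer_Suc
    by (metis coprime_nxt prod.collapse)
qed (simp add: coprime_commute)

lemma flower_layer_state:
  assumes "flower_layer a b k X" "0 < a" "a < b" "coprime a b"
  shows "necklace_state (layer a b k) X"
  using assms
proof (induction rule: flower_layer.induct)
  case outer
  then show ?case
    using necklace_tzk[of b a] by (auto simp: necklace_state_def std_necklace_eq same_quad_def coprime_commute)
next
  case (inner k X Y)
  then show ?case unfolding layer_Suc by (metis necklace_state_step(2) prod.collapse)
qed

lemma flower_layer_tzk:
  assumes "0 < a" "a < b" "coprime a b" "alive (layer a b k)"
  shows "flower_layer a b k (tzk (fst (layer a b k)) (snd (layer a b k)))"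
  using assms(4)
proof (induction k)
  case 0
  then show ?case using flower_layer.outer[of a b] assms(2) by (simp add: std_necklace_eq)
next
  case (Suc k)
  from Suc.prems have *: "alive (layer a b k)" "fst (layer a b k) \<noteq> snd (layer a b k)"
    using alive_nxt unfolding layer_Suc by auto
  have "gauss_necklace 0 (tzk (fst (layer a b k)) (snd (layer a b k))) (tzk (fst (layer a b (Suc k))) (snd (layer a b (Suc k))))"
    by (rule gauss_necklace_tzk) (use * coprime_layer[OF assms(3)] in \<open>auto simp: alive_def layer_Suc\<close>)
  then show ?case using Suc.IH[OF *(1)] by (rule flower_layer.inner[rotated])
qed

text \<open>Eliminates the necklaces from the coloring: the quantifier over X becomes a statement
  about an explicit point set. The predicate P will say that the set contains a given translated
  face.\<close>

lemma flower_layer_carriers: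
  assumes "0 < a" "a < b" "coprime a b"
  shows "(\<exists>X. flower_layer a b k X \<and> P (carrier X)) \<longleftrightarrow>
     alive (layer a b k) \<and> P (starset (layer a b k) - ostarset (layer a b (Suc k)))"
proof
  assume "\<exists>X. flower_layer a b k X \<and> P (carrier X)"
  then obtain X where X: "flower_layer a b k X" "P (carrier X)" by blast
  have "necklace_state (layer a b k) X" using flower_layer_state X(1) assms by blast
  moreover from this have "alive (layer a b k)" by (auto simp: necklace_state_def alive_def)
  ultimately show "alive (layer a b k) \<and> P (starset (layer a b k) - ostarset (layer a b (Suc k)))"
    using X(2) necklace_state_carrier by (simp add: layer_Suc)
next
  assume *: "alive (layer a b k) \<and> P (starset (layer a b k) - ostarset (layer a b (Suc k)))"
  then have "carrier (tzk (fst (layer a b k)) (snd (layer a b k))) = starset (layer a b k) - ostarset (layer a b (Suc k))"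
    using carrier_tzk[of "fst (layer a b k)" "snd (layer a b k)"]
    by (simp add: alive_def layer_Suc del: nxt.simps)
  then show "\<exists>X. flower_layer a b k X \<and> P (carrier X)"
    using flower_layer_tzk[OF assms] * by metis
qed

section \<open>Faces and centroids\<close>

text \<open>The unit rhombus with lower left corner i + j\<alpha> consists of an upward triangle (s
  = 0) and a downward one (s = 1).\<close>

definition tile :: "int \<Rightarrow> int \<Rightarrow> int \<Rightarrow> complex set" where
  "tile i j s = {z. i \<le> pX z \<and> pX z \<le> i + 1 \<and> j \<le> pY z \<and> pY z \<le> j + 1 \<and>
     i + j + s \<le> pX z + pY z \<and> pX z + pY z \<le> i + j + s + 1}"

definition centroid :: "int \<Rightarrow> int \<Rightarrow> int \<Rightarrow> complex" where
  "centroid i j s = cx (i + (1 + s) / 3) (j + (1 + s) / 3)"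

text \<open>A relation rather than a function, since a face arises from any of its three corners; it
  turns out to be one-to-one.\<close>

definition face_centroid :: "complex set \<Rightarrow> complex \<Rightarrow> bool" where
  "face_centroid t c \<longleftrightarrow> (\<exists>v k. v \<in> eisenstein \<and> t = convex hull {v, v + \<alpha> ^ k, v + \<alpha> ^ Suc k} \<and>
     c = v + (\<alpha> ^ k + \<alpha> ^ Suc k) / 3)"

lemma hull_up: "convex hull {cx i j, cx (i + 1) j, cx i (j + 1)} = tile i j 0" for i j :: int
proof -
  have "z \<in> tile i j 0" if "0 \<le> u" "0 \<le> v" "0 \<le> w" "u + v + w = 1"
    "z = u *\<^sub>R cx i j + v *\<^sub>R cx (i + 1) j + w *\<^sub>R cx i (j + 1)" for u v w z
  proof -
    have "pX z = (u + v + w) * i + v" "pY z = (u + v + w) * j + w" using that(5) by (simp_all add: algebra_simps)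
    then show ?thesis using that by (simp add: tile_def)
  qed
  moreover have "\<exists>u v w. 0 \<le> u \<and> 0 \<le> v \<and> 0 \<le> w \<and> u + v + w = 1 \<and>
      z = u *\<^sub>R cx i j + v *\<^sub>R cx (i + 1) j + w *\<^sub>R cx i (j + 1)" if "z \<in> tile i j 0" for z
    using that
    by (intro exI[of _ "1 - (pX z - i) - (pY z - j)"] exI[of _ "pX z - i"] exI[of _ "pY z - j"])
       (auto simp: tile_def pXY_eq_iff algebra_simps)
  ultimately show ?thesis unfolding convex_hull_3 by blast
qed

lemma hull_down: "convex hull {cx (i + 1) j, cx i (j + 1), cx (i + 1) (j + 1)} = tile i j 1" for i j :: int
proof -
  have "z \<in> tile i j 1" if "0 \<le> u" "0 \<le> v" "0 \<le> w" "u + v + w = 1"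
    "z = u *\<^sub>R cx (i + 1) j + v *\<^sub>R cx i (j + 1) + w *\<^sub>R cx (i + 1) (j + 1)" for u v w z
  proof -
    have "pX z = (u + v + w) * i + (u + w)" "pY z = (u + v + w) * j + (v + w)"
      using that(5) by (simp_all add: algebra_simps)
    then show ?thesis using that by (simp add: tile_def)
  qed
  moreover have "\<exists>u v w. 0 \<le> u \<and> 0 \<le> v \<and> 0 \<le> w \<and> u + v + w = 1 \<and>
      z = u *\<^sub>R cx (i + 1) j + v *\<^sub>R cx i (j + 1) + w *\<^sub>R cx (i + 1) (j + 1)" if "z \<in> tile i j 1" for z
    using that
    by (intro exI[of _ "1 - (pY z - j)"] exI[of _ "1 - (pX z - i)"] exI[of _ "(pX z - i) + (pY z - j) - 1"])
       (auto simp: tile_def pXY_eq_iff algebra_simps)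
  ultimately show ?thesis unfolding convex_hull_3 by blast
qed

lemma eisenstein_cx: "v \<in> eisenstein \<longleftrightarrow> (\<exists>i j :: int. v = cx (of_int i) (of_int j))"
  by (auto simp: eisenstein_iff elim!: Ints_cases) (metis cx_pX_pY)

lemma cx_plus_\<alpha>_pow:
  "cx x y + \<alpha> ^ 0 = cx (x + 1) y" "cx x y + \<alpha> ^ 1 = cx x (y + 1)" "cx x y + \<alpha> ^ 2 = cx (x - 1) (y + 1)"
  "cx x y + \<alpha> ^ 3 = cx (x - 1) y" "cx x y + \<alpha> ^ 4 = cx x (y - 1)" "cx x y + \<alpha> ^ 5 = cx (x + 1) (y - 1)"
  by (simp_all only: \<alpha>_pow_expand pXY_eq_iff) auto

text \<open>Even directions k give upward triangles, odd ones downward triangles.\<close>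

lemma face_centroid_iff:
  "face_centroid t c \<longleftrightarrow> (\<exists>i j s. (s = 0 \<or> s = 1) \<and> t = tile i j s \<and> c = centroid i j s)"
proof
  assume "face_centroid t c"
  then obtain v k where v: "v \<in> eisenstein" and tc: "t = convex hull {v, v + \<alpha> ^ k, v + \<alpha> ^ Suc k}" "c = v + (\<alpha> ^ k + \<alpha> ^ Suc k) / 3"
    by (auto simp: face_centroid_def)
  then obtain i j :: int where ij: "v = cx (of_int i) (of_int j)" by (auto simp: eisenstein_cx)
  define d where "d = k mod 6"
  have "\<alpha> ^ Suc k = \<alpha> ^ (Suc d mod 6)" "\<alpha> ^ k = \<alpha> ^ d"
    unfolding d_def by (simp_all only: \<alpha>_pow_mod mod_Suc_eq)
  then have tc: "t = convex hull {cx i j, cx i j + \<alpha> ^ d, cx i j + \<alpha> ^ (Suc d mod 6)}" "c = cx i j + (\<alpha> ^ d + \<alpha> ^ (Suc d mod 6)) / 3"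
    using tc ij by simp_all
  have "d < 6" by (simp add: d_def)
  then consider "d = 0" | "d = 1" | "d = 2" | "d = 3" | "d = 4" | "d = 5" by linarith
  then show "\<exists>i j s. (s = 0 \<or> s = 1) \<and> t = tile i j s \<and> c = centroid i j s"
  proof cases
    case 1
    have "Suc 0 mod 6 = 1" by simp
    with 1 tc have "t = tile i j 0" using hull_up[of i j] by (simp only: cx_plus_\<alpha>_pow of_int_add of_int_1)
    moreover have "c = centroid i j 0"
      by (simp only: tc 1 \<open>Suc 0 mod 6 = 1\<close> \<alpha>_pow_expand) (simp add: pXY_eq_iff centroid_def)
    ultimately show ?thesis by blast
  next
    case 2
    have "Suc 1 mod 6 = 2" by simp
    with 2 tc have "t = tile (i - 1) j 1" using hull_down[of "i - 1" j]
      by (simp only: cx_plus_\<alpha>_pow) (simp add: insert_commute)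
    moreover have "c = centroid (i - 1) j 1"
      by (simp only: tc 2 \<open>Suc 1 mod 6 = 2\<close> \<alpha>_pow_expand) (simp add: pXY_eq_iff centroid_def)
    ultimately show ?thesis by blast
  next
    case 3
    have "Suc 2 mod 6 = 3" by simp
    with 3 tc have "t = tile (i - 1) j 0" using hull_up[of "i - 1" j]
      by (simp only: cx_plus_\<alpha>_pow) (simp add: insert_commute)
    moreover have "c = centroid (i - 1) j 0"
      by (simp only: tc 3 \<open>Suc 2 mod 6 = 3\<close> \<alpha>_pow_expand) (simp add: pXY_eq_iff centroid_def)
    ultimately show ?thesis by blast
  next
    case 4
    have "Suc 3 mod 6 = 4" by simp
    with 4 tc have "t = tile (i - 1) (j - 1) 1" using hull_down[of "i - 1" "j - 1"]
      by (simp only: cx_plus_\<alpha>_pow) (simp add: insert_commute)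
    moreover have "c = centroid (i - 1) (j - 1) 1"
      by (simp only: tc 4 \<open>Suc 3 mod 6 = 4\<close> \<alpha>_pow_expand) (simp add: pXY_eq_iff centroid_def)
    ultimately show ?thesis by blast
  next
    case 5
    have "Suc 4 mod 6 = 5" by simp
    with 5 tc have "t = tile i (j - 1) 0" using hull_up[of i "j - 1"]
      by (simp only: cx_plus_\<alpha>_pow) (simp add: insert_commute)
    moreover have "c = centroid i (j - 1) 0"
      by (simp only: tc 5 \<open>Suc 4 mod 6 = 5\<close> \<alpha>_pow_expand) (simp add: pXY_eq_iff centroid_def)
    ultimately show ?thesis by blast
  next
    case 6
    have "Suc 5 mod 6 = 0" by simp
    with 6 tc have "t = tile i (j - 1) 1" using hull_down[of i "j - 1"]
      by (simp only: cx_plus_\<alpha>_pow) (simp add: insert_commute)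
    moreover have "c = centroid i (j - 1) 1"
      by (simp only: tc 6 \<open>Suc 5 mod 6 = 0\<close> \<alpha>_pow_expand) (simp add: pXY_eq_iff centroid_def)
    ultimately show ?thesis by blast
  qed
next
  assume "\<exists>i j s. (s = 0 \<or> s = 1) \<and> t = tile i j s \<and> c = centroid i j s"
  then obtain i j s where s: "s = 0 \<or> s = 1" and tc: "t = tile i j s" "c = centroid i j s" by blast
  from s show "face_centroid t c"
  proof
    assume s: "s = 0"
    define v where "v = cx (of_int i) (of_int j)"
    have "t = convex hull {v, v + \<alpha> ^ 0, v + \<alpha> ^ 1}"
      using hull_up[of i j] by (simp only: tc s v_def cx_plus_\<alpha>_pow of_int_add of_int_1)
    moreover have "c = v + (\<alpha> ^ 0 + \<alpha> ^ 1) / 3"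
      by (simp only: tc s v_def \<alpha>_pow_expand) (simp add: pXY_eq_iff centroid_def)
    moreover have "v \<in> eisenstein" by (simp add: v_def eisenstein_cxI)
    ultimately show ?thesis unfolding face_centroid_def One_nat_def by blast
  next
    assume s: "s = 1"
    define v where "v = cx (of_int i + 1) (of_int j + 1)"
    have "{v, v + \<alpha> ^ 3, v + \<alpha> ^ 4} = {cx (of_int i + 1) (of_int j), cx (of_int i) (of_int j + 1), v}"
      by (simp only: v_def cx_plus_\<alpha>_pow) (simp add: insert_commute)
    then have "t = convex hull {v, v + \<alpha> ^ 3, v + \<alpha> ^ 4}"
      using hull_down[of i j] by (simp only: tc s v_def of_int_add of_int_1)
    moreover have "c = v + (\<alpha> ^ 3 + \<alpha> ^ 4) / 3"
      by (simp only: tc s v_def \<alpha>_pow_expand) (simp add: pXY_eq_iff centroid_def)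
    moreover have "v \<in> eisenstein" unfolding v_def by (intro eisenstein_cxI Ints_add) auto
    moreover have "4 = Suc 3" by simp
    ultimately show ?thesis unfolding face_centroid_def by metis
  qed
qed

lemma centroid_in_tile: "s = 0 \<or> s = 1 \<Longrightarrow> centroid i j s \<in> tile i j s"
  by (auto simp: tile_def centroid_def)

text \<open>The coordinates X, Y, X + Y of a centroid have fractional part 1/3 or 2/3, so the
  integers on both sides of each are determined.\<close>

lemma centroid_in_tileD:
  assumes "centroid i j s \<in> tile i' j' s'" "s = 0 \<or> s = 1" "s' = 0 \<or> s' = 1"
  shows "i = i' \<and> j = j' \<and> s = s'"
proof -
  from assms(1) have *: "real_of_int i' \<le> i + (1 + s) / 3" "i + (1 + s) / 3 \<le> i' + 1" "real_of_int j' \<le> j + (1 + s) / 3"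
    "j + (1 + s) / 3 \<le> j' + 1" "real_of_int i' + j' + s' \<le> i + j + 2 * (1 + s) / 3" "i + j + 2 * (1 + s) / 3 \<le> i' + j' + s' + 1"
    by (auto simp: tile_def centroid_def)
  have i: "i = i'" using *(1,2) assms(2) by auto
  moreover have j: "j = j'" using *(3,4) assms(2) by auto
  ultimately show ?thesis using *(5,6) assms(2,3) by auto
qed

lemma centroid_inj:
  assumes "centroid i j s = centroid i' j' s'" "s = 0 \<or> s = 1" "s' = 0 \<or> s' = 1"
  shows "i = i' \<and> j = j' \<and> s = s'"
  using assms centroid_in_tileD[of i j s i' j' s'] centroid_in_tile[of s' i' j'] by simp

lemma face_centroid_unique1: "face_centroid t c \<Longrightarrow> face_centroid t c' \<Longrightarrow> c = c'"
  unfolding face_centroid_iff using centroid_in_tile centroid_in_tileD by metis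

lemma face_centroid_unique2: "face_centroid t c \<Longrightarrow> face_centroid t' c \<Longrightarrow> t = t'"
  unfolding face_centroid_iff using centroid_inj by metis

lemma faces_iff: "t \<in> faces \<longleftrightarrow> (\<exists>c. face_centroid t c)"
  unfolding faces_def face_centroid_def by blast

section \<open>Rigid motions, and triangles relative to stars\<close>

definition motion :: "nat \<Rightarrow> complex \<Rightarrow> complex \<Rightarrow> complex" where
  "motion k l z = \<alpha> ^ k * z + l"

lemma motion_image: "motion k l ` S = (+) l ` (*) (\<alpha> ^ k) ` S"
  by (auto simp: motion_def image_image add.commute)

lemma face_centroid_motion:
  assumes "face_centroid t c" "l \<in> eisenstein"
  shows "face_centroid (motion k l ` t) (motion k l c)"
proof -
  from assms obtain v j where v: "v \<in> eisenstein" "t = convex hull {v, v + \<alpha> ^ j, v + \<alpha> ^ Suc j}"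
    "c = v + (\<alpha> ^ j + \<alpha> ^ Suc j) / 3" unfolding face_centroid_def by blast
  have "linear ((*) (\<alpha> ^ k))" by (auto intro!: linearI simp: algebra_simps)
  then have "motion k l ` t = convex hull ((+) l ` (*) (\<alpha> ^ k) ` {v, v + \<alpha> ^ j, v + \<alpha> ^ Suc j})"
    unfolding motion_image v(2) by (simp only: convex_hull_linear_image convex_hull_translation)
  also have "(+) l ` (*) (\<alpha> ^ k) ` {v, v + \<alpha> ^ j, v + \<alpha> ^ Suc j}
      = {motion k l v, motion k l v + \<alpha> ^ (k + j), motion k l v + \<alpha> ^ Suc (k + j)}"
    by (simp add: motion_def power_add algebra_simps)
  finally have "motion k l ` t = convex hull {motion k l v, motion k l v + \<alpha> ^ (k + j), motion k l v + \<alpha> ^ Suc (k + j)}" .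
  moreover have "motion k l c = motion k l v + (\<alpha> ^ (k + j) + \<alpha> ^ Suc (k + j)) / 3"
    by (simp add: v(3) motion_def power_add algebra_simps add_divide_distrib)
  moreover have "motion k l v \<in> eisenstein"
    unfolding motion_def using v assms by (intro eisenstein_closed eisenstein_mult eisenstein_\<alpha>_pow)
  ultimately show ?thesis unfolding face_centroid_def by blast
qed

text \<open>Lines of the tiling do not cut triangles: a closed half-plane bounded by such a line
  contains a triangle as soon as it contains its centroid.\<close>

lemma tile_halfplanes:
  assumes "s = 0 \<or> s = 1" "w \<in> tile i j s"
  shows "pX (centroid i j s) \<le> of_int N \<Longrightarrow> pX w \<le> of_int N" "- pX (centroid i j s) \<le> of_int N \<Longrightarrow> - pX w \<le> of_int N"
    "pY (centroid i j s) \<le> of_int N \<Longrightarrow> pY w \<le> of_int N" "- pY (centroid i j s) \<le> of_int N \<Longrightarrow> - pY w \<le> of_int N"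
    "pX (centroid i j s) + pY (centroid i j s) \<le> of_int N \<Longrightarrow> pX w + pY w \<le> of_int N"
    "- (pX (centroid i j s) + pY (centroid i j s)) \<le> of_int N \<Longrightarrow> - (pX w + pY w) \<le> of_int N"
proof -
  note w = assms(2)[unfolded tile_def mem_Collect_eq]
  show "pX (centroid i j s) \<le> of_int N \<Longrightarrow> pX w \<le> of_int N"
  proof -
    assume "pX (centroid i j s) \<le> of_int N"
    then have "i + 1 \<le> N" using assms(1) by (auto simp: centroid_def; linarith)
    then show ?thesis using w by linarith
  qed
  show "- pX (centroid i j s) \<le> of_int N \<Longrightarrow> - pX w \<le> of_int N"
  proof -
    assume "- pX (centroid i j s) \<le> of_int N"
    then have "- i \<le> N" using assms(1) by (auto simp: centroid_def; linarith)
    then show ?thesis using w by linarith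
  qed
  show "pY (centroid i j s) \<le> of_int N \<Longrightarrow> pY w \<le> of_int N"
  proof -
    assume "pY (centroid i j s) \<le> of_int N"
    then have "j + 1 \<le> N" using assms(1) by (auto simp: centroid_def; linarith)
    then show ?thesis using w by linarith
  qed
  show "- pY (centroid i j s) \<le> of_int N \<Longrightarrow> - pY w \<le> of_int N"
  proof -
    assume "- pY (centroid i j s) \<le> of_int N"
    then have "- j \<le> N" using assms(1) by (auto simp: centroid_def; linarith)
    then show ?thesis using w by linarith
  qed
  show "pX (centroid i j s) + pY (centroid i j s) \<le> of_int N \<Longrightarrow> pX w + pY w \<le> of_int N"
  proof -
    assume "pX (centroid i j s) + pY (centroid i j s) \<le> of_int N"
    then have "i + j + s + 1 \<le> N" using assms(1) by (auto simp: centroid_def; linarith)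
    then show ?thesis using w by linarith
  qed
  show "- (pX (centroid i j s) + pY (centroid i j s)) \<le> of_int N \<Longrightarrow> - (pX w + pY w) \<le> of_int N"
  proof -
    assume "- (pX (centroid i j s) + pY (centroid i j s)) \<le> of_int N"
    then have "- (i + j + s) \<le> N" using assms(1) by (auto simp: centroid_def; linarith)
    then show ?thesis using w by linarith
  qed
qed

lemma tile_star:
  fixes m n :: nat
  assumes "s = 0 \<or> s = 1" "w \<in> tile i j s" "centroid i j s \<in> starset (m, n)"
  shows "w \<in> starset (m, n)"
  using assms(3) tile_halfplanes[OF assms(1,2), of "int m"] tile_halfplanes[OF assms(1,2), of "int n"]
  unfolding starset_def star_def by (simp only: mem_Collect_eq fst_conv snd_conv of_int_of_nat_eq) blast

lemma tile_not_ostar: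
  fixes m n :: nat
  assumes "s = 0 \<or> s = 1" "w \<in> tile i j s" "centroid i j s \<notin> ostarset (m, n)"
  shows "w \<notin> ostarset (m, n)"
proof -
  have *: "- a < b \<longleftrightarrow> \<not> a \<le> - b" "a < b \<longleftrightarrow> \<not> - a \<le> - b" for a b :: real by auto
  have **: "\<not> a < b \<longleftrightarrow> - a \<le> - b" for a b :: real by auto
  show ?thesis
  using assms(3) tile_halfplanes[OF assms(1,2), of "- int m"] tile_halfplanes[OF assms(1,2), of "- int n"]
  unfolding ostarset_def ostar_def
  by (simp only: mem_Collect_eq fst_conv snd_conv of_int_of_nat_eq of_int_minus ** de_Morgan_conj de_Morgan_disj minus_minus) blast
qed

text \<open>Centroids never lie on a line of the tiling, so strict and weak inequalities say the
  same about them.\<close>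

lemma starset_centroid:
  fixes m n :: nat
  assumes "s = 0 \<or> s = 1"
  shows "centroid i j s \<in> starset (m, n) \<longleftrightarrow> istar m n i j s"
    "centroid i j s \<in> ostarset (m, n) \<longleftrightarrow> istar m n i j s"
proof -
  have *: "of_int i + (1 + of_int s) / 3 \<le> real k \<longleftrightarrow> i < int k" "- (of_int i + (1 + of_int s) / 3) \<le> real k \<longleftrightarrow> - i \<le> int k"
     "of_int i + (1 + of_int s) / 3 < real k \<longleftrightarrow> i < int k" "- (of_int i + (1 + of_int s) / 3) < real k \<longleftrightarrow> - i \<le> int k" for i k
    using assms by (auto; linarith)+
  have **: "of_int i + (1 + of_int s) / 3 + (of_int j + (1 + of_int s) / 3) \<le> real k \<longleftrightarrow> i + j + s < int k"
     "- (of_int i + (1 + of_int s) / 3 + (of_int j + (1 + of_int s) / 3)) \<le> real k \<longleftrightarrow> - (i + j + s) \<le> int k"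
     "of_int i + (1 + of_int s) / 3 + (of_int j + (1 + of_int s) / 3) < real k \<longleftrightarrow> i + j + s < int k"
     "- (of_int i + (1 + of_int s) / 3 + (of_int j + (1 + of_int s) / 3)) < real k \<longleftrightarrow> - (i + j + s) \<le> int k" for k
    using assms by (auto; linarith)+
  show "centroid i j s \<in> starset (m, n) \<longleftrightarrow> istar m n i j s"
    unfolding starset_def star_def istar_def centroid_def by (simp only: mem_Collect_eq pXY_cx * ** fst_conv snd_conv)
  show "centroid i j s \<in> ostarset (m, n) \<longleftrightarrow> istar m n i j s"
    unfolding ostarset_def ostar_def istar_def centroid_def by (simp only: mem_Collect_eq pXY_cx * ** fst_conv snd_conv)
qed

lemma face_centroid_layer:
  assumes "face_centroid t c"
  shows "t \<subseteq> starset mn - ostarset mn' \<longleftrightarrow> c \<in> starset mn - ostarset mn'"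
proof -
  obtain m n m' n' where mn: "mn = (m, n)" "mn' = (m', n')" by (cases mn; cases mn')
  from assms obtain i j s where s: "s = 0 \<or> s = 1" and tc: "t = tile i j s" "c = centroid i j s"
    unfolding face_centroid_iff by blast
  show ?thesis
    using tile_star[OF s] tile_not_ostar[OF s] centroid_in_tile[OF s] unfolding mn tc by blast
qed

section \<open>Orbits and the number of faces\<close>

text \<open>The translations in \<open>rot_group \<beta>\<close>; a sublattice of index 3 in the
  rotation centers, as 1 + \<alpha> has squared norm 3.\<close>

definition lattice :: "complex \<Rightarrow> complex set" where
  "lattice \<beta> = {\<beta> * (1 + \<alpha>) * e | e. e \<in> eisenstein}"

lemma lattice_closed:
  "l \<in> lattice \<beta> \<Longrightarrow> l' \<in> lattice \<beta> \<Longrightarrow> l + l' \<in> lattice \<beta>"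
  "l \<in> lattice \<beta> \<Longrightarrow> l' \<in> lattice \<beta> \<Longrightarrow> l - l' \<in> lattice \<beta>"
  "l \<in> lattice \<beta> \<Longrightarrow> - l \<in> lattice \<beta>"
  "l \<in> lattice \<beta> \<Longrightarrow> e \<in> eisenstein \<Longrightarrow> e * l \<in> lattice \<beta>"
  "0 \<in> lattice \<beta>"
proof -
  show "l + l' \<in> lattice \<beta>" if "l \<in> lattice \<beta>" "l' \<in> lattice \<beta>"
    using that unfolding lattice_def by (auto simp flip: distrib_left intro: eisenstein_closed)
  show "l - l' \<in> lattice \<beta>" if "l \<in> lattice \<beta>" "l' \<in> lattice \<beta>"
    using that unfolding lattice_def by (auto simp flip: right_diff_distrib intro: eisenstein_closed)
  show "- l \<in> lattice \<beta>" if "l \<in> lattice \<beta>"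
  proof -
    obtain e where "l = \<beta> * (1 + \<alpha>) * e" "e \<in> eisenstein" using \<open>l \<in> lattice \<beta>\<close> by (auto simp: lattice_def)
    then have "- l = \<beta> * (1 + \<alpha>) * (- e)" "- e \<in> eisenstein" by (simp_all add: eisenstein_closed)
    then show ?thesis unfolding lattice_def by blast
  qed
  show "e * l \<in> lattice \<beta>" if "l \<in> lattice \<beta>" "e \<in> eisenstein"
  proof -
    obtain e' where "l = \<beta> * (1 + \<alpha>) * e'" "e' \<in> eisenstein" using \<open>l \<in> lattice \<beta>\<close> by (auto simp: lattice_def)
    then have "e * l = \<beta> * (1 + \<alpha>) * (e * e')" "e * e' \<in> eisenstein" using that by (simp_all add: eisenstein_mult)
    then show ?thesis unfolding lattice_def by blast
  qed
  show "0 \<in> lattice \<beta>"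
    unfolding lattice_def by (auto intro!: exI[of _ 0] eisenstein_closed)
qed

lemma lattice_eisenstein: "l \<in> lattice \<beta> \<Longrightarrow> \<beta> \<in> eisenstein \<Longrightarrow> l \<in> eisenstein"
  unfolding lattice_def by (auto intro!: eisenstein_mult eisenstein_closed)

lemma motion_comp: "motion k l \<circ> motion k' l' = motion (k + k') (\<alpha> ^ k * l' + l)"
  by (auto simp: motion_def fun_eq_iff power_add algebra_simps)

lemma rot3_eq_motion: "rot3 c = motion 2 ((1 - \<alpha>\<^sup>2) * c)"
  by (auto simp: motion_def rot3_def fun_eq_iff algebra_simps)

lemma rot_group_subset: "g \<in> rot_group \<beta> \<Longrightarrow> \<exists>k l. l \<in> lattice \<beta> \<and> g = motion (2 * k) l"
proof (induction rule: rot_group.induct)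
  case id
  have "id = motion (2 * 0) 0" by (simp add: motion_def fun_eq_iff)
  then show ?case using lattice_closed(5) by blast
next
  case (rot g e)
  then obtain k l where kl: "l \<in> lattice \<beta>" "g = motion (2 * k) l" by blast
  have "rot3 (\<beta> * e) \<circ> g = motion (2 * Suc k) (\<alpha> ^ 2 * l + (1 - \<alpha>\<^sup>2) * (\<beta> * e))"
    unfolding rot3_eq_motion kl(2) motion_comp by simp
  \<comment> \<open>Factor 1 - \<alpha>^2 as (1 + \<alpha>)(1 - \<alpha>); the second factor is a
    unit.\<close>
  moreover have "(1 - \<alpha>\<^sup>2) * (\<beta> * e) = \<beta> * (1 + \<alpha>) * ((1 - \<alpha>) * e)"
    by (simp add: algebra_simps power2_eq_square)
  then have "(1 - \<alpha>\<^sup>2) * (\<beta> * e) \<in> lattice \<beta>"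
    using rot(2) unfolding lattice_def by (auto intro!: eisenstein_mult eisenstein_closed)
  then have "\<alpha> ^ 2 * l + (1 - \<alpha>\<^sup>2) * (\<beta> * e) \<in> lattice \<beta>"
    using lattice_closed(1)[OF lattice_closed(4)[OF kl(1) eisenstein_\<alpha>_pow]] by blast
  ultimately show ?case by blast
qed

lemma motion_2_in_rot_group: "g \<in> rot_group \<beta> \<Longrightarrow> l \<in> lattice \<beta> \<Longrightarrow> motion 2 l \<circ> g \<in> rot_group \<beta>"
proof -
  assume g: "g \<in> rot_group \<beta>" and "l \<in> lattice \<beta>"
  then obtain e where e: "l = \<beta> * (1 + \<alpha>) * e" "e \<in> eisenstein" by (auto simp: lattice_def)
  \<comment> \<open>A rotation with prescribed translation part l has its center at
    \<beta>\<alpha>e, because (1 - \<alpha>)\<alpha> = 1.\<close>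
  have "(1 - \<alpha>\<^sup>2) * (\<beta> * (\<alpha> * e)) = \<beta> * (1 + \<alpha>) * (((1 - \<alpha>) * \<alpha>) * e)"
    by (simp add: algebra_simps power2_eq_square)
  then have "rot3 (\<beta> * (\<alpha> * e)) = motion 2 l"
    by (simp only: rot3_eq_motion e \<alpha>_mult_inverse mult_1_left)
  then show ?thesis using rot_group.rot[OF g, of "\<alpha> * e"] e by (simp add: eisenstein_closed)
qed

lemma motion_in_rot_group: "l \<in> lattice \<beta> \<Longrightarrow> motion (2 * k) l \<in> rot_group \<beta>"
proof -
  have *: "motion (2 * Suc k) l \<in> rot_group \<beta>" if "l \<in> lattice \<beta>" for k l
    using that
  proof (induction k arbitrary: l)
    case 0
    have "motion 2 l \<circ> id \<in> rot_group \<beta>" by (intro motion_2_in_rot_group rot_group.id 0)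
    then show ?case by simp
  next
    case (Suc k)
    have "motion 2 l \<circ> motion (2 * Suc k) 0 \<in> rot_group \<beta>"
      by (intro motion_2_in_rot_group Suc lattice_closed)
    then show ?case by (simp add: motion_comp)
  qed
  assume l: "l \<in> lattice \<beta>"
  show ?thesis
  proof (cases k)
    case 0
    \<comment> \<open>A pure translation is obtained as a product of three rotations, with linear
      part \<alpha>^6 = 1.\<close>
    have "motion (2 * k) l = motion (2 * Suc 2) l" using \<alpha>_pow6 by (simp add: 0 motion_def fun_eq_iff)
    then show ?thesis using *[OF l, of 2] by simp
  next
    case (Suc j)
    then show ?thesis using *[OF l, of j] by simp
  qed
qed

lemma rot_group_eq: "rot_group \<beta> = {motion (2 * k) l | k l. l \<in> lattice \<beta>}"
  using rot_group_subset motion_in_rot_group by blast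

lemma motion_inverse: "motion (2 * (2 * k)) (- (\<alpha> ^ (2 * (2 * k)) * l)) \<circ> motion (2 * k) l = id"
proof -
  have "\<alpha> ^ (2 * (2 * k) + 2 * k) = (\<alpha> ^ 6) ^ k" unfolding power_mult[symmetric] by simp
  then have "\<alpha> ^ (2 * (2 * k) + 2 * k) = 1" by (simp add: \<alpha>_pow6)
  then show ?thesis unfolding motion_comp by (simp add: motion_def fun_eq_iff)
qed

lemma orbit_eq_iff: "orbit \<beta> S = orbit \<beta> S' \<longleftrightarrow> (\<exists>g\<in>rot_group \<beta>. S' = g ` S)"
proof
  assume "orbit \<beta> S = orbit \<beta> S'"
  moreover have "id ` S' \<in> orbit \<beta> S'" unfolding orbit_def by (rule imageI) (rule rot_group.id)
  then have "S' \<in> orbit \<beta> S'" by simp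
  ultimately have "S' \<in> orbit \<beta> S" by simp
  then show "\<exists>g\<in>rot_group \<beta>. S' = g ` S" unfolding orbit_def by auto
next
  have sub: "orbit \<beta> (g ` S) \<subseteq> orbit \<beta> S" if "g \<in> rot_group \<beta>" for g S
  proof -
    have "h \<circ> g \<in> rot_group \<beta>" if h: "h \<in> rot_group \<beta>" for h
    proof -
      obtain k l k' l' where "l \<in> lattice \<beta>" "l' \<in> lattice \<beta>" "g = motion (2 * k) l" "h = motion (2 * k') l'"
        using rot_group_subset[OF \<open>g \<in> _\<close>] rot_group_subset[OF h] by blast
      then show ?thesis
        unfolding rot_group_eq
        by (auto simp: motion_comp intro!: exI[of _ "k' + k"] lattice_closed eisenstein_\<alpha>_pow)
    qed
    then show ?thesis unfolding orbit_def image_comp by (auto simp only: image_comp intro: image_eqI)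
  qed
  assume "\<exists>g\<in>rot_group \<beta>. S' = g ` S"
  then obtain g where g: "g \<in> rot_group \<beta>" "S' = g ` S" by blast
  then obtain k l where kl: "l \<in> lattice \<beta>" "g = motion (2 * k) l" using rot_group_subset by blast
  define h where "h = motion (2 * (2 * k)) (- (\<alpha> ^ (2 * (2 * k)) * l))"
  have "h \<in> rot_group \<beta>" unfolding h_def using kl by (intro motion_in_rot_group lattice_closed eisenstein_\<alpha>_pow)
  moreover have "h ` S' = S" using motion_inverse[of k l] unfolding g(2) kl(2) h_def image_comp by simp
  ultimately have "orbit \<beta> S \<subseteq> orbit \<beta> S'" using sub[of h S'] by simp
  then show "orbit \<beta> S = orbit \<beta> S'" using sub[OF g(1), of S] g(2) by simp
qed

lemma orbit_motion: "l \<in> lattice \<beta> \<Longrightarrow> orbit \<beta> (motion (2 * k) l ` S) = orbit \<beta> S"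
  using orbit_eq_iff motion_in_rot_group by blast

section \<open>Residues modulo a + b\<alpha>\<close>

lemma eis_eq_cx: "eis a b = cx (real a) (real b)" by (simp add: eis_def cx_def)

lemma eisenstein_cases:
  assumes "e \<in> eisenstein"
  obtains u w :: int where "e = cx (of_int u) (of_int w)"
  using assms eisenstein_cx by blast

text \<open>The integers in the ideal generated by a + b\<alpha> are the multiples of its norm.
  Vanishing of the Y-coordinate makes b divide (a + b) w, hence w, as b and a + b are
  coprime.\<close>

lemma multiple_in_integers:
  assumes "coprime a b" "of_int d = eis a b * e" "e \<in> eisenstein"
  shows "int (a\<^sup>2 + a * b + b\<^sup>2) dvd d"
proof -
  obtain u w where e: "e = cx (of_int u) (of_int w)" using assms(3) by (rule eisenstein_cases)
  have "pX (of_int d) = pX (eis a b * e)" "pY (of_int d) = pY (eis a b * e)" by (simp_all only: assms(2))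
  then have "of_int d = real a * of_int u - real b * of_int w"
    "0 = real a * of_int w + real b * of_int u + real b * of_int w"
    by (simp_all add: pXY_mult e eis_eq_cx)
  then have *: "d = int a * u - int b * w" "0 = int a * w + int b * u + int b * w"
    by (simp_all flip: of_int_eq_iff[where 'a = real])
  have "coprime (int (a + b)) (int b)" using assms(1) by (simp add: coprime_iff_gcd_eq_1)
  moreover have "int b dvd int (a + b) * w" using *(2) by (intro dvdI[of _ _ "- u"]) (simp add: algebra_simps)
  ultimately have "int b dvd w" using coprime_commute coprime_dvd_mult_right_iff by blast
  then obtain h where h: "w = int b * h" by blast
  show ?thesis
  proof (cases "b = 0")
    case True
    then show ?thesis using * assms(1) by simp
  next
    case False
    have "int b * (int (a + b) * h + u) = 0" using *(2) by (simp add: h algebra_simps)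
    then have "u = - (int (a + b) * h)" using False by simp
    then have "d = int (a\<^sup>2 + a * b + b\<^sup>2) * (- h)" unfolding *(1) h \<open>u = _\<close> by (simp add: algebra_simps power2_eq_square)
    then show ?thesis by (metis dvd_triv_left)
  qed
qed

text \<open>The residue ring is represented by integers: coprimality of a + b and b yields a
  multiple of a + b\<alpha> with Y-coordinate 1, which clears the Y-coordinate of y, and the norm
  reduces what is left.\<close>

lemma residue_mod_eis:
  assumes "coprime a b" "0 < b" "y \<in> eisenstein"
  shows "\<exists>x e. x < a\<^sup>2 + a * b + b\<^sup>2 \<and> e \<in> eisenstein \<and> y = of_nat x + eis a b * e"
proof -
  define N where "N = a\<^sup>2 + a * b + b\<^sup>2"
  have N: "0 < N" using assms(2) by (simp add: N_def)
  obtain p q where y: "y = cx (of_int p) (of_int q)" using assms(3) by (rule eisenstein_cases)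
  have "coprime (int (a + b)) (int b)" using assms(1) by (simp add: coprime_iff_gcd_eq_1)
  then obtain w u where uw: "w * int (a + b) + u * int b = 1"
    using bezout_int[of "int (a + b)" "int b"] by (auto simp: coprime_iff_gcd_eq_1)
  define d where "d = p - q * (int a * u - int b * w)"
  define h where "h = d div int N"
  define x where "x = nat (d mod int N)"
  have x: "x < N" "d = int x + int N * h" using N by (auto simp: x_def h_def nat_less_iff)
  \<comment> \<open>The first summand carries the Y-coordinate q. The second is h times the
    conjugate of a + b\<alpha> and contributes the integer N h.\<close>
  define e where "e = of_int q * cx (of_int u) (of_int w) + of_int h * cx (of_int (int a + int b)) (- of_int (int b))"
  have uw': "of_int w * (real a + real b) + of_int u * real b = 1"
    using arg_cong[OF uw, of real_of_int] by simp
  have dx: "real_of_int p - of_int q * (real a * of_int u - real b * of_int w) = real x + ((real a)\<^sup>2 + real a * real b + (real b)\<^sup>2) * of_int h"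
    using arg_cong[OF x(2), of real_of_int] by (simp add: d_def N_def)
  have "y = of_nat x + eis a b * e"
  proof (rule pXY_eqI)
    show "pX y = pX (of_nat x + eis a b * e)"
      using dx by (simp add: y e_def pXY_mult eis_eq_cx algebra_simps power2_eq_square)
    have "pY (of_nat x + eis a b * e) = of_int q * (of_int w * (real a + real b) + of_int u * real b)"
      by (simp add: e_def pXY_mult eis_eq_cx algebra_simps)
    then show "pY y = pY (of_nat x + eis a b * e)" by (simp only: uw' y pXY_cx mult_1_right)
  qed
  moreover have "e \<in> eisenstein"
    unfolding e_def by (intro eisenstein_closed eisenstein_mult eisenstein_cxI) auto
  ultimately show ?thesis using x(1) unfolding N_def by (intro exI[of _ x] exI[of _ e]) simp
qed

lemma centroid_000: "centroid 0 0 0 = (1 + \<alpha>) / 3"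
  by (simp add: centroid_def pXY_eq_iff)

text \<open>The rotation by \<open>\<alpha>\<^sup>2\<close> about 0 changes \<open>X - Y\<close> of the lower left corner \<open>X + Y\<alpha>\<close> of an upward
  triangle by 1 modulo 3, so it can be made a multiple of 3.\<close>

lemma up_face_normal_form:
  assumes "v \<in> eisenstein"
  shows "\<exists>m y. y \<in> eisenstein \<and> \<alpha> ^ (2 * m) * (v + (1 + \<alpha>) / 3) = (1 + \<alpha>) * y + (1 + \<alpha>) / 3"
proof -
  define P where "P = (\<lambda>v m. \<exists>y. y \<in> eisenstein \<and> \<alpha> ^ (2 * m) * (v + (1 + \<alpha>) / 3) = (1 + \<alpha>) * y + (1 + \<alpha>) / 3)"
  have 0: "P (cx (of_int p) (of_int q)) 0" if "3 dvd p - q" for p q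
  proof -
    from that obtain h where h: "p = q + 3 * h" by (metis diff_add_cancel add.commute dvdE)
    have "cx (of_int p) (of_int q) = (1 + \<alpha>) * cx (of_int (p - h)) (of_int (- h))"
      by (rule pXY_eqI) (simp_all add: h pXY_mult)
    then show ?thesis unfolding P_def
      by (intro exI[of _ "cx (of_int (p - h)) (of_int (- h))"]) (auto intro!: eisenstein_cxI)
  qed
  have step: "P (cx (of_int p) (of_int q)) (Suc m)" if "P (cx (of_int (- p - q - 1)) (of_int p)) m" for p q m
  proof -
    have "\<alpha> ^ 2 * (cx (of_int p) (of_int q) + (1 + \<alpha>) / 3) = cx (of_int (- p - q - 1)) (of_int p) + (1 + \<alpha>) / 3"
      unfolding \<alpha>_sq left_diff_distrib by (rule pXY_eqI) simp_all
    moreover have "\<alpha> ^ (2 * Suc m) * c = \<alpha> ^ (2 * m) * (\<alpha> ^ 2 * c)" for c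
      by (simp add: power2_eq_square mult_ac)
    ultimately show ?thesis using that unfolding P_def by (simp only:)
  qed
  obtain p q where v: "v = cx (of_int p) (of_int q)" using assms by (rule eisenstein_cases)
  have "3 dvd p - q \<or> 3 dvd (- p - q - 1) - p \<or> 3 dvd (- (- p - q - 1) - p - 1) - (- p - q - 1)" by presburger
  then have "\<exists>m. P v m"
    unfolding v using 0 step by meson
  then show ?thesis unfolding P_def by blast
qed

text \<open>Upward triangles with lower left corner (1 + \<alpha>) x for \<epsilon> = 0, and their
  images under rotation by \<alpha>, which are downward, for \<epsilon> = 1.\<close>

definition rep :: "nat \<times> nat \<Rightarrow> complex set" where
  "rep = (\<lambda>(\<epsilon>, x). motion \<epsilon> (\<alpha> ^ \<epsilon> * (1 + \<alpha>) * of_nat x) ` tile 0 0 0)"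

lemma face_centroid_rep: "face_centroid (rep (\<epsilon>, x)) (\<alpha> ^ \<epsilon> * ((1 + \<alpha>) * (of_nat x + 1 / 3)))"
proof -
  have "face_centroid (tile 0 0 0) ((1 + \<alpha>) / 3)"
    using centroid_000 unfolding face_centroid_iff by metis
  then have "face_centroid (rep (\<epsilon>, x)) (motion \<epsilon> (\<alpha> ^ \<epsilon> * (1 + \<alpha>) * of_nat x) ((1 + \<alpha>) / 3))"
    unfolding rep_def by (auto intro!: face_centroid_motion eisenstein_mult eisenstein_closed eisenstein_\<alpha>_pow)
  then show ?thesis by (simp add: motion_def algebra_simps)
qed

lemma one_plus_\<alpha>_nonzero: "1 + \<alpha> \<noteq> 0" by (simp add: pXY_eq_iff)

text \<open>A nonzero multiple of 3 has absolute value at least 3, a difference of two units at most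
  2.\<close>

lemma \<alpha>_pow_cong3:
  assumes "\<alpha> ^ i - \<alpha> ^ j = 3 * e" "e \<in> eisenstein"
  shows "\<alpha> ^ i = \<alpha> ^ j"
proof (rule ccontr)
  assume "\<alpha> ^ i \<noteq> \<alpha> ^ j"
  then have "e \<noteq> 0" using assms by auto
  obtain u w where e: "e = cx (of_int u) (of_int w)" using assms(2) by (rule eisenstein_cases)
  have "(norm e)\<^sup>2 = of_int (u * u + u * w + w * w)" unfolding norm_sq e by (simp add: power2_eq_square)
  moreover have "(norm e)\<^sup>2 > 0" using \<open>e \<noteq> 0\<close> by simp
  ultimately have "1 \<le> (norm e)\<^sup>2" by (simp only: of_int_0_less_iff of_int_1_le_iff)
  then have "1 \<le> norm e" using power2_le_imp_le[of 1 "norm e"] by simp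
  moreover have "norm (\<alpha> ^ i - \<alpha> ^ j) \<le> 2" using norm_triangle_ineq4[of "\<alpha> ^ i" "\<alpha> ^ j"] by simp
  ultimately show False unfolding assms(1) by (simp add: norm_mult)
qed

lemma \<alpha>_pow_eq_iff: "\<alpha> ^ i = \<alpha> ^ j \<longleftrightarrow> i mod 6 = j mod 6"
proof -
  have "inj_on (\<lambda>i. \<alpha> ^ i) {0, 1, 2, 3, 4, 5}"
    by (intro inj_onI; elim insertE emptyE; hypsubst; simp only: \<alpha>_pow_expand; simp add: pXY_eq_iff)
  then have "inj_on (\<lambda>i. \<alpha> ^ i) {..<6}" unfolding lessThan_6 .
  then have "\<alpha> ^ (i mod 6) = \<alpha> ^ (j mod 6) \<longleftrightarrow> i mod 6 = j mod 6"
    by (intro inj_on_eq_iff) auto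
  then show ?thesis unfolding \<alpha>_pow_mod .
qed

lemma eis_eisenstein: "eis a b \<in> eisenstein"
  unfolding eis_eq_cx by (intro eisenstein_cxI) auto

text \<open>Centroids are compared after division by (1 + \<alpha>)/3, where they are units times 3x
  + 1. Modulo 3 the units agree, and their parity gives \<epsilon> = \<epsilon>'; then x' - x is a
  multiple of a + b\<alpha>, hence of the norm.\<close>

lemma inj_on_orbit_rep:
  assumes "coprime a b"
  shows "inj_on (\<lambda>p. orbit (eis a b) (rep p)) ({0, 1} \<times> {..<a\<^sup>2 + a * b + b\<^sup>2})"
proof (rule inj_onI, clarify)
  define \<beta> where "\<beta> = eis a b"
  fix \<epsilon> x \<epsilon>' x'
  assume \<epsilon>: "\<epsilon> \<in> {0, 1::nat}" "\<epsilon>' \<in> {0, 1::nat}" and x: "x < a\<^sup>2 + a * b + b\<^sup>2" "x' < a\<^sup>2 + a * b + b\<^sup>2"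
    and "orbit (eis a b) (rep (\<epsilon>, x)) = orbit (eis a b) (rep (\<epsilon>', x'))"
  then obtain g where "g \<in> rot_group \<beta>" "rep (\<epsilon>', x') = g ` rep (\<epsilon>, x)"
    unfolding orbit_eq_iff \<beta>_def by blast
  then obtain k l where kl: "l \<in> lattice \<beta>" "rep (\<epsilon>', x') = motion (2 * k) l ` rep (\<epsilon>, x)"
    using rot_group_subset by blast
  then obtain e where e: "e \<in> eisenstein" "l = \<beta> * (1 + \<alpha>) * e" by (auto simp: lattice_def)
  have "l \<in> eisenstein" using lattice_eisenstein kl(1) eis_eisenstein \<beta>_def by blast
  then have "\<alpha> ^ \<epsilon>' * ((1 + \<alpha>) * (of_nat x' + 1 / 3)) = motion (2 * k) l (\<alpha> ^ \<epsilon> * ((1 + \<alpha>) * (of_nat x + 1 / 3)))"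
    using face_centroid_motion[OF face_centroid_rep, of l "2 * k" \<epsilon> x] face_centroid_rep[of \<epsilon>' x']
    unfolding kl(2)[symmetric] by (metis face_centroid_unique1)
  then have "(1 + \<alpha>) * (\<alpha> ^ \<epsilon>' * (of_nat x' + 1 / 3)) = (1 + \<alpha>) * (\<alpha> ^ (2 * k + \<epsilon>) * (of_nat x + 1 / 3) + \<beta> * e)"
    unfolding motion_def e power_add by (simp add: algebra_simps)
  then have "\<alpha> ^ \<epsilon>' * (of_nat x' + 1 / 3) = \<alpha> ^ (2 * k + \<epsilon>) * (of_nat x + 1 / 3) + \<beta> * e"
    using one_plus_\<alpha>_nonzero by (simp only: mult_cancel_left simp_thms)
  from arg_cong[OF this, of "\<lambda>z. 3 * z"] have *: "\<alpha> ^ \<epsilon>' * (3 * of_nat x' + 1) = \<alpha> ^ (2 * k + \<epsilon>) * (3 * of_nat x + 1) + 3 * (\<beta> * e)"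
    by (simp add: algebra_simps)
  have "\<alpha> ^ \<epsilon>' = \<alpha> ^ (2 * k + \<epsilon>)"
  proof (rule \<alpha>_pow_cong3)
    show "\<alpha> ^ \<epsilon>' - \<alpha> ^ (2 * k + \<epsilon>) = 3 * (\<alpha> ^ (2 * k + \<epsilon>) * of_nat x + \<beta> * e - \<alpha> ^ \<epsilon>' * of_nat x')"
      using * by (simp add: algebra_simps)
    show "\<alpha> ^ (2 * k + \<epsilon>) * of_nat x + \<beta> * e - \<alpha> ^ \<epsilon>' * of_nat x' \<in> eisenstein"
      unfolding \<beta>_def by (intro eisenstein_closed eisenstein_mult eisenstein_\<alpha>_pow eis_eisenstein e)
  qed
  moreover from this have "\<epsilon>' mod 6 = (2 * k + \<epsilon>) mod 6" unfolding \<alpha>_pow_eq_iff .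
  then have "\<epsilon>' mod 6 mod 2 = (2 * k + \<epsilon>) mod 6 mod 2" by (rule arg_cong)
  then have "\<epsilon>' mod 2 = \<epsilon> mod 2" by (simp add: mod_mod_cancel)
  then have "\<epsilon> = \<epsilon>'" using \<epsilon> by auto
  ultimately have "3 * (\<alpha> ^ \<epsilon> * (of_nat x' - of_nat x)) = 3 * (\<beta> * e)" using * by (simp add: algebra_simps)
  then have "\<alpha> ^ \<epsilon> * (of_nat x' - of_nat x) = \<beta> * e" by (simp only: mult_cancel_left) simp
  then have "\<alpha> ^ (5 * \<epsilon>) * (\<alpha> ^ \<epsilon> * (of_nat x' - of_nat x)) = \<beta> * (\<alpha> ^ (5 * \<epsilon>) * e)"
    by (simp only: ac_simps)
  moreover have "\<alpha> ^ (5 * \<epsilon>) * \<alpha> ^ \<epsilon> = 1"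
  proof -
    have "\<alpha> ^ (5 * \<epsilon>) * \<alpha> ^ \<epsilon> = \<alpha> ^ (6 * \<epsilon>)" by (simp flip: power_add)
    then show ?thesis by (simp add: power_mult \<alpha>_pow6)
  qed
  ultimately have "of_int (int x' - int x) = eis a b * (\<alpha> ^ (5 * \<epsilon>) * e)"
    unfolding \<beta>_def by (simp flip: mult.assoc)
  then have "int (a\<^sup>2 + a * b + b\<^sup>2) dvd int x' - int x"
    using multiple_in_integers[OF assms] e(1) eisenstein_mult eisenstein_\<alpha>_pow by blast
  then have "int x' mod int (a\<^sup>2 + a * b + b\<^sup>2) = int x mod int (a\<^sup>2 + a * b + b\<^sup>2)" by (simp only: mod_eq_dvd_iff)
  then have "x' mod (a\<^sup>2 + a * b + b\<^sup>2) = x mod (a\<^sup>2 + a * b + b\<^sup>2)"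
    by (simp only: of_nat_mod[symmetric] of_nat_eq_iff)
  then have "x = x'" using x by simp
  then show "\<epsilon> = \<epsilon>' \<and> x = x'" using \<open>\<epsilon> = \<epsilon>'\<close> by simp
qed

text \<open>Undoing the direction k makes the face upward, a rotation of order 3 brings its corner
  into the multiples of 1 + \<alpha>, and a lattice translation reduces the quotient to an integer
  x.\<close>

lemma face_orbit_rep:
  assumes "coprime a b" "0 < b" "t \<in> faces"
  shows "\<exists>p\<in>{0, 1} \<times> {..<a\<^sup>2 + a * b + b\<^sup>2}. orbit (eis a b) t = orbit (eis a b) (rep p)"
proof -
  obtain v k where vk: "v \<in> eisenstein" "face_centroid t (v + (\<alpha> ^ k + \<alpha> ^ Suc k) / 3)"
    using assms(3) unfolding faces_iff face_centroid_def by blast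
  define \<epsilon> h where "\<epsilon> = k mod 2" and "h = k div 2"
  have k: "k = 2 * h + \<epsilon>" by (simp add: \<epsilon>_def h_def)
  define v1 where "v1 = \<alpha> ^ (5 * k) * v"
  have pow6: "\<alpha> ^ (6 * i) = 1" for i by (simp add: power_mult \<alpha>_pow6)
  have "v1 \<in> eisenstein" unfolding v1_def using vk by (intro eisenstein_mult eisenstein_\<alpha>_pow)
  then obtain m y where my: "y \<in> eisenstein" "\<alpha> ^ (2 * m) * (v1 + (1 + \<alpha>) / 3) = (1 + \<alpha>) * y + (1 + \<alpha>) / 3"
    using up_face_normal_form by blast
  obtain x e where x: "x < a\<^sup>2 + a * b + b\<^sup>2" "e \<in> eisenstein" "y = of_nat x + eis a b * e"
    using residue_mod_eis[OF assms(1,2) my(1)] by blast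
  define l where "l = \<alpha> ^ (2 * (h + 2 * m) + \<epsilon>) * (eis a b * (1 + \<alpha>) * e)"
  have "v + (\<alpha> ^ k + \<alpha> ^ Suc k) / 3 = motion (2 * (h + 2 * m)) l (\<alpha> ^ \<epsilon> * ((1 + \<alpha>) * (of_nat x + 1 / 3)))"
  proof -
    have "\<alpha> ^ k * \<alpha> ^ (5 * k) = \<alpha> ^ (6 * k)" by (simp flip: power_add)
    then have "\<alpha> ^ k * v1 = v" unfolding v1_def pow6 by (simp flip: mult.assoc)
    then have "v + (\<alpha> ^ k + \<alpha> ^ Suc k) / 3 = \<alpha> ^ k * (v1 + (1 + \<alpha>) / 3)"
      by (simp add: algebra_simps add_divide_distrib)
    also have "\<dots> = \<alpha> ^ k * \<alpha> ^ (4 * m) * (\<alpha> ^ (2 * m) * (v1 + (1 + \<alpha>) / 3))"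
    proof -
      have "\<alpha> ^ (4 * m) * \<alpha> ^ (2 * m) = \<alpha> ^ (6 * m)" by (simp flip: power_add)
      then have "\<alpha> ^ (4 * m) * (\<alpha> ^ (2 * m) * z) = z" for z unfolding pow6 by (simp flip: mult.assoc)
      then show ?thesis by (simp add: mult.assoc)
    qed
    also have "\<alpha> ^ k * \<alpha> ^ (4 * m) = \<alpha> ^ (2 * (h + 2 * m) + \<epsilon>)" unfolding k by (simp add: algebra_simps flip: power_add)
    finally show ?thesis unfolding my(2) x(3) motion_def l_def power_add
      by (simp add: algebra_simps add_divide_distrib)
  qed
  moreover have l: "l \<in> lattice (eis a b)"
  proof -
    have "eis a b * (1 + \<alpha>) * e \<in> lattice (eis a b)" using x(2) by (auto simp: lattice_def)
    then show ?thesis unfolding l_def by (rule lattice_closed(4)) (rule eisenstein_\<alpha>_pow)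
  qed
  ultimately have "t = motion (2 * (h + 2 * m)) l ` rep (\<epsilon>, x)"
    using face_centroid_motion[OF face_centroid_rep, of l "2 * (h + 2 * m)" \<epsilon> x] vk(2)
      lattice_eisenstein[OF l eis_eisenstein] face_centroid_unique2 by metis
  then have "orbit (eis a b) t = orbit (eis a b) (rep (\<epsilon>, x))"
    by (simp only: orbit_motion[OF l])
  moreover have "\<epsilon> \<in> {0, 1}" unfolding \<epsilon>_def by auto
  ultimately show ?thesis using x(1) by (intro bexI[of _ "(\<epsilon>, x)"]) auto
qed

lemma face_count_eq:
  assumes "coprime a b" "0 < b"
  shows "face_count (eis a b) = 2 * (a\<^sup>2 + a * b + b\<^sup>2)"
proof -
  let ?R = "{0, 1::nat} \<times> {..<a\<^sup>2 + a * b + b\<^sup>2}"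
  have "rep p \<in> faces" for p
    using face_centroid_rep[of "fst p" "snd p"] unfolding faces_iff by auto
  then have "quot_faces (eis a b) = (\<lambda>p. orbit (eis a b) (rep p)) ` ?R"
    unfolding quot_faces_def using face_orbit_rep[OF assms] by (auto simp: image_iff)
  then have "face_count (eis a b) = card ?R"
    unfolding face_count_def by (simp only: card_image[OF inj_on_orbit_rep[OF assms(1)]])
  then show ?thesis by (simp add: card_cartesian_product)
qed

section \<open>The coloring of a flower\<close>

lemma layers_reach_1:
  assumes "0 < m" "0 < n" "coprime m n"
  shows "\<exists>K. (nxt ^^ K) (m, n) = (1, 1) \<and> (\<forall>k\<le>K. alive ((nxt ^^ k) (m, n)))"
  using assms
proof (induction "m + n" arbitrary: m n rule: less_induct)
  case less
  show ?case
  proof (cases "m = n")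
    case True
    then have "m = 1" using less.prems by simp
    then show ?thesis using True by (intro exI[of _ 0]) (simp add: alive_def)
  next
    case False
    obtain m' n' where nxt: "nxt (m, n) = (m', n')" by (cases "nxt (m, n)")
    then have "0 < m'" "0 < n'" "m' + n' < m + n" using less.prems False by (auto split: if_splits)
    moreover have "coprime m' n'" using coprime_nxt less.prems nxt by blast
    ultimately obtain K where K: "(nxt ^^ K) (m', n') = (1, 1)" "\<forall>k\<le>K. alive ((nxt ^^ k) (m', n'))"
      using less.hyps by blast
    have *: "(nxt ^^ Suc k) (m, n) = (nxt ^^ k) (m', n')" for k
      unfolding funpow_Suc_right comp_def nxt ..
    have al: "alive ((nxt ^^ k) (m, n))" if "k \<le> Suc K" for k
    proof (cases k)
      case 0
      then show ?thesis using less.prems by (simp add: alive_def)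
    next
      case (Suc k')
      then show ?thesis using K(2) that unfolding Suc * by simp
    qed
    have "(nxt ^^ Suc K) (m, n) = (1, 1)" using K(1) unfolding * .
    show ?thesis
    proof (intro exI conjI allI impI)
      show "(nxt ^^ Suc K) (m, n) = (1, 1)" by fact
      show "alive ((nxt ^^ k) (m, n))" if "k \<le> Suc K" for k using that by (rule al)
    qed
  qed
qed

text \<open>K is the index of the innermost necklace, of aspect ratio 1; the layer after it is the
  hexagon of the six central triangles.\<close>

locale cf_flower =
  fixes a b K :: nat
  assumes a_pos: "0 < a" and a_less_b: "a < b" and coprime_ab: "coprime a b"
    and layer_K: "layer a b K = (1, 1)" and alive_le_K: "\<And>k. k \<le> K \<Longrightarrow> alive (layer a b k)"
begin

abbreviation ly :: "nat \<Rightarrow> nat \<times> nat" where "ly \<equiv> layer a b"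

lemma ly_Suc_K: "ly (Suc K) = (0, 1)" by (simp add: layer_Suc layer_K)

lemma alive_iff: "alive (ly k) \<longleftrightarrow> k \<le> K"
proof
  assume "alive (ly k)"
  moreover have "\<not> alive (ly (Suc K + i))" for i
  proof (induction i)
    case 0
    then show ?case using ly_Suc_K by (simp add: alive_def)
  next
    case (Suc i)
    then show ?case using alive_nxt[of "ly (Suc K + i)"] by (auto simp: layer_Suc)
  qed
  ultimately show "k \<le> K" by (metis le_add_diff_inverse not_less_eq_eq)
qed (rule alive_le_K)

text \<open>The coloring is transferred to points, to be evaluated at centroids of faces:
  \<open>ring_black\<close> and \<open>black\<close> concern the flower at 0,
  \<open>black_tiled\<close> the whole plane.\<close>

definition ring_black :: "complex \<Rightarrow> bool" where
  "ring_black z \<longleftrightarrow> (\<exists>k\<le>K. even k \<and> z \<in> starset (ly k) - ostarset (ly (Suc k)))"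

definition black :: "complex \<Rightarrow> bool" where
  "black z \<longleftrightarrow> ring_black z \<or> (\<exists>j. even j \<and> z = (\<alpha> ^ j + \<alpha> ^ Suc j) / 3)"

definition black_tiled :: "complex \<Rightarrow> bool" where
  "black_tiled z \<longleftrightarrow> (\<exists>l\<in>lattice (eis a b). black (z - l))"

lemma cf_black_iff:
  assumes "face_centroid t c"
  shows "cf_black a b t \<longleftrightarrow> black_tiled c"
proof -
  have H: "((\<exists>k X. flower_layer a b k X \<and> even k \<and> t \<subseteq> (+) l ` carrier X) \<or>
     (\<exists>j. even j \<and> t = (+) l ` (convex hull {0, \<alpha> ^ j, \<alpha> ^ Suc j}))) \<longleftrightarrow> black (c - l)" if l: "l \<in> lattice (eis a b)" for l
  proof -
    have le: "l \<in> eisenstein" "- l \<in> eisenstein" using lattice_eisenstein[OF l eis_eisenstein] eisenstein_closed by auto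
    have sub: "t \<subseteq> (+) l ` S \<longleftrightarrow> motion 0 (- l) ` t \<subseteq> S" for S
    proof -
      have "z \<in> (+) l ` S \<longleftrightarrow> z - l \<in> S" for z by (auto simp: image_iff) (metis add.commute diff_add_cancel)
      then show ?thesis by (auto simp: motion_def)
    qed
    have fc: "face_centroid (motion 0 (- l) ` t) (c - l)"
      using face_centroid_motion[OF assms le(2), of 0] by (simp add: motion_def)
    have "(\<exists>X. flower_layer a b k X \<and> t \<subseteq> (+) l ` carrier X) \<longleftrightarrow>
        k \<le> K \<and> c - l \<in> starset (ly k) - ostarset (ly (Suc k))" for k
      unfolding sub
      using flower_layer_carriers[OF a_pos a_less_b coprime_ab, of k "\<lambda>S. motion 0 (- l) ` t \<subseteq> S"]
      by (simp only: alive_iff face_centroid_layer[OF fc])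
    then have 1: "(\<exists>k X. flower_layer a b k X \<and> even k \<and> t \<subseteq> (+) l ` carrier X) \<longleftrightarrow> ring_black (c - l)"
      unfolding ring_black_def by blast
    have 2: "t = (+) l ` (convex hull {0, \<alpha> ^ j, \<alpha> ^ Suc j}) \<longleftrightarrow> c - l = (\<alpha> ^ j + \<alpha> ^ Suc j) / 3" for j
    proof -
      have "face_centroid (convex hull {0, \<alpha> ^ j, \<alpha> ^ Suc j}) ((\<alpha> ^ j + \<alpha> ^ Suc j) / 3)"
        unfolding face_centroid_def by (rule exI[of _ 0], rule exI[of _ j]) (simp add: eisenstein_closed)
      from face_centroid_motion[OF this le(1), of 0]
      have *: "face_centroid ((+) l ` (convex hull {0, \<alpha> ^ j, \<alpha> ^ Suc j})) ((\<alpha> ^ j + \<alpha> ^ Suc j) / 3 + l)"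
        unfolding motion_image by (simp add: motion_def)
      show ?thesis
      proof
        assume "t = (+) l ` (convex hull {0, \<alpha> ^ j, \<alpha> ^ Suc j})"
        then have "c = (\<alpha> ^ j + \<alpha> ^ Suc j) / 3 + l" using face_centroid_unique1 assms * by blast
        then show "c - l = (\<alpha> ^ j + \<alpha> ^ Suc j) / 3" by simp
      next
        assume "c - l = (\<alpha> ^ j + \<alpha> ^ Suc j) / 3"
        then have "c = (\<alpha> ^ j + \<alpha> ^ Suc j) / 3 + l" by (simp only: diff_eq_eq)
        then show "t = (+) l ` (convex hull {0, \<alpha> ^ j, \<alpha> ^ Suc j})" using face_centroid_unique2 assms * by metis
      qed
    qed
    show ?thesis unfolding 1 2 black_def ..
  qed
  have "flower_centers a b = lattice (eis a b)" by (simp add: flower_centers_def lattice_def)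
  then show ?thesis unfolding cf_black_def black_tiled_def by (intro bex_cong H)
qed

lemma starset_rot: "\<alpha> ^ k * z \<in> starset mn \<longleftrightarrow> z \<in> starset mn"
proof (induction k)
  case (Suc k)
  have "\<alpha> ^ Suc k * z \<in> starset mn \<longleftrightarrow> \<alpha> * (\<alpha> ^ k * z) \<in> starset mn" by (simp add: mult.assoc)
  also have "\<dots> \<longleftrightarrow> \<alpha> ^ k * z \<in> starset mn" by (simp only: starset_def mem_Collect_eq pX_\<alpha>_mult pY_\<alpha>_mult star_rot)
  finally show ?case using Suc by simp
qed simp

lemma ostarset_rot: "\<alpha> ^ k * z \<in> ostarset mn \<longleftrightarrow> z \<in> ostarset mn"
proof (induction k)
  case (Suc k)
  have "\<alpha> ^ Suc k * z \<in> ostarset mn \<longleftrightarrow> \<alpha> * (\<alpha> ^ k * z) \<in> ostarset mn" by (simp add: mult.assoc)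
  also have "\<dots> \<longleftrightarrow> \<alpha> ^ k * z \<in> ostarset mn" by (simp only: ostarset_def mem_Collect_eq pX_\<alpha>_mult pY_\<alpha>_mult ostar_rots)
  finally show ?case using Suc by simp
qed simp

lemma ring_black_rot: "ring_black (\<alpha> ^ k * z) \<longleftrightarrow> ring_black z"
  by (simp add: ring_black_def starset_rot ostarset_rot)

lemma central_eq: "(\<alpha> ^ j + \<alpha> ^ Suc j) / 3 = \<alpha> ^ j * centroid 0 0 0"
  by (simp add: centroid_000 algebra_simps)

text \<open>Even powers of \<alpha>, since the rings are invariant under \<alpha> but the central
  triangles alternate.\<close>

lemma black_rot: "black (\<alpha> ^ (2 * k) * z) \<longleftrightarrow> black z"
proof -
  have 1: "black (\<alpha> ^ (2 * k) * z)" if "black z" for k z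
    using that unfolding black_def ring_black_rot central_eq
    by (elim disjE exE conjE) (auto intro!: exI[of _ "2 * k + j" for j] simp: power_add mult.assoc)
  have "\<alpha> ^ (2 * (2 * k)) * (\<alpha> ^ (2 * k) * z) = (\<alpha> ^ 6) ^ k * z"
    unfolding mult.assoc[symmetric] power_add[symmetric] power_mult[symmetric] by simp
  then have "\<alpha> ^ (2 * (2 * k)) * (\<alpha> ^ (2 * k) * z) = z" by (simp add: \<alpha>_pow6)
  then show ?thesis using 1 by metis
qed

lemma starset_ly_mono: "i \<le> j \<Longrightarrow> starset (ly j) \<subseteq> starset (ly i)"
proof (induction j rule: dec_induct)
  case (step j)
  have "starset (ly (Suc j)) \<subseteq> starset (ly j)" unfolding layer_Suc by (rule starset_nxt)
  then show ?case using step.IH by blast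
qed simp

lemma black_in_flower: "black z \<Longrightarrow> z \<in> starset (b, a)"
proof -
  have "\<alpha> ^ j * centroid 0 0 0 \<in> starset (ly (Suc K))" for j
    unfolding starset_rot ly_Suc_K by (subst starset_centroid) (auto simp: istar_def)
  then have "\<alpha> ^ j * centroid 0 0 0 \<in> starset (ly 0)" for j using starset_ly_mono[of 0 "Suc K"] by blast
  moreover have "z \<in> starset (ly 0)" if "ring_black z"
    using that starset_ly_mono[of 0] unfolding ring_black_def by blast
  ultimately show "black z \<Longrightarrow> z \<in> starset (b, a)" unfolding black_def central_eq by auto
qed

section \<open>Boundary edges of the nested stars\<close>

definition in_star :: "int \<Rightarrow> int \<Rightarrow> int \<Rightarrow> nat \<Rightarrow> bool" where
  "in_star i j s k \<longleftrightarrow> istar (fst (ly k)) (snd (ly k)) i j s"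

definition on_arm :: "int \<Rightarrow> int \<Rightarrow> nat \<Rightarrow> bool" where
  "on_arm N y k \<longleftrightarrow> arms (fst (ly k)) (snd (ly k)) N y"

lemma in_star_starset: "s = 0 \<or> s = 1 \<Longrightarrow> centroid i j s \<in> starset (ly k) \<longleftrightarrow> in_star i j s k"
   "s = 0 \<or> s = 1 \<Longrightarrow> centroid i j s \<in> ostarset (ly k) \<longleftrightarrow> in_star i j s k"
  using starset_centroid[of s i j "fst (ly k)" "snd (ly k)"] by (simp_all add: in_star_def)

lemma in_star_antimono: "s = 0 \<or> s = 1 \<Longrightarrow> in_star i j s k' \<Longrightarrow> k \<le> k' \<Longrightarrow> in_star i j s k"
  using starset_ly_mono unfolding in_star_starset(1)[symmetric] by blast

lemma ly_pos: "k \<le> Suc K \<Longrightarrow> 0 < fst (ly k) + snd (ly k)"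
  using alive_iff[of k] ly_Suc_K by (cases "k = Suc K") (auto simp: alive_def)

lemma on_arm_iff: "k \<le> Suc K \<Longrightarrow> 0 \<le> N \<Longrightarrow> on_arm N y k \<longleftrightarrow> in_star (N - 1) y 1 k \<and> \<not> in_star N y 0 k"
  using istar_arms[of "int (fst (ly k))" "int (snd (ly k))" N y] istar_arms'[of "int (fst (ly k))" "int (snd (ly k))" N y] ly_pos[of k]
  unfolding on_arm_def in_star_def by (simp flip: of_nat_add) blast

lemma on_arm_Suc:
  assumes "k \<le> K" "on_arm N y k"
  shows "\<not> on_arm N y (Suc k)"
proof -
  obtain m n where mn: "ly k = (m, n)" by (cases "ly k")
  then have pos: "0 < m" "0 < n" using alive_le_K[OF assms(1)] by (auto simp: alive_def)
  show ?thesis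
  proof (cases "n \<le> m")
    case True
    then show ?thesis using assms(2) arms_disjoint1[of "int n" "int m" N y] pos
      by (simp add: on_arm_def layer_Suc mn of_nat_diff)
  next
    case False
    then show ?thesis using assms(2) arms_disjoint2[of "int m" "int n" N y] pos
      by (simp add: on_arm_def layer_Suc mn of_nat_diff)
  qed
qed

text \<open>By nesting, an edge that bounds the stars k < k' also bounds the star k + 1, although
  consecutive stars share no boundary edge.\<close>

lemma on_arm_unique_less: "k < k' \<Longrightarrow> k' \<le> Suc K \<Longrightarrow> 0 \<le> N \<Longrightarrow> on_arm N y k \<Longrightarrow> \<not> on_arm N y k'"
proof
  assume *: "k < k'" "k' \<le> Suc K" "0 \<le> N" "on_arm N y k" "on_arm N y k'"
  then have "in_star (N - 1) y 1 k'" "\<not> in_star N y 0 k" using on_arm_iff[of k] on_arm_iff[of k'] by auto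
  then have "in_star (N - 1) y 1 (Suc k)" "\<not> in_star N y 0 (Suc k)"
    using in_star_antimono[of 1 "N - 1" y k' "Suc k"] in_star_antimono[of 0 N y "Suc k" k] *(1) by auto
  then have "on_arm N y (Suc k)" using on_arm_iff[of "Suc k"] * by simp
  then show False using on_arm_Suc[of k] * by simp
qed

lemma on_arm_unique: "k \<le> Suc K \<Longrightarrow> k' \<le> Suc K \<Longrightarrow> 0 \<le> N \<Longrightarrow> on_arm N y k \<Longrightarrow> on_arm N y k' \<Longrightarrow> k = k'"
  using on_arm_unique_less by (metis linorder_neqE_nat)

lemma ring_black_centroid: "s = 0 \<or> s = 1 \<Longrightarrow> ring_black (centroid i j s) \<longleftrightarrow> (\<exists>k\<le>K. even k \<and> in_star i j s k \<and> \<not> in_star i j s (Suc k))"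
  unfolding ring_black_def by (simp add: in_star_starset)

lemma ring_black_even:
  assumes "s = 0 \<or> s = 1" "k \<le> K" "in_star i j s k" "\<not> in_star i j s (Suc k)"
  shows "ring_black (centroid i j s) \<longleftrightarrow> even k"
proof -
  have "k' = k" if "in_star i j s k'" "\<not> in_star i j s (Suc k')" for k'
    using in_star_antimono[OF assms(1)] that assms(3,4) by (metis linorder_neqE_nat Suc_leI)
  then show ?thesis using assms unfolding ring_black_centroid[OF assms(1)] by metis
qed

lemma black_off_center:
  assumes "s = 0 \<or> s = 1" "\<not> in_star i j' s (Suc K)"
  shows "black (\<alpha> ^ j * centroid i j' s) \<longleftrightarrow> ring_black (centroid i j' s)"
proof -
  have "\<alpha> ^ j * centroid i j' s \<noteq> \<alpha> ^ h * centroid 0 0 0" for h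
  proof
    assume "\<alpha> ^ j * centroid i j' s = \<alpha> ^ h * centroid 0 0 0"
    moreover have "\<alpha> ^ h * centroid 0 0 0 \<in> starset (ly (Suc K))"
      unfolding starset_rot ly_Suc_K by (subst starset_centroid) (auto simp: istar_def)
    ultimately have "centroid i j' s \<in> starset (ly (Suc K))" using starset_rot by metis
    then show False using assms in_star_starset by blast
  qed
  then show ?thesis unfolding black_def ring_black_rot central_eq by blast
qed

text \<open>The exponent of a central triangle is determined modulo 6, so its parity is well
  defined.\<close>

lemma black_center:
  assumes "s = 0 \<or> s = 1" "in_star i j' s (Suc K)" "centroid i j' s = \<alpha> ^ d * centroid 0 0 0"
  shows "black (\<alpha> ^ j * centroid i j' s) \<longleftrightarrow> even (j + d)"
proof -
  have "\<not> ring_black (centroid i j' s)"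
    using in_star_antimono[OF assms(1,2)] unfolding ring_black_centroid[OF assms(1)] by auto
  moreover have "centroid 0 0 0 \<noteq> 0" by (simp add: centroid_def pXY_eq_iff)
  then have "\<alpha> ^ j * centroid i j' s = \<alpha> ^ h * centroid 0 0 0 \<longleftrightarrow> (j + d) mod 6 = h mod 6" for h
    unfolding assms(3) mult.assoc[symmetric] by (simp add: \<alpha>_pow_eq_iff flip: power_add)
  moreover have "(\<exists>h. even h \<and> (j + d) mod 6 = h mod 6) \<longleftrightarrow> even (j + d)"
  proof
    assume "\<exists>h. even h \<and> (j + d) mod 6 = h mod 6"
    then obtain h where "even h" "(j + d) mod 6 = h mod 6" by blast
    then have "(j + d) mod 6 mod 2 = h mod 6 mod 2" by simp
    then have "(j + d) mod 2 = h mod 2" by (simp add: mod_mod_cancel)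
    then show "even (j + d)" using \<open>even h\<close> by presburger
  qed blast
  ultimately show ?thesis unfolding black_def ring_black_rot central_eq by simp
qed

text \<open>Stars are nested and consecutive stars share no boundary edge, so an edge separates at most two
  consecutive rings. The other folded edges are the six spokes and every other side of the central
  hexagon.\<close>

lemma black_edge:
  assumes N: "0 \<le> N"
  shows "black (\<alpha> ^ j * centroid N y 0) \<noteq> black (\<alpha> ^ j * centroid (N - 1) y 1) \<longleftrightarrow>
    (\<exists>k\<le>K. on_arm N y k) \<or> N = 0 \<and> (y = 0 \<or> y = - 1) \<or> N = 1 \<and> y = - 1 \<and> even (K + j)"
proof -
  have on_arm1: "on_arm N y (Suc K) \<longleftrightarrow> N = 1 \<and> y = - 1"
    unfolding on_arm_def ly_Suc_K by (auto simp: arms_def)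
  have hex1: "in_star i jj s (Suc K) \<longleftrightarrow> istar 0 1 i jj s" for i jj s unfolding in_star_def ly_Suc_K by simp
  have hexN: "in_star N y 0 (Suc K) \<longleftrightarrow> N = 0 \<and> (y = 0 \<or> y = - 1)"
    using N unfolding hex1 istar_def by auto
  consider (arm) k where "k \<le> K" "on_arm N y k" | (hex) "\<forall>k\<le>K. \<not> on_arm N y k" "on_arm N y (Suc K)"
    | (none) "\<forall>k\<le>Suc K. \<not> on_arm N y k"
    by (metis le_SucE)
  then show ?thesis
  proof cases
    case arm
    have nbd: "\<not> on_arm N y (Suc k)" using on_arm_Suc arm by blast
    have pk: "in_star (N - 1) y 1 k" "\<not> in_star N y 0 k" using on_arm_iff[of k] arm N by auto
    have npS: "\<not> in_star N y 0 (Suc k)" using in_star_antimono[of 0 N y "Suc k" k] pk by auto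
    then have npS2: "\<not> in_star (N - 1) y 1 (Suc k)" using nbd on_arm_iff[of "Suc k"] arm N by auto
    have off: "\<not> in_star N y 0 (Suc K)" "\<not> in_star (N - 1) y 1 (Suc K)"
      using in_star_antimono[of 0 N y "Suc K" "Suc k"] in_star_antimono[of 1 "N - 1" y "Suc K" "Suc k"] npS npS2 arm by auto
    have 2: "ring_black (centroid (N - 1) y 1) \<longleftrightarrow> even k" using ring_black_even arm pk npS2 by blast
    have 1: "ring_black (centroid N y 0) \<longleftrightarrow> odd k"
    proof (cases k)
      \<comment> \<open>Beyond the outermost star lies the white cap, which behaves like a ring of
        odd index -1.\<close>
      case 0
      then have "\<not> in_star N y 0 k'" for k' using pk in_star_antimono[of 0 N y k' 0] by auto
      then show ?thesis using 0 by (simp add: ring_black_centroid)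
    next
      case (Suc k0)
      have "in_star (N - 1) y 1 k0" using in_star_antimono[of 1 "N - 1" y k k0] pk Suc by simp
      moreover have "\<not> on_arm N y k0" using on_arm_Suc[of k0] arm Suc by auto
      ultimately have "in_star N y 0 k0" using on_arm_iff[of k0] N arm Suc by auto
      then show ?thesis using ring_black_even[of 0 k0 N y] pk Suc arm by simp
    qed
    show ?thesis using 1 2 off arm by (simp add: black_off_center) blast
  next
    case hex
    then have Ny: "N = 1" "y = - 1" using on_arm1 by auto
    have pK: "in_star (N - 1) y 1 (Suc K)" "\<not> in_star N y 0 (Suc K)" using on_arm_iff[of "Suc K"] hex N by auto
    have "in_star N y 0 K"
      using in_star_antimono[of 1 "N - 1" y "Suc K" K] pK on_arm_iff[of K] hex N by auto
    then have "ring_black (centroid N y 0) \<longleftrightarrow> even K" using ring_black_even pK by blast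
    moreover have "centroid (N - 1) y 1 = \<alpha> ^ 5 * centroid 0 0 0"
      unfolding Ny \<alpha>_pow_expand by (simp add: centroid_def pXY_eq_iff)
    then have "black (\<alpha> ^ j * centroid (N - 1) y 1) \<longleftrightarrow> even (j + 5)" using black_center pK by blast
    ultimately show ?thesis using hex Ny pK by (simp add: black_off_center) blast
  next
    case none
    then have eq: "in_star N y 0 k = in_star (N - 1) y 1 k" if "k \<le> Suc K" for k
      using on_arm_iff[of k] that N istar_arms'[of "int (fst (ly k))" "int (snd (ly k))" N y] ly_pos[of k]
      by (auto simp: in_star_def simp flip: of_nat_add)
    have neq: "\<not> (N = 1 \<and> y = - 1)" using none on_arm1 by blast
    show ?thesis
    proof (cases "in_star N y 0 (Suc K)")
      case True
      then have p2: "in_star (N - 1) y 1 (Suc K)" using eq by blast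
      from True hexN consider "N = 0" "y = 0" | "N = 0" "y = - 1" by blast
      then show ?thesis
      proof cases
        case 1
        have "centroid N y 0 = \<alpha> ^ 0 * centroid 0 0 0" "centroid (N - 1) y 1 = \<alpha> ^ 1 * centroid 0 0 0"
          unfolding 1 \<alpha>_pow_expand by (simp_all add: centroid_def pXY_eq_iff)
        then have "black (\<alpha> ^ j * centroid N y 0) \<longleftrightarrow> even (j + 0)" "black (\<alpha> ^ j * centroid (N - 1) y 1) \<longleftrightarrow> even (j + 1)"
          using black_center True p2 by blast+
        then show ?thesis using 1 by simp
      next
        case 2
        have "centroid N y 0 = \<alpha> ^ 4 * centroid 0 0 0" "centroid (N - 1) y 1 = \<alpha> ^ 3 * centroid 0 0 0"
          unfolding 2 \<alpha>_pow_expand by (simp_all add: centroid_def pXY_eq_iff)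
        then have "black (\<alpha> ^ j * centroid N y 0) \<longleftrightarrow> even (j + 4)" "black (\<alpha> ^ j * centroid (N - 1) y 1) \<longleftrightarrow> even (j + 3)"
          using black_center True p2 by blast+
        then show ?thesis using 2 by simp
      qed
    next
      case False
      then have "\<not> in_star (N - 1) y 1 (Suc K)" using eq by blast
      moreover have "ring_black (centroid N y 0) = ring_black (centroid (N - 1) y 1)"
        using eq by (auto simp: ring_black_centroid)
      ultimately show ?thesis using False hexN none neq by (auto simp: black_off_center)
    qed
  qed
qed

end

section \<open>Folded edges\<close>

definition eseg :: "nat \<Rightarrow> int \<Rightarrow> int \<Rightarrow> complex set" where
  "eseg j N y = (*) (\<alpha> ^ j) ` closed_segment (cx (of_int N) (of_int y)) (cx (of_int N) (of_int y + 1))"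

text \<open>Midpoints stand for edges: they move along with them, and they are never Eisenstein
  integers, so the strict Voronoi inequality applies to them.\<close>

definition mid :: "nat \<Rightarrow> int \<Rightarrow> int \<Rightarrow> complex" where
  "mid j N y = \<alpha> ^ j * cx (of_int N) (of_int y + 1 / 2)"

lemma mid_in_eseg: "mid j N y \<in> eseg j N y"
proof -
  have "cx (of_int N) (of_int y + 1 / 2) = midpoint (cx (of_int N) (of_int y)) (cx (of_int N) (of_int y + 1))"
    by (simp add: midpoint_def cx_arith)
  then show ?thesis unfolding mid_def eseg_def by (metis imageI midpoint_in_closed_segment)
qed

lemma \<alpha>_pow_inverse: "\<alpha> ^ j * \<alpha> ^ (5 * j) = 1" "\<alpha> ^ (5 * j) * \<alpha> ^ j = 1"
proof -
  have "\<alpha> ^ j * \<alpha> ^ (5 * j) = \<alpha> ^ (6 * j)" by (simp flip: power_add)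
  then show "\<alpha> ^ j * \<alpha> ^ (5 * j) = 1" by (simp add: power_mult \<alpha>_pow6)
  then show "\<alpha> ^ (5 * j) * \<alpha> ^ j = 1" by (simp only: mult.commute)
qed

lemma \<alpha>_pow_inverse_mult: "\<alpha> ^ j * (\<alpha> ^ (5 * j) * z) = z" "\<alpha> ^ (5 * j) * (\<alpha> ^ j * z) = z"
  unfolding mult.assoc[symmetric] \<alpha>_pow_inverse by simp_all

lemma eisenstein_rot: "\<alpha> ^ j * z \<in> eisenstein \<longleftrightarrow> z \<in> eisenstein"
  using eisenstein_mult[OF eisenstein_\<alpha>_pow] \<alpha>_pow_inverse_mult(2)[of j z] by metis

lemma mid_not_eisenstein: "mid j N y \<notin> eisenstein"
proof -
  have "of_int y + 1 / 2 \<notin> (\<int> :: real set)"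
  proof
    assume "of_int y + 1 / 2 \<in> (\<int> :: real set)"
    then obtain i where "real_of_int y + 1 / 2 = of_int i" by (auto elim: Ints_cases)
    then have "2 * y + 1 = 2 * i" by linarith
    then show False by presburger
  qed
  then have "cx (of_int N) (of_int y + 1 / 2) \<notin> eisenstein" by (simp add: eisenstein_iff)
  then show ?thesis by (simp only: mid_def eisenstein_rot simp_thms)
qed

text \<open>The direction is divided by \<alpha> so that the edge runs along a line X = N; if N is
  negative, rotation by \<alpha>^3 = -1 reverses the segment and makes it positive.\<close>

lemma edge_normal_form:
  assumes "e \<in> edges"
  obtains j N y where "0 \<le> N" "e = eseg j N y"
proof -
  obtain v k where v: "v \<in> eisenstein" "e = closed_segment v (v + \<alpha> ^ k)" using assms by (auto simp: edges_def)
  define i where "i = k + 5"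
  have k: "\<alpha> ^ k = \<alpha> ^ i * \<alpha>"
  proof -
    have "\<alpha> ^ i * \<alpha> = \<alpha> ^ k * \<alpha> ^ 6" unfolding i_def by (simp add: power_add eval_nat_numeral mult_ac)
    then show ?thesis by (simp add: \<alpha>_pow6)
  qed
  have "\<alpha> ^ (5 * i) * v \<in> eisenstein" using v eisenstein_rot by blast
  then obtain p q where pq: "\<alpha> ^ (5 * i) * v = cx (of_int p) (of_int q)" by (rule eisenstein_cases)
  then have v': "v = \<alpha> ^ i * cx (of_int p) (of_int q)" using \<alpha>_pow_inverse_mult(1) by metis
  have "v + \<alpha> ^ k = \<alpha> ^ i * (cx (of_int p) (of_int q) + \<alpha>)" unfolding v' k by (simp add: distrib_left)
  also have "cx (of_int p) (of_int q) + \<alpha> = cx (of_int p) (of_int q + 1)" by (simp add: pXY_eq_iff)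
  finally have e: "e = (*) (\<alpha> ^ i) ` closed_segment (cx (of_int p) (of_int q)) (cx (of_int p) (of_int q + 1))"
    unfolding v(2) closed_segment_mult v'[symmetric] by simp
  show ?thesis
  proof (cases "0 \<le> p")
    case True
    then show ?thesis using that e unfolding eseg_def by blast
  next
    case False
    have 1: "\<alpha> ^ (i + 3) * cx x y = \<alpha> ^ i * cx (- x) (- y)" for x y
      unfolding power_add \<alpha>_pow_expand(4) by (simp add: pXY_eq_iff cx_arith flip: mult_minus_right)
    have "eseg (i + 3) (- p) (- q - 1) = e"
      unfolding e eseg_def closed_segment_mult 1 by (simp add: insert_commute add.commute)
    then show ?thesis using False that[of "- p" "i + 3" "- q - 1"] by simp
  qed
qed

lemma eseg_in_edges: "eseg j N y \<in> edges"
proof -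
  have "cx (of_int N) (of_int y + 1) = cx (of_int N) (of_int y) + \<alpha>" by (simp add: pXY_eq_iff)
  then have "eseg j N y = closed_segment (\<alpha> ^ j * cx (of_int N) (of_int y)) (\<alpha> ^ j * cx (of_int N) (of_int y) + \<alpha> ^ Suc j)"
    unfolding eseg_def closed_segment_mult by (simp add: distrib_left mult.commute)
  moreover have "\<alpha> ^ j * cx (of_int N) (of_int y) \<in> eisenstein"
    by (intro eisenstein_mult eisenstein_\<alpha>_pow eisenstein_cxI) auto
  ultimately show ?thesis unfolding edges_def by blast
qed

lemma convex_tile: "s = 0 \<or> s = 1 \<Longrightarrow> convex (tile i j s)"
  using hull_up[of i j] hull_down[of i j] convex_convex_hull by metis

lemma rot_image_motion: "(*) (\<alpha> ^ j) ` S = motion j 0 ` S" by (simp add: motion_def)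

lemma eseg_faces:
  "face_centroid t c \<and> eseg j N y \<subseteq> t \<longleftrightarrow>
     t = (*) (\<alpha> ^ j) ` tile N y 0 \<and> c = \<alpha> ^ j * centroid N y 0 \<or>
     t = (*) (\<alpha> ^ j) ` tile (N - 1) y 1 \<and> c = \<alpha> ^ j * centroid (N - 1) y 1"
proof
  assume *: "face_centroid t c \<and> eseg j N y \<subseteq> t"
  then have "face_centroid (motion (5 * j) 0 ` t) (motion (5 * j) 0 c)"
    by (intro face_centroid_motion eisenstein_closed) simp
  then obtain i k s where s: "s = 0 \<or> s = 1" and tc: "motion (5 * j) 0 ` t = tile i k s" "motion (5 * j) 0 c = centroid i k s"
    unfolding face_centroid_iff by blast
  have t: "t = (*) (\<alpha> ^ j) ` tile i k s"
  proof -
    have "(*) (\<alpha> ^ j) ` motion (5 * j) 0 ` t = t"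
      by (simp add: motion_def image_image \<alpha>_pow_inverse_mult)
    then show ?thesis using tc(1) by simp
  qed
  have c: "c = \<alpha> ^ j * centroid i k s" using tc(2) by (metis \<alpha>_pow_inverse_mult(1) add.right_neutral motion_def)
  have "closed_segment (cx (of_int N) (of_int y)) (cx (of_int N) (of_int y + 1)) \<subseteq> tile i k s"
    using * inj_image_subset_iff[OF inj_mult_\<alpha>] unfolding t eseg_def by blast
  then have "cx (of_int N) (of_int y) \<in> tile i k s" "cx (of_int N) (of_int y + 1) \<in> tile i k s" by auto
  then have *: "real_of_int k \<le> of_int y" "real_of_int y + 1 \<le> of_int k + 1"
    "real_of_int i + of_int k + of_int s \<le> of_int N + of_int y"
    "real_of_int N + (of_int y + 1) \<le> of_int i + of_int k + of_int s + 1" unfolding tile_def by auto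
  then have k: "k = y" by linarith
  then have "i + s = N" using * by linarith
  with s k show "t = (*) (\<alpha> ^ j) ` tile N y 0 \<and> c = \<alpha> ^ j * centroid N y 0 \<or>
     t = (*) (\<alpha> ^ j) ` tile (N - 1) y 1 \<and> c = \<alpha> ^ j * centroid (N - 1) y 1"
    using t c by auto
next
  have *: "face_centroid ((*) (\<alpha> ^ j) ` tile i k s) (\<alpha> ^ j * centroid i k s)" if "s = 0 \<or> s = 1" for i k s
    using face_centroid_motion[of "tile i k s" "centroid i k s" 0 j] that eisenstein_closed(5)
    unfolding rot_image_motion face_centroid_iff[of "tile i k s"] by (auto simp: motion_def)
  have 1: "eseg j N y \<subseteq> (*) (\<alpha> ^ j) ` tile N y 0"
    unfolding eseg_def by (intro image_mono closed_segment_subset convex_tile) (auto simp: tile_def)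
  have 2: "eseg j N y \<subseteq> (*) (\<alpha> ^ j) ` tile (N - 1) y 1"
    unfolding eseg_def by (intro image_mono closed_segment_subset convex_tile) (auto simp: tile_def)
  assume "t = (*) (\<alpha> ^ j) ` tile N y 0 \<and> c = \<alpha> ^ j * centroid N y 0 \<or>
     t = (*) (\<alpha> ^ j) ` tile (N - 1) y 1 \<and> c = \<alpha> ^ j * centroid (N - 1) y 1"
  then show "face_centroid t c \<and> eseg j N y \<subseteq> t" using * 1 2 by auto
qed

definition fold_edge :: "(complex \<Rightarrow> bool) \<Rightarrow> complex set \<Rightarrow> bool" where
  "fold_edge P e \<longleftrightarrow> (\<exists>t t' c c'. face_centroid t c \<and> face_centroid t' c' \<and> e \<subseteq> t \<and> e \<subseteq> t' \<and> P c \<noteq> P c')"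

lemma fold_edge_eseg: "fold_edge P (eseg j N y) \<longleftrightarrow> P (\<alpha> ^ j * centroid N y 0) \<noteq> P (\<alpha> ^ j * centroid (N - 1) y 1)"
proof -
  have "fold_edge P (eseg j N y) \<longleftrightarrow> (\<exists>t t' c c'. (face_centroid t c \<and> eseg j N y \<subseteq> t) \<and> (face_centroid t' c' \<and> eseg j N y \<subseteq> t') \<and> P c \<noteq> P c')"
    unfolding fold_edge_def by blast
  then show ?thesis unfolding eseg_faces by blast
qed

text \<open>A midpoint has the integer X-coordinate N and a half-integer Y-coordinate. Of the
  nontrivial rotations only \<alpha>^3 keeps X an integer, and it changes the sign of N.\<close>

lemma mid_unique:
  assumes "\<alpha> ^ i * cx (of_int N) (of_int y + 1 / 2) = cx (of_int N') (of_int y' + 1 / 2)" "0 \<le> N" "0 \<le> N'"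
  shows "i mod 6 = 0 \<and> N = N' \<and> y = y' \<or> N = 0 \<and> N' = 0 \<and> y' = - 1 - y"
proof -
  have half: "real_of_int u + 1 / 2 \<noteq> of_int w" "real_of_int u - 1 / 2 \<noteq> of_int w" for u w
  proof -
    have "2 * u + 1 \<noteq> 2 * w" "2 * u - 1 \<noteq> 2 * w" by presburger+
    then show "real_of_int u + 1 / 2 \<noteq> of_int w" "real_of_int u - 1 / 2 \<noteq> of_int w" by linarith+
  qed
  define d where "d = i mod 6"
  have eq: "\<alpha> ^ d * cx (of_int N) (of_int y + 1 / 2) = cx (of_int N') (of_int y' + 1 / 2)"
    using assms(1) unfolding d_def \<alpha>_pow_mod .
  have "d < 6" by (simp add: d_def)
  then consider "d = 0" | "d = 1" | "d = 2" | "d = 3" | "d = 4" | "d = 5" by linarith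
  then show ?thesis
  proof cases
    case 1
    then show ?thesis using eq by (auto simp flip: d_def)
  next
    case 2
    then have "- real_of_int y - 1 / 2 = of_int N'" using arg_cong[OF eq, of pX] unfolding 2 \<alpha>_pow_expand by simp
    then show ?thesis using half(2)[of "- y" N'] by simp
  next
    case 3
    then have "- real_of_int y - 1 / 2 - of_int N = of_int N'" using arg_cong[OF eq, of pX] unfolding 3 \<alpha>_pow_expand
      by (simp add: left_diff_distrib)
    then show ?thesis using half(2)[of "- y - N" N'] by simp
  next
    case 4
    then have "- real_of_int N = of_int N'" "- (real_of_int y + 1 / 2) = of_int y' + 1 / 2"
      using arg_cong[OF eq, of pX] arg_cong[OF eq, of pY] unfolding 4 \<alpha>_pow_expand by simp_all
    then have "- N = N'" "y' = - 1 - y" by linarith+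
    then show ?thesis using assms by auto
  next
    case 5
    then have "real_of_int y + 1 / 2 = of_int N'" using arg_cong[OF eq, of pX] unfolding 5 \<alpha>_pow_expand by simp
    then show ?thesis using half(1)[of y N'] by simp
  next
    case 6
    then have "real_of_int N + (of_int y + 1 / 2) = of_int N'" using arg_cong[OF eq, of pX] unfolding 6 \<alpha>_pow_expand
      by (simp add: left_diff_distrib)
    then show ?thesis using half(1)[of "N + y" N'] by simp
  qed
qed

text \<open>Apart from its corners, the star lies strictly inside the Voronoi cell of 0 for the lattice of
  flower centers; hence flowers do not overlap and folded edges of one flower are inequivalent under
  translations.\<close>

lemma star_dirichlet:
  assumes "star m n X Y" "0 < m" "0 < n" "\<not> (X = n \<and> Y = m)" "\<not> (X = - m \<and> Y = n + m)"
  shows "n * X + (n + m) * Y < m\<^sup>2 + m * n + n\<^sup>2"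
proof -
  have e: "n * X + (n + m) * Y = n * (X + Y) + m * Y" by (simp add: algebra_simps)
  have pos: "0 < m * n" "0 < n * n" using assms by auto
  show ?thesis
  proof (cases "Y \<le> m")
    case True
    show ?thesis
    proof (cases "X \<le> n")
      case X: True
      have "n * X \<le> n * n" "(n + m) * Y \<le> (n + m) * m" using X True assms by (auto intro: mult_left_mono)
      moreover have "n * X < n * n \<or> (n + m) * Y < (n + m) * m"
        using X True assms by (auto simp: less_le)
      ultimately show ?thesis by (auto simp: power2_eq_square algebra_simps)
    next
      case False
      then have "X + Y \<le> m" using assms(1) by (auto simp: star_def)
      then have "n * (X + Y) \<le> n * m" "m * Y \<le> m * (m - n)" using assms False by (auto intro!: mult_left_mono)
      then show ?thesis unfolding e using pos by (simp add: power2_eq_square algebra_simps)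
    qed
  next
    case False
    then have XY: "X + Y \<le> n" using assms(1) by (auto simp: star_def)
    then have 1: "n * (X + Y) \<le> n * n" using assms by (auto intro!: mult_left_mono)
    consider "Y \<le> n" | "- X \<le> m" using assms(1) by (auto simp: star_def)
    then show ?thesis
    proof cases
      case 1
      then have "m * Y \<le> m * n" using assms by (auto intro!: mult_left_mono)
      moreover have "0 < m * m" using assms by simp
      ultimately show ?thesis unfolding e using \<open>n * (X + Y) \<le> n * n\<close> by (simp add: power2_eq_square)
    next
      case 2
      then have Y: "Y \<le> n + m" using XY by linarith
      then have 2: "m * Y \<le> m * (n + m)" using assms by (auto intro!: mult_left_mono)
      have "X + Y < n \<or> Y < n + m" using assms(5) XY Y by linarith
      then have "n * (X + Y) < n * n \<or> m * Y < m * (n + m)" using assms by auto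
      then show ?thesis unfolding e using 1 2 by (auto simp: power2_eq_square algebra_simps)
    qed
  qed
qed

section \<open>Separation of the flowers\<close>

lemma eisenstein_unit:
  assumes "e \<in> eisenstein" "(norm e)\<^sup>2 < 2" "e \<noteq> 0"
  shows "\<exists>k. e = \<alpha> ^ k"
proof -
  obtain u w where e: "e = cx (of_int u) (of_int w)" using assms(1) by (rule eisenstein_cases)
  define q where "q = u * u + u * w + w * w"
  have "(norm e)\<^sup>2 = of_int q" unfolding norm_sq e q_def by (simp add: power2_eq_square)
  then have lt: "q < 2" using assms(2) by linarith
  have 3: "3 * (u * u) \<le> 4 * q" "3 * (w * w) \<le> 4 * q"
    using zero_le_square[of "u + 2 * w"] zero_le_square[of "2 * u + w"] by (simp_all add: q_def algebra_simps)
  have "u * u < 4" using 3(1) lt by linarith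
  moreover have "w * w < 4" using 3(2) lt by linarith
  ultimately have sq: "u * u < 4" "w * w < 4" by auto
  then have "\<bar>u\<bar> < 2" "\<bar>w\<bar> < 2" using sq abs_le_square_iff[of 2 u] abs_le_square_iff[of 2 w]
    by (auto simp: power2_eq_square not_le)
  then have "u \<in> {-1, 0, 1}" "w \<in> {-1, 0, 1}" by auto
  then consider "u = 1" "w = 0" | "u = 0" "w = 1" | "u = -1" "w = 1" | "u = -1" "w = 0" | "u = 0" "w = -1" | "u = 1" "w = -1"
    using lt assms(3) e by (auto simp: pXY_eq_iff q_def)
  then show ?thesis
  proof cases
    case 1 then show ?thesis by (intro exI[of _ 0]) (simp only: e \<alpha>_pow_expand, simp add: pXY_eq_iff)
  next
    case 2 then show ?thesis by (intro exI[of _ 1]) (simp only: e \<alpha>_pow_expand, simp add: pXY_eq_iff)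
  next
    case 3 then show ?thesis by (intro exI[of _ 2]) (simp only: e \<alpha>_pow_expand, simp add: pXY_eq_iff)
  next
    case 4 then show ?thesis by (intro exI[of _ 3]) (simp only: e \<alpha>_pow_expand, simp add: pXY_eq_iff)
  next
    case 5 then show ?thesis by (intro exI[of _ 4]) (simp only: e \<alpha>_pow_expand, simp add: pXY_eq_iff)
  next
    case 6 then show ?thesis by (intro exI[of _ 5]) (simp only: e \<alpha>_pow_expand, simp add: pXY_eq_iff)
  qed
qed

context cf_flower
begin

lemma norm_eis_sq: "(norm (eis a b))\<^sup>2 = (real b)\<^sup>2 + real b * real a + (real a)\<^sup>2"
  unfolding norm_sq by (simp add: eis_eq_cx algebra_simps)

text \<open>Three times the inequality of \<open>star_dirichlet\<close>: the center \<beta>(1 +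
  \<alpha>) is the sum of the adjacent corners \<beta> and \<alpha>\<beta> of the hexagon. These
  corners, where equality holds, are Eisenstein integers.\<close>

lemma dirichlet_unit:
  assumes "z \<in> starset (b, a)" "z \<notin> eisenstein"
  shows "2 * (z \<bullet> (\<alpha> ^ k * (eis a b * (1 + \<alpha>)))) < (norm (eis a b * (1 + \<alpha>)))\<^sup>2"
proof -
  define w where "w = \<alpha> ^ (5 * k) * z"
  have z: "z = \<alpha> ^ k * w" by (simp add: w_def \<alpha>_pow_inverse_mult)
  have w: "w \<in> starset (b, a)" "w \<notin> eisenstein"
    using assms unfolding w_def starset_rot eisenstein_rot by auto
  have inner: "(\<alpha> ^ k * u) \<bullet> (\<alpha> ^ k * v) = u \<bullet> v" for u v
  proof -
    have "2 * ((\<alpha> ^ k * u) \<bullet> (\<alpha> ^ k * v)) = (norm (\<alpha> ^ k * (u + v)))\<^sup>2 - (norm (\<alpha> ^ k * u))\<^sup>2 - (norm (\<alpha> ^ k * v))\<^sup>2"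
      unfolding distrib_left power2_norm_eq_inner by (simp add: inner_add inner_commute)
    also have "\<dots> = 2 * (u \<bullet> v)"
      by (simp add: norm_mult) (simp add: power2_norm_eq_inner inner_add inner_commute)
    finally show ?thesis by simp
  qed
  define X Y where "X = pX w" and "Y = pY w"
  have "\<not> (X = real a \<and> Y = real b)" "\<not> (X = - real b \<and> Y = real a + real b)"
    using w(2) unfolding X_def Y_def eisenstein_iff by auto
  then have "real a * X + (real a + real b) * Y < (real b)\<^sup>2 + real b * real a + (real a)\<^sup>2"
    using star_dirichlet[of "real b" "real a" X Y] w(1) a_pos a_less_b by (simp add: starset_def X_def Y_def)
  moreover have P: "pX (eis a b * (1 + \<alpha>)) = real a - real b" "pY (eis a b * (1 + \<alpha>)) = real a + 2 * real b"
    by (simp_all add: pXY_mult eis_eq_cx)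
  have "2 * (w \<bullet> (eis a b * (1 + \<alpha>))) = 3 * (real a * X + (real a + real b) * Y)"
    "(norm (eis a b * (1 + \<alpha>)))\<^sup>2 = 3 * ((real b)\<^sup>2 + real b * real a + (real a)\<^sup>2)"
    unfolding inner_coords norm_sq X_def[symmetric] Y_def[symmetric] P by (simp_all add: algebra_simps power2_eq_square)
  ultimately show ?thesis unfolding z inner by simp
qed

text \<open>The six nearest centers correspond to units e and are covered by
  \<open>dirichlet_unit\<close>. All others are so far away that the norm bound for the star
  suffices.\<close>

lemma dirichlet:
  assumes "z \<in> starset (b, a)" "z \<notin> eisenstein" "l \<in> lattice (eis a b)" "l \<noteq> 0"
  shows "norm z < norm (z - l)"
proof -
  obtain e where e: "l = eis a b * (1 + \<alpha>) * e" "e \<in> eisenstein" using assms(3) by (auto simp: lattice_def)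
  have "e \<noteq> 0" using e assms(4) by auto
  have less: "2 * (z \<bullet> l) < (norm l)\<^sup>2"
  proof (cases "(norm e)\<^sup>2 < 2")
    case True
    then obtain k where k: "e = \<alpha> ^ k" using eisenstein_unit e \<open>e \<noteq> 0\<close> by blast
    have l: "l = \<alpha> ^ k * (eis a b * (1 + \<alpha>))" by (simp add: e k)
    show ?thesis using dirichlet_unit[OF assms(1,2), of k] unfolding l[symmetric] by (simp add: l norm_mult)
  next
    case False
    have l0: "l \<noteq> 0" by fact
    have "(norm (1 + \<alpha>))\<^sup>2 = 3" unfolding norm_sq by simp
    then have nl: "(norm l)\<^sup>2 = 3 * (norm (eis a b))\<^sup>2 * (norm e)\<^sup>2" unfolding e norm_mult power_mult_distrib by simp
    have "(norm z)\<^sup>2 \<le> (norm (eis a b))\<^sup>2" using norm_starset[OF assms(1)] norm_eis_sq by simp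
    then have nz: "norm z \<le> norm (eis a b)" by (rule power2_le_imp_le) simp
    have "eis a b \<noteq> 0" using a_pos by (simp add: eis_eq_cx pXY_eq_iff)
    \<comment> \<open>Here the squared norm of l is at least 3 * 2 = 6 times that of a + b\<alpha>,
      and 6 > 4.\<close>
    then have "(2 * norm (eis a b))\<^sup>2 < (norm l)\<^sup>2"
      using False unfolding nl by (simp add: power_mult_distrib)
    then have "2 * norm (eis a b) < norm l" by (rule power2_less_imp_less) simp
    then have "2 * norm z * norm l < norm l * norm l" using nz l0 by simp
    moreover have "z \<bullet> l \<le> norm z * norm l" by (rule norm_cauchy_schwarz)
    ultimately show ?thesis by (simp add: power2_eq_square)
  qed
  have "(norm (z - l))\<^sup>2 = (norm z)\<^sup>2 - 2 * (z \<bullet> l) + (norm l)\<^sup>2"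
    by (simp add: power2_norm_eq_inner inner_diff inner_commute)
  then have "(norm z)\<^sup>2 < (norm (z - l))\<^sup>2" using less by simp
  then show ?thesis by (rule power2_less_imp_less) simp
qed

text \<open>Otherwise each of the two centers would be strictly nearer to z than the other.\<close>

lemma lattice_translate_unique:
  assumes "z - l \<in> starset (b, a)" "z - l' \<in> starset (b, a)" "z \<notin> eisenstein" "l \<in> lattice (eis a b)" "l' \<in> lattice (eis a b)"
  shows "l = l'"
proof (rule ccontr)
  assume "l \<noteq> l'"
  have E: "z - h \<notin> eisenstein" if "h \<in> lattice (eis a b)" for h
    using assms(3) eisenstein_closed(1)[of "z - h" h] lattice_eisenstein[OF that eis_eisenstein] by auto
  have "norm (z - l) < norm (z - l - (l' - l))"
    by (rule dirichlet) (use assms E \<open>l \<noteq> l'\<close> lattice_closed in auto)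
  moreover have "norm (z - l') < norm (z - l' - (l - l'))"
    by (rule dirichlet) (use assms E \<open>l \<noteq> l'\<close> lattice_closed in auto)
  ultimately show False by simp
qed

section \<open>From the plane to the quotient\<close>

lemma black_mid:
  assumes "face_centroid t c" "\<mu> \<in> t" "black c"
  shows "\<mu> \<in> starset (b, a)"
proof -
  obtain i j s where s: "s = 0 \<or> s = 1" and tc: "t = tile i j s" "c = centroid i j s"
    using assms(1) unfolding face_centroid_iff by blast
  then show ?thesis using tile_star[OF s] black_in_flower[OF assms(3)] assms(2) by blast
qed

text \<open>Only a flower whose star contains \<mu> can blacken a face through \<mu>, and there is
  just one such flower.\<close>

lemma black_tiled_eq:
  assumes "face_centroid t c" "\<mu> \<in> t" "\<mu> \<notin> eisenstein" "l \<in> lattice (eis a b)" "\<mu> - l \<in> starset (b, a)"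
  shows "black_tiled c \<longleftrightarrow> black (c - l)"
proof
  assume "black_tiled c"
  then obtain l' where l': "l' \<in> lattice (eis a b)" "black (c - l')" by (auto simp: black_tiled_def)
  have "- l' \<in> eisenstein" using lattice_eisenstein[OF l'(1) eis_eisenstein] eisenstein_closed by blast
  then have "face_centroid (motion 0 (- l') ` t) (c - l')"
    using face_centroid_motion[OF assms(1), of "- l'" 0] by (simp add: motion_def)
  moreover have "\<mu> - l' \<in> motion 0 (- l') ` t" using assms(2) by (auto simp: motion_def)
  ultimately have "\<mu> - l' \<in> starset (b, a)" using black_mid l'(2) by blast
  then have "l = l'" using lattice_translate_unique assms l' by blast
  then show "black (c - l)" using l' by simp
qed (use assms(4) in \<open>auto simp: black_tiled_def\<close>)

lemma black_tiled_motion: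
  assumes "l \<in> lattice (eis a b)"
  shows "black_tiled (motion (2 * k) l c) \<longleftrightarrow> black_tiled c"
proof -
  have 1: "black_tiled (motion (2 * k) l c)" if "black_tiled c" "l \<in> lattice (eis a b)" for k l c
  proof -
    obtain l0 where l0: "l0 \<in> lattice (eis a b)" "black (c - l0)" using \<open>black_tiled c\<close> by (auto simp: black_tiled_def)
    have "motion (2 * k) l c - (\<alpha> ^ (2 * k) * l0 + l) = \<alpha> ^ (2 * k) * (c - l0)"
      by (simp add: motion_def algebra_simps)
    then have "black (motion (2 * k) l c - (\<alpha> ^ (2 * k) * l0 + l))" using l0(2) black_rot by simp
    moreover have "\<alpha> ^ (2 * k) * l0 + l \<in> lattice (eis a b)"
      by (rule lattice_closed(1)[OF lattice_closed(4)[OF l0(1) eisenstein_\<alpha>_pow] that(2)])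
    ultimately show ?thesis unfolding black_tiled_def by blast
  qed
  define l' where "l' = - (\<alpha> ^ (2 * (2 * k)) * l)"
  have "l' \<in> lattice (eis a b)"
    unfolding l'_def by (rule lattice_closed(3)[OF lattice_closed(4)[OF assms eisenstein_\<alpha>_pow]])
  moreover have "motion (2 * (2 * k)) l' (motion (2 * k) l c) = c"
    using fun_cong[OF motion_inverse[of k l], of c] by (simp only: l'_def o_apply id_apply)
  ultimately show ?thesis using 1[of "motion (2 * k) l c" l' "2 * k"] 1[OF _ assms] by metis
qed

lemma cf_coloring_orbit:
  assumes "face_centroid t c"
  shows "cf_coloring a b (orbit (eis a b) t) \<longleftrightarrow> black_tiled c"
proof -
  have "cf_black a b (g ` t) \<longleftrightarrow> black_tiled c" if "g \<in> rot_group (eis a b)" for g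
  proof -
    obtain k l where l: "l \<in> lattice (eis a b)" "g = motion (2 * k) l" using rot_group_subset[OF \<open>g \<in> _\<close>] by blast
    then have "face_centroid (g ` t) (g c)"
      using face_centroid_motion[OF assms lattice_eisenstein[OF l(1) eis_eisenstein]] by simp
    then show ?thesis using cf_black_iff black_tiled_motion[OF l(1)] l(2) by simp
  qed
  then show ?thesis unfolding cf_coloring_def orbit_def using rot_group.id by blast
qed

text \<open>Incidence of orbits relates some copy of e to some copy of t; the inverse of the motion
  of e moves this incidence to e itself.\<close>

lemma incident_orbits:
  assumes "t \<in> faces"
  shows "quot_incident (orbit (eis a b) e) (orbit (eis a b) t) \<longleftrightarrow>
     (\<exists>t'\<in>faces. orbit (eis a b) t' = orbit (eis a b) t \<and> e \<subseteq> t')"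
proof
  assume "quot_incident (orbit (eis a b) e) (orbit (eis a b) t)"
  then obtain g h where gh: "g \<in> rot_group (eis a b)" "h \<in> rot_group (eis a b)" "g ` e \<subseteq> h ` t"
    unfolding quot_incident_def orbit_def by blast
  obtain k l where l: "l \<in> lattice (eis a b)" "g = motion (2 * k) l" using rot_group_subset[OF gh(1)] by blast
  define l' where "l' = - (\<alpha> ^ (2 * (2 * k)) * l)"
  have l': "l' \<in> lattice (eis a b)"
    unfolding l'_def by (rule lattice_closed(3)[OF lattice_closed(4)[OF l(1) eisenstein_\<alpha>_pow]])
  define g' where "g' = motion (2 * (2 * k)) l'"
  have "g' ` g ` e = e" using motion_inverse[of k l] unfolding g'_def l'_def l(2) image_comp by simp
  then have "e \<subseteq> g' ` h ` t" using gh(3) by (metis image_mono)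
  moreover have "orbit (eis a b) (g' ` h ` t) = orbit (eis a b) t"
    using orbit_motion[OF l'] gh(2) orbit_eq_iff unfolding g'_def by metis
  moreover have "g' ` h ` t \<in> faces"
  proof -
    obtain c where c: "face_centroid t c" using assms by (auto simp: faces_iff)
    obtain k2 l2 where h: "l2 \<in> lattice (eis a b)" "h = motion (2 * k2) l2" using rot_group_subset[OF gh(2)] by blast
    have "face_centroid (h ` t) (h c)" using face_centroid_motion[OF c lattice_eisenstein[OF h(1) eis_eisenstein]] h by simp
    then have "face_centroid (g' ` h ` t) (g' (h c))"
      unfolding g'_def by (rule face_centroid_motion) (rule lattice_eisenstein[OF l' eis_eisenstein])
    then show ?thesis by (auto simp: faces_iff)
  qed
  ultimately show "\<exists>t'\<in>faces. orbit (eis a b) t' = orbit (eis a b) t \<and> e \<subseteq> t'" by blast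
next
  have self: "S \<in> orbit (eis a b) S" for S
    unfolding orbit_def by (rule image_eqI[of _ _ id]) (simp_all add: rot_group.id)
  assume "\<exists>t'\<in>faces. orbit (eis a b) t' = orbit (eis a b) t \<and> e \<subseteq> t'"
  then show "quot_incident (orbit (eis a b) e) (orbit (eis a b) t)"
    unfolding quot_incident_def using self by metis
qed

lemma folded_orbit:
  "(\<exists>F\<in>quot_faces (eis a b). \<exists>F'\<in>quot_faces (eis a b). quot_incident (orbit (eis a b) e) F \<and>
      quot_incident (orbit (eis a b) e) F' \<and> cf_coloring a b F \<noteq> cf_coloring a b F') \<longleftrightarrow> fold_edge black_tiled e"
proof
  assume "\<exists>F\<in>quot_faces (eis a b). \<exists>F'\<in>quot_faces (eis a b). quot_incident (orbit (eis a b) e) F \<and>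
      quot_incident (orbit (eis a b) e) F' \<and> cf_coloring a b F \<noteq> cf_coloring a b F'"
  then obtain t1 t2 where t: "t1 \<in> faces" "t2 \<in> faces" "quot_incident (orbit (eis a b) e) (orbit (eis a b) t1)"
      "quot_incident (orbit (eis a b) e) (orbit (eis a b) t2)"
      "cf_coloring a b (orbit (eis a b) t1) \<noteq> cf_coloring a b (orbit (eis a b) t2)"
    unfolding quot_faces_def by blast
  then obtain t1' t2' where t': "t1' \<in> faces" "t2' \<in> faces" "orbit (eis a b) t1' = orbit (eis a b) t1"
    "orbit (eis a b) t2' = orbit (eis a b) t2" "e \<subseteq> t1'" "e \<subseteq> t2'"
    unfolding incident_orbits[OF t(1)] incident_orbits[OF t(2)] by blast
  then obtain c1 c2 where c: "face_centroid t1' c1" "face_centroid t2' c2" by (auto simp: faces_iff)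
  then have "black_tiled c1 \<noteq> black_tiled c2"
    using t(5) cf_coloring_orbit[OF c(1)] cf_coloring_orbit[OF c(2)] t'(3,4) by simp
  then show "fold_edge black_tiled e" unfolding fold_edge_def using c t'(5,6) by blast
next
  assume "fold_edge black_tiled e"
  then obtain t t' c c' where c: "face_centroid t c" "face_centroid t' c'" "e \<subseteq> t" "e \<subseteq> t'" "black_tiled c \<noteq> black_tiled c'"
    unfolding fold_edge_def by blast
  have f: "t \<in> faces" "t' \<in> faces" using c by (auto simp: faces_iff)
  have "cf_coloring a b (orbit (eis a b) t) \<noteq> cf_coloring a b (orbit (eis a b) t')"
    using c(5) cf_coloring_orbit[OF c(1)] cf_coloring_orbit[OF c(2)] by simp
  moreover have "quot_incident (orbit (eis a b) e) (orbit (eis a b) t)" using incident_orbits[OF f(1)] f c by blast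
  moreover have "quot_incident (orbit (eis a b) e) (orbit (eis a b) t')" using incident_orbits[OF f(2)] f c by blast
  ultimately show "\<exists>F\<in>quot_faces (eis a b). \<exists>F'\<in>quot_faces (eis a b). quot_incident (orbit (eis a b) e) F \<and>
      quot_incident (orbit (eis a b) e) F' \<and> cf_coloring a b F \<noteq> cf_coloring a b F'"
    unfolding quot_faces_def using f by blast
qed

end

section \<open>Counting the folded edges\<close>

lemma card_arms:
  fixes m n :: nat
  assumes "0 < m" "0 < n"
  shows "card {(N, y). arms (int m) (int n) N y} = m + n" "finite {(N, y). arms (int m) (int n) N y}"
proof -
  let ?A = "{int n} \<times> {int m - int n..<int m}" and ?B = "{int m} \<times> {- (int m + int n)..<- int n}"
  have "{(N, y). arms (int m) (int n) N y} = ?A \<union> ?B" by (auto simp: arms_def)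
  moreover have "?A \<inter> ?B = {}" by auto
  then have "card (?A \<union> ?B) = card ?A + card ?B" by (intro card_Un_disjoint) auto
  moreover have "card ?A = n" "card ?B = m" by (simp_all add: card_cartesian_product)
  ultimately show "card {(N, y). arms (int m) (int n) N y} = m + n" by simp
  show "finite {(N, y). arms (int m) (int n) N y}" unfolding \<open>_ = ?A \<union> ?B\<close> by simp
qed

context cf_flower
begin

definition layer_sum :: nat where "layer_sum = (\<Sum>k\<le>K. fst (ly k) + snd (ly k))"

text \<open>The position (0, 0) stands for the spokes. A spoke at position (0, -1) is the one at (0,
  0) in the opposite direction, and is left out.\<close>

definition fold_positions :: "(int \<times> int) set" where
  "fold_positions = insert (0, 0) (\<Union>k\<le>K. {(N, y). on_arm N y k})"

text \<open>Rotations of order 3 change the direction by 2, which leaves the directions 0 and 1. The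
  additional element is the single orbit of folded sides of the central hexagon, whose direction has
  the parity of K.\<close>

definition fold_reps :: "(nat \<times> int \<times> int) set" where
  "fold_reps = insert (K mod 2, 1, - 1) ({0, 1} \<times> fold_positions)"

lemma on_arm_nonneg: "k \<le> K \<Longrightarrow> on_arm N y k \<Longrightarrow> 0 < N"
  using alive_le_K[of k] by (auto simp: on_arm_def arms_def alive_def)

lemma on_arm_Suc_K: "on_arm 1 (- 1) (Suc K)"
  by (simp add: on_arm_def ly_Suc_K arms_def)

lemma fold_positions_card: "card fold_positions = layer_sum + 1" "finite fold_positions"
proof -
  have al: "0 < fst (ly k)" "0 < snd (ly k)" if "k \<le> K" for k using alive_le_K[OF that] by (auto simp: alive_def)
  have fin: "finite {(N, y). on_arm N y k}" if "k \<le> K" for k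
    unfolding on_arm_def using card_arms(2)[OF al[OF that]] .
  have "card (\<Union>k\<le>K. {(N, y). on_arm N y k}) = (\<Sum>k\<le>K. card {(N, y). on_arm N y k})"
  proof (rule card_UN_disjoint)
    show "\<forall>i\<in>{..K}. \<forall>j\<in>{..K}. i \<noteq> j \<longrightarrow> {(N, y). on_arm N y i} \<inter> {(N, y). on_arm N y j} = {}"
    proof (intro ballI impI)
      fix i j assume ij: "i \<in> {..K}" "j \<in> {..K}" "i \<noteq> j"
      have "\<not> on_arm N y j" if "on_arm N y i" for N y
        using on_arm_unique[of i j N y] on_arm_nonneg[of i N y] ij that by auto
      then show "{(N, y). on_arm N y i} \<inter> {(N, y). on_arm N y j} = {}" by auto
    qed
  qed (use fin in auto)
  also have "\<dots> = layer_sum"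
    unfolding layer_sum_def on_arm_def using card_arms(1) al by (intro sum.cong) auto
  finally have "card (\<Union>k\<le>K. {(N, y). on_arm N y k}) = layer_sum" .
  moreover have "(0, 0) \<notin> (\<Union>k\<le>K. {(N, y). on_arm N y k})" using on_arm_nonneg by auto
  moreover have f: "finite (\<Union>k\<le>K. {(N, y). on_arm N y k})" using fin by auto
  ultimately show "card fold_positions = layer_sum + 1" unfolding fold_positions_def by simp
  show "finite fold_positions" unfolding fold_positions_def using f by simp
qed

lemma fold_reps_card: "card fold_reps = 2 * layer_sum + 3"
proof -
  have "(1, - 1) \<notin> fold_positions"
  proof -
    have "\<not> on_arm 1 (- 1) k" if "k \<le> K" for k using on_arm_unique_less[of k "Suc K" 1 "- 1"] on_arm_Suc_K that by auto
    then show ?thesis unfolding fold_positions_def by auto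
  qed
  then have "(K mod 2, 1, - 1) \<notin> {0, 1::nat} \<times> fold_positions" by auto
  then show ?thesis
    unfolding fold_reps_def using fold_positions_card by (simp add: card_cartesian_product)
qed

lemma fold_reps_cases:
  assumes "(j, N, y) \<in> fold_reps"
  shows "j \<in> {0, 1}" "0 \<le> N" "N = 0 \<Longrightarrow> y = 0"
    "(\<exists>k\<le>K. on_arm N y k) \<or> N = 0 \<and> (y = 0 \<or> y = - 1) \<or> N = 1 \<and> y = - 1 \<and> even (K + j)"
  using assms on_arm_nonneg unfolding fold_reps_def fold_positions_def by (auto; force)+

lemma fold_reps_fold_edge:
  assumes "(j, N, y) \<in> fold_reps"
  shows "fold_edge black (eseg j N y)"
  unfolding fold_edge_eseg using black_edge fold_reps_cases[OF assms] by blast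

lemma fold_edge_mid: "fold_edge black (eseg j N y) \<Longrightarrow> mid j N y \<in> starset (b, a)"
  unfolding fold_edge_def using black_mid mid_in_eseg by blast

lemma fold_edge_translate:
  assumes "mid j N y - l \<in> starset (b, a)" "l \<in> lattice (eis a b)"
  shows "fold_edge black_tiled (eseg j N y) \<longleftrightarrow> fold_edge black (motion 0 (- l) ` eseg j N y)"
proof -
  have le: "l \<in> eisenstein" "- l \<in> eisenstein"
    using lattice_eisenstein[OF assms(2) eis_eisenstein] eisenstein_closed by auto
  have bt: "black_tiled c \<longleftrightarrow> black (c - l)" if "face_centroid t c" "eseg j N y \<subseteq> t" for t c
    using black_tiled_eq[OF that(1) _ mid_not_eisenstein assms(2,1)] that(2) mid_in_eseg by blast
  have m: "motion 0 (- l) z = z - l" "motion 0 l z = z + l" for z by (simp_all add: motion_def)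
  have mm: "motion 0 l ` motion 0 (- l) ` S = S" "motion 0 (- l) ` motion 0 l ` S = S" for S
    by (simp_all add: image_image m)
  show ?thesis
  proof
    assume "fold_edge black_tiled (eseg j N y)"
    then obtain t t' c c' where c: "face_centroid t c" "face_centroid t' c'" "eseg j N y \<subseteq> t" "eseg j N y \<subseteq> t'"
      "black_tiled c \<noteq> black_tiled c'" unfolding fold_edge_def by blast
    have "face_centroid (motion 0 (- l) ` t) (c - l)" "face_centroid (motion 0 (- l) ` t') (c' - l)"
      using face_centroid_motion[OF c(1) le(2), of 0] face_centroid_motion[OF c(2) le(2), of 0] by (simp_all add: m)
    moreover have "black (c - l) \<noteq> black (c' - l)" using c bt by metis
    ultimately show "fold_edge black (motion 0 (- l) ` eseg j N y)"
      unfolding fold_edge_def using image_mono[OF c(3)] image_mono[OF c(4)] by metis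
  next
    assume "fold_edge black (motion 0 (- l) ` eseg j N y)"
    then obtain t t' c c' where c: "face_centroid t c" "face_centroid t' c'" "motion 0 (- l) ` eseg j N y \<subseteq> t"
       "motion 0 (- l) ` eseg j N y \<subseteq> t'" "black c \<noteq> black c'" unfolding fold_edge_def by blast
    have f: "face_centroid (motion 0 l ` t) (c + l)" "face_centroid (motion 0 l ` t') (c' + l)"
      using face_centroid_motion[OF c(1) le(1), of 0] face_centroid_motion[OF c(2) le(1), of 0] by (simp_all add: m)
    moreover have s: "eseg j N y \<subseteq> motion 0 l ` t" "eseg j N y \<subseteq> motion 0 l ` t'"
      using image_mono[OF c(3), of "motion 0 l"] image_mono[OF c(4), of "motion 0 l"] by (simp_all only: mm)
    moreover have "black_tiled (c + l) \<noteq> black_tiled (c' + l)"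
      using c(5) bt[OF f(1) s(1)] bt[OF f(2) s(2)] by simp
    ultimately show "fold_edge black_tiled (eseg j N y)" unfolding fold_edge_def by blast
  qed
qed

lemma eseg_mod: "eseg (j mod 6) N y = eseg j N y"
  unfolding eseg_def \<alpha>_pow_mod ..

lemma motion_eseg: "motion k 0 ` eseg j N y = eseg (k + j) N y"
  unfolding eseg_def motion_def by (simp add: image_image power_add mult.assoc)

lemma eseg_flip: "eseg j 0 (- 1) = eseg (j + 3) 0 0"
proof -
  have 1: "\<alpha> ^ (j + 3) * cx x y = \<alpha> ^ j * cx (- x) (- y)" for x y
    unfolding power_add \<alpha>_pow_expand(4) by (simp add: cx_arith flip: mult_minus_right)
  show ?thesis unfolding eseg_def closed_segment_mult 1 by (simp add: insert_commute)
qed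

text \<open>The even exponent 4 (j div 2) is -2 (j div 2) modulo 6, so a rotation of order 3 reduces
  the direction to j mod 2.\<close>

lemma eseg_normalize: "eseg (2 * (2 * (j div 2)) + j) N y = eseg (j mod 2) N y"
proof -
  have "2 * (2 * (j div 2)) + j = j mod 2 + 6 * (j div 2)" using mod_mult_div_eq[of j 2] by simp
  then have "(2 * (2 * (j div 2)) + j) mod 6 = (j mod 2) mod 6" by (simp only: mod_mult_self2)
  then show ?thesis by (metis eseg_mod)
qed

lemma fold_rep_exists:
  assumes "0 \<le> N" "fold_edge black (eseg j N y)"
  shows "\<exists>h. \<exists>r\<in>fold_reps. eseg (2 * h + j) N y = (case r of (j, N, y) \<Rightarrow> eseg j N y)"
proof -
  note eh = eseg_normalize[of j]
  have j2: "j mod 2 \<in> {0, 1}" by auto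
  from assms consider (arm) k where "k \<le> K" "on_arm N y k" | (spoke0) "N = 0" "y = 0" | (spoke1) "N = 0" "y = - 1"
    | (hex) "N = 1" "y = - 1" "even (K + j)"
    unfolding fold_edge_eseg using black_edge[OF assms(1)] by blast
  then show ?thesis
  proof cases
    case arm
    then have "(j mod 2, N, y) \<in> fold_reps" using j2 by (auto simp: fold_reps_def fold_positions_def)
    then show ?thesis using eh[of N y]
      by (intro exI[of _ "2 * (j div 2)"] bexI[of _ "(j mod 2, N, y)"]) (simp_all only: prod.case)
  next
    case spoke0
    then have "(j mod 2, N, y) \<in> fold_reps" using j2 by (auto simp: fold_reps_def fold_positions_def)
    then show ?thesis using eh[of N y]
      by (intro exI[of _ "2 * (j div 2)"] bexI[of _ "(j mod 2, N, y)"]) (simp_all only: prod.case)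
  next
    case spoke1
    \<comment> \<open>The same spoke read in the opposite direction; this changes the parity of its
      direction.\<close>
    define i where "i = j + 3"
    define h' where "h' = 2 * (i div 2)"
    have "eseg (2 * h' + j) N y = eseg (2 * h' + i) 0 0"
      unfolding spoke1 eseg_flip i_def by (simp add: add.assoc)
    also have "\<dots> = eseg (i mod 2) 0 0" unfolding h'_def by (rule eseg_normalize)
    finally have "eseg (2 * h' + j) N y = eseg (i mod 2) 0 0" .
    moreover have "(i mod 2, 0, 0) \<in> fold_reps" by (auto simp: fold_reps_def fold_positions_def)
    ultimately show ?thesis
      by (intro exI[of _ h'] bexI[of _ "(i mod 2, 0, 0)"]) (simp_all only: prod.case)
  next
    case hex
    then have "j mod 2 = K mod 2" by presburger
    then have "(j mod 2, N, y) \<in> fold_reps" using hex by (simp add: fold_reps_def)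
    then show ?thesis using eh[of N y]
      by (intro exI[of _ "2 * (j div 2)"] bexI[of _ "(j mod 2, N, y)"]) (simp_all only: prod.case)
  qed
qed

definition rep_orbit :: "nat \<times> int \<times> int \<Rightarrow> complex set set" where
  "rep_orbit = (\<lambda>(j, N, y). orbit (eis a b) (eseg j N y))"

text \<open>One face at a folded edge is black and hence belongs to a flower. Moving the center of
  that flower to 0 turns \<open>black_tiled\<close> into \<open>black\<close>, and a rotation of
  order 3 then reaches a representative.\<close>

lemma folded_edges: "orbit (eis a b) ` {e \<in> edges. fold_edge black_tiled e} = rep_orbit ` fold_reps"
proof (intro equalityI subsetI)
  fix E assume "E \<in> orbit (eis a b) ` {e \<in> edges. fold_edge black_tiled e}"
  then obtain e where e: "e \<in> edges" "fold_edge black_tiled e" "E = orbit (eis a b) e" by blast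
  obtain j N y where jNy: "0 \<le> N" "e = eseg j N y" using edge_normal_form[OF e(1)] by blast
  from e(2) obtain t c where tc: "face_centroid t c" "e \<subseteq> t" "black_tiled c" unfolding fold_edge_def by blast
  then obtain l where l: "l \<in> lattice (eis a b)" "black (c - l)" by (auto simp: black_tiled_def)
  have le: "- l \<in> eisenstein" using lattice_eisenstein[OF l(1) eis_eisenstein] eisenstein_closed by blast
  have m: "motion 0 (- l) z = z - l" for z by (simp add: motion_def)
  have "face_centroid (motion 0 (- l) ` t) (c - l)"
    using face_centroid_motion[OF tc(1) le, of 0] by (simp add: m)
  moreover have "mid j N y - l \<in> motion 0 (- l) ` t"
    using tc(2) mid_in_eseg unfolding jNy m[symmetric] by blast
  ultimately have "mid j N y - l \<in> starset (b, a)" using black_mid l(2) by blast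
  then have f: "fold_edge black (motion 0 (- l) ` e)" using fold_edge_translate l(1) e(2) jNy by blast
  have "motion 0 (- l) ` e \<in> edges"
  proof -
    obtain v k where v: "v \<in> eisenstein" "e = closed_segment v (v + \<alpha> ^ k)" using e(1) by (auto simp: edges_def)
    have "motion 0 (- l) ` e = closed_segment (v - l) (v - l + \<alpha> ^ k)"
      unfolding v(2) motion_image using closed_segment_translation[of "- l" v "v + \<alpha> ^ k"] by (simp add: algebra_simps)
    moreover have "v - l \<in> eisenstein" using eisenstein_closed(1)[OF v(1) le] by simp
    ultimately show ?thesis by (auto simp: edges_def)
  qed
  then obtain j' N' y' where n: "0 \<le> N'" "motion 0 (- l) ` e = eseg j' N' y'" using edge_normal_form by metis
  then obtain h r where r: "r \<in> fold_reps" "eseg (2 * h + j') N' y' = (case r of (j, N, y) \<Rightarrow> eseg j N y)"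
    using fold_rep_exists f by metis
  have "orbit (eis a b) e = orbit (eis a b) (motion (2 * 0) (- l) ` e)"
    using orbit_motion[OF lattice_closed(3)[OF l(1)]] by metis
  also have "\<dots> = orbit (eis a b) (motion (2 * h) 0 ` eseg j' N' y')"
    using orbit_motion[OF lattice_closed(5)] n(2) by simp
  also have "\<dots> = rep_orbit r"
    unfolding motion_eseg r(2) rep_orbit_def by (cases r) simp
  finally show "E \<in> rep_orbit ` fold_reps" using r(1) e(3) by blast
next
  fix E assume "E \<in> rep_orbit ` fold_reps"
  then obtain j N y where r: "(j, N, y) \<in> fold_reps" "E = orbit (eis a b) (eseg j N y)" by (auto simp: rep_orbit_def)
  have f: "fold_edge black (eseg j N y)" by (rule fold_reps_fold_edge[OF r(1)])
  have "fold_edge black_tiled (eseg j N y)"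
    using fold_edge_translate[of j N y 0] fold_edge_mid[OF f] f lattice_closed(5) by (simp add: motion_def)
  then show "E \<in> orbit (eis a b) ` {e \<in> edges. fold_edge black_tiled e}" using eseg_in_edges r(2) by blast
qed

lemma motion_mid: "motion (2 * k) l ` eseg j N y = eseg j' N' y' \<Longrightarrow> motion (2 * k) l (mid j N y) = mid j' N' y'"
proof -
  have seg: "eseg j N y = closed_segment (\<alpha> ^ j * cx (of_int N) (of_int y)) (\<alpha> ^ j * cx (of_int N) (of_int y + 1))" for j N y
    unfolding eseg_def closed_segment_mult ..
  have mp: "mid j N y = midpoint (\<alpha> ^ j * cx (of_int N) (of_int y)) (\<alpha> ^ j * cx (of_int N) (of_int y + 1))" for j N y
  proof -
    have half: "cx (of_int N) (of_int y + 1 / 2) = (cx (of_int N) (of_int y) + cx (of_int N) (of_int y + 1)) / 2"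
      by (simp add: pXY_eq_iff)
    show ?thesis unfolding mid_def midpoint_def half by (simp add: scaleR_conv_of_real distrib_left)
  qed
  have img: "motion (2 * k) l ` closed_segment p q = closed_segment (motion (2 * k) l p) (motion (2 * k) l q)" for p q
    unfolding motion_image closed_segment_mult closed_segment_translation[symmetric] by (simp add: motion_def add.commute)
  have mm: "motion (2 * k) l (midpoint p q) = midpoint (motion (2 * k) l p) (motion (2 * k) l q)" for p q
    by (simp add: motion_def midpoint_def scaleR_conv_of_real algebra_simps flip: add_divide_distrib)
  assume "motion (2 * k) l ` eseg j N y = eseg j' N' y'"
  then show ?thesis
    unfolding seg img closed_segment_eq mp mm by (metis doubleton_eq_iff midpoint_sym)
qed

text \<open>Midpoints of representatives lie in the flower at 0, so a motion between two of them has
  no translation part. Comparing directions, 5j' + 2k + j = 0 modulo 6 forces j and j' to have the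
  same parity.\<close>

lemma inj_on_rep_orbit: "inj_on rep_orbit fold_reps"
proof (rule inj_onI)
  fix r r' assume r: "r \<in> fold_reps" "r' \<in> fold_reps" "rep_orbit r = rep_orbit r'"
  obtain j N y j' N' y' where jNy: "r = (j, N, y)" "r' = (j', N', y')" by (cases r; cases r')
  from r(3) obtain g where g: "g \<in> rot_group (eis a b)" "eseg j' N' y' = g ` eseg j N y"
    unfolding jNy rep_orbit_def by (auto simp: orbit_eq_iff)
  then obtain k l where l: "l \<in> lattice (eis a b)" "g = motion (2 * k) l" using rot_group_subset by blast
  have mid: "mid j' N' y' = \<alpha> ^ (2 * k) * mid j N y + l"
    using motion_mid[of k l j N y j' N' y'] g(2) unfolding l(2) motion_def by simp
  have st: "mid j N y \<in> starset (b, a)" "mid j' N' y' \<in> starset (b, a)"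
    using fold_edge_mid fold_reps_fold_edge r(1,2) jNy by auto
  then have "\<alpha> ^ (2 * k) * mid j N y \<in> starset (b, a)" by (simp add: starset_rot)
  then have "mid j' N' y' - l \<in> starset (b, a)" unfolding mid by simp
  then have "l = 0"
    using lattice_translate_unique[of "mid j' N' y'" l 0] st(2) mid_not_eisenstein l(1) lattice_closed(5) by simp
  then have "mid j' N' y' = \<alpha> ^ (2 * k + j) * cx (of_int N) (of_int y + 1 / 2)"
    using mid unfolding mid_def by (simp add: power_add mult.assoc)
  then have "\<alpha> ^ (5 * j') * mid j' N' y' = \<alpha> ^ (5 * j' + (2 * k + j)) * cx (of_int N) (of_int y + 1 / 2)"
    by (simp add: power_add mult.assoc)
  then have "\<alpha> ^ (5 * j' + (2 * k + j)) * cx (of_int N) (of_int y + 1 / 2) = cx (of_int N') (of_int y' + 1 / 2)"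
    unfolding mid_def \<alpha>_pow_inverse_mult by simp
  from mid_unique[OF this] have "(5 * j' + (2 * k + j)) mod 6 = 0 \<and> N = N' \<and> y = y' \<or> N = 0 \<and> N' = 0 \<and> y' = - 1 - y"
    using fold_reps_cases(2) r jNy by blast
  \<comment> \<open>Spokes are represented by y = 0 only, which excludes y' = -1 - y.\<close>
  moreover have "y = 0" if "N = 0" using that fold_reps_cases(3) r jNy by blast
  moreover have "y' = 0" if "N' = 0" using that fold_reps_cases(3) r jNy by blast
  ultimately have *: "(5 * j' + (2 * k + j)) mod 6 = 0" "N = N'" "y = y'" by auto
  then have "(5 * j' + (2 * k + j)) mod 6 mod 2 = 0" by simp
  then have "(5 * j' + (2 * k + j)) mod 2 = 0" by (simp add: mod_mod_cancel)
  moreover have "j \<in> {0, 1}" "j' \<in> {0, 1}" using fold_reps_cases(1) r jNy by blast+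
  ultimately have "j = j'" by auto
  then show "r = r'" using * jNy by simp
qed

lemma fold_count_eq: "fold_count (eis a b) (cf_coloring a b) = 2 * layer_sum + 3"
proof -
  have "{E \<in> quot_edges (eis a b). \<exists>F\<in>quot_faces (eis a b). \<exists>F'\<in>quot_faces (eis a b).
             quot_incident E F \<and> quot_incident E F' \<and> cf_coloring a b F \<noteq> cf_coloring a b F'}
     = orbit (eis a b) ` {e \<in> edges. fold_edge black_tiled e}"
    unfolding quot_edges_def using folded_orbit by auto
  then show ?thesis
    unfolding fold_count_def folded_edges by (simp only: card_image[OF inj_on_rep_orbit] fold_reps_card)
qed

end

section \<open>Subtractive Euclidean algorithm on the reals\<close>

text \<open>Unlike \<open>nxt\<close>, which keeps track of the orientation of the trapezoids, this version of the
  subtraction step is continuous.\<close>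

definition gauss_step :: "real \<times> real \<Rightarrow> real \<times> real" where
  "gauss_step = (\<lambda>(x, y). (min x y, \<bar>x - y\<bar>))"

definition gauss_fst :: "nat \<Rightarrow> real \<Rightarrow> real" where "gauss_fst k r = fst ((gauss_step ^^ k) (r, 1))"
definition gauss_snd :: "nat \<Rightarrow> real \<Rightarrow> real" where "gauss_snd k r = snd ((gauss_step ^^ k) (r, 1))"

lemma gauss_pair_0 [simp]: "gauss_fst 0 r = r" "gauss_snd 0 r = 1" by (simp_all add: gauss_fst_def gauss_snd_def)

lemma gauss_fst_Suc: "gauss_fst (Suc k) r = min (gauss_fst k r) (gauss_snd k r)" and gauss_snd_Suc: "gauss_snd (Suc k) r = \<bar>gauss_fst k r - gauss_snd k r\<bar>"
  by (simp_all add: gauss_fst_def gauss_snd_def gauss_step_def split: prod.split)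

text \<open>For rational \<open>r\<close> the pair eventually becomes constant with a vanishing component; the sum is set
  to 0 from there on.\<close>

definition positive_sum :: "nat \<Rightarrow> real \<Rightarrow> real" where
  "positive_sum k r = (if 0 < gauss_fst k r \<and> 0 < gauss_snd k r then gauss_fst k r + gauss_snd k r else 0)"

lemma continuous_gauss_pair: "continuous_on UNIV (gauss_fst k)" "continuous_on UNIV (gauss_snd k)"
proof -
  have "continuous_on UNIV (gauss_fst k) \<and> continuous_on UNIV (gauss_snd k)"
  proof (induction k)
    case 0
    then show ?case unfolding gauss_fst_def gauss_snd_def by simp
  next
    case (Suc k)
    then show ?case unfolding gauss_fst_Suc[abs_def] gauss_snd_Suc[abs_def] by (intro conjI continuous_intros) auto
  qed
  then show "continuous_on UNIV (gauss_fst k)" "continuous_on UNIV (gauss_snd k)" by auto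
qed

lemma tendsto_gauss_pair:
  assumes "r \<longlonglongrightarrow> x"
  shows "(\<lambda>n. gauss_fst k (r n)) \<longlonglongrightarrow> gauss_fst k x" "(\<lambda>n. gauss_snd k (r n)) \<longlonglongrightarrow> gauss_snd k x"
  using continuous_gauss_pair[of k] assms by (auto intro: continuous_on_tendsto_compose)

lemma gauss_pair_nonneg: "0 \<le> r \<Longrightarrow> 0 \<le> gauss_fst k r" "0 \<le> r \<Longrightarrow> 0 \<le> gauss_snd k r"
  by (induction k) (auto simp: gauss_fst_Suc gauss_snd_Suc)

lemma gauss_pair_sum_Suc: "0 \<le> r \<Longrightarrow> gauss_fst (Suc k) r + gauss_snd (Suc k) r = max (gauss_fst k r) (gauss_snd k r)"
  by (auto simp: gauss_fst_Suc gauss_snd_Suc)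

text \<open>The two components are successive remainders of the Euclidean algorithm, up to sign the
  forms Qr - P and Q'r - P'. The last equation is the invariant that bounds each coefficient by the
  reciprocal of the other remainder.\<close>

lemma gauss_pair_unimodular:
  "\<exists>Q Q' P P' :: int. \<exists>\<sigma>\<in>{1, -1}. 0 \<le> Q \<and> 0 \<le> Q' \<and> gauss_fst k r = \<sigma> * (of_int Q * r - of_int P) \<and>
     gauss_snd k r = - \<sigma> * (of_int Q' * r - of_int P') \<and> of_int Q * gauss_snd k r + of_int Q' * gauss_fst k r = 1"
proof (induction k)
  case 0
  show ?case by (intro exI[of _ 1] exI[of _ 0] exI[of _ 0] exI[of _ 1] bexI[of _ 1]) auto
next
  case (Suc k)
  then obtain Q Q' P P' :: int and \<sigma> where I: "\<sigma> \<in> {1, -1}" "0 \<le> Q" "0 \<le> Q'" "gauss_fst k r = \<sigma> * (of_int Q * r - of_int P)"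
     "gauss_snd k r = - \<sigma> * (of_int Q' * r - of_int P')" "of_int Q * gauss_snd k r + of_int Q' * gauss_fst k r = 1" by blast
  have "0 \<le> Q + Q'" "- \<sigma> \<in> {1, - 1}" using I(1-3) by auto
  show ?case
  proof (cases "gauss_fst k r \<le> gauss_snd k r")
    case True
    then have e: "gauss_fst (Suc k) r = gauss_fst k r" "gauss_snd (Suc k) r = gauss_snd k r - gauss_fst k r" by (simp_all add: gauss_fst_Suc gauss_snd_Suc)
    have "of_int Q * (gauss_snd k r - gauss_fst k r) + of_int (Q + Q') * gauss_fst k r = 1" using I(6) by (simp add: algebra_simps)
    moreover have "gauss_snd k r - gauss_fst k r = - \<sigma> * (of_int (Q + Q') * r - of_int (P + P'))"
      unfolding I(4,5) by (simp add: algebra_simps)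
    ultimately show ?thesis
      unfolding e using I(1,2,4) \<open>0 \<le> Q + Q'\<close>
      by (intro exI[of _ Q] exI[of _ "Q + Q'"] exI[of _ P] exI[of _ "P + P'"] bexI[of _ \<sigma>] conjI)
  next
    case False
    then have e: "gauss_fst (Suc k) r = gauss_snd k r" "gauss_snd (Suc k) r = gauss_fst k r - gauss_snd k r" by (simp_all add: gauss_fst_Suc gauss_snd_Suc)
    have "of_int Q' * (gauss_fst k r - gauss_snd k r) + of_int (Q + Q') * gauss_snd k r = 1" using I(6) by (simp add: algebra_simps)
    moreover have "gauss_fst k r - gauss_snd k r = - (- \<sigma>) * (of_int (Q + Q') * r - of_int (P + P'))"
      unfolding I(4,5) by (simp add: algebra_simps)
    ultimately show ?thesis
      unfolding e using I(3,5) \<open>0 \<le> Q + Q'\<close> \<open>- \<sigma> \<in> {1, - 1}\<close>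
      by (intro exI[of _ Q'] exI[of _ "Q + Q'"] exI[of _ P'] exI[of _ "P + P'"] bexI[of _ "- \<sigma>"] conjI)
  qed
qed

lemma irrational_combination:
  fixes r :: real
  assumes "r \<notin> \<rat>" "of_int Q * r - of_int P = 0"
  shows "Q = 0"
proof (rule ccontr)
  assume "Q \<noteq> 0"
  then have "r = of_int P / of_int Q" using assms(2) by (simp add: field_simps)
  then show False using assms(1) by simp
qed

lemma gauss_pair_pos:
  assumes "r \<notin> \<rat>" "0 \<le> r"
  shows "0 < gauss_fst k r" "0 < gauss_snd k r"
proof -
  obtain Q Q' P P' :: int and \<sigma> where I: "\<sigma> \<in> {1, -1}" "0 \<le> Q" "0 \<le> Q'" "gauss_fst k r = \<sigma> * (of_int Q * r - of_int P)"
     "gauss_snd k r = - \<sigma> * (of_int Q' * r - of_int P')" "of_int Q * gauss_snd k r + of_int Q' * gauss_fst k r = 1"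
    using gauss_pair_unimodular[of k r] by blast
  have "gauss_fst k r \<noteq> 0"
  proof
    assume "gauss_fst k r = 0"
    then have "of_int Q * r - of_int P = 0" using I(1,4) by auto
    then have "Q = 0" using irrational_combination[OF assms(1)] by blast
    then show False using I(6) \<open>gauss_fst k r = 0\<close> by simp
  qed
  moreover have "gauss_snd k r \<noteq> 0"
  proof
    assume "gauss_snd k r = 0"
    then have "of_int Q' * r - of_int P' = 0" using I(1,5) by auto
    then have "Q' = 0" using irrational_combination[OF assms(1)] by blast
    then show False using I(6) \<open>gauss_snd k r = 0\<close> by simp
  qed
  ultimately show "0 < gauss_fst k r" "0 < gauss_snd k r" using gauss_pair_nonneg[OF assms(2)] by (simp_all add: less_le)
qed

text \<open>The sum decreases by the smaller component at each step, so it converges and the smaller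
  component tends to 0. If the limit l were positive, the larger component would stay at least l;
  then subtraction would eventually leave the smaller one unchanged, a positive constant.\<close>

lemma gauss_pair_sum_tendsto_0:
  assumes "x \<notin> \<rat>" "0 \<le> x"
  shows "(\<lambda>k. gauss_fst k x + gauss_snd k x) \<longlonglongrightarrow> 0"
proof -
  let ?s = "\<lambda>k. gauss_fst k x + gauss_snd k x"
  note pos = gauss_pair_pos[OF assms]
  have step: "?s (Suc k) = ?s k - min (gauss_fst k x) (gauss_snd k x)" for k
    unfolding gauss_pair_sum_Suc[OF assms(2)] by (auto simp: min_def max_def)
  have "decseq ?s"
    unfolding decseq_Suc_iff step using pos by (auto simp: min_def less_imp_le)
  moreover have "0 \<le> ?s k" for k using pos[of k] by simp
  ultimately obtain l where l: "?s \<longlonglongrightarrow> l" "\<forall>k. l \<le> ?s k" using decseq_convergent[of ?s 0] by metis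
  have "0 \<le> l" using l(1) \<open>\<And>k. 0 \<le> ?s k\<close> by (intro LIMSEQ_le_const) auto
  have min0: "(\<lambda>k. min (gauss_fst k x) (gauss_snd k x)) \<longlonglongrightarrow> 0"
  proof -
    have "(\<lambda>k. ?s k - ?s (Suc k)) \<longlonglongrightarrow> l - l" by (intro tendsto_diff l(1) LIMSEQ_Suc)
    then show ?thesis unfolding step by simp
  qed
  have "l = 0"
  proof (rule ccontr)
    assume "l \<noteq> 0"
    then have "0 < l / 3" using \<open>0 \<le> l\<close> by simp
    then have "eventually (\<lambda>k. min (gauss_fst k x) (gauss_snd k x) < l / 3) sequentially"
      by (rule order_tendstoD(2)[OF min0])
    then obtain n where n: "\<And>k. n \<le> k \<Longrightarrow> min (gauss_fst k x) (gauss_snd k x) < l / 3" by (auto simp: eventually_sequentially)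
    have const: "min (gauss_fst (Suc k) x) (gauss_snd (Suc k) x) = min (gauss_fst k x) (gauss_snd k x)" if "n \<le> k" for k
    proof -
      have "l \<le> max (gauss_fst k x) (gauss_snd k x)" using l(2)[rule_format, of "Suc k"] unfolding gauss_pair_sum_Suc[OF assms(2)] .
      then show ?thesis using n[OF that] \<open>0 < l / 3\<close> unfolding gauss_fst_Suc gauss_snd_Suc by (auto simp: min_def max_def abs_if split: if_splits)
    qed
    have "min (gauss_fst (n + i) x) (gauss_snd (n + i) x) = min (gauss_fst n x) (gauss_snd n x)" for i
      by (induction i) (use const in auto)
    then have "(\<lambda>i. min (gauss_fst (i + n) x) (gauss_snd (i + n) x)) \<longlonglongrightarrow> min (gauss_fst n x) (gauss_snd n x)"
      by (simp add: add.commute)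
    moreover have "(\<lambda>i. min (gauss_fst (i + n) x) (gauss_snd (i + n) x)) \<longlonglongrightarrow> 0" using min0 by (rule LIMSEQ_ignore_initial_segment)
    ultimately have "min (gauss_fst n x) (gauss_snd n x) = 0" using LIMSEQ_unique by blast
    then show False using pos[of n] by (auto simp: min_def split: if_splits)
  qed
  then show ?thesis using l(1) by simp
qed

section \<open>Badly approximable numbers, uniformly for rationals\<close>

definition badly_approximable :: "real \<Rightarrow> real \<Rightarrow> bool" where
  "badly_approximable C r \<longleftrightarrow> (\<forall>Q P :: int. 1 \<le> Q \<longrightarrow> of_int Q * r \<noteq> of_int P \<longrightarrow> C / of_int Q \<le> \<bar>of_int Q * r - of_int P\<bar>)"

text \<open>For the remainders u and v of one step, Q v \<le> 1 turns C/Q into C v. If Q = 0 then u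
  is a positive integer, and C \<le> 1/2 together with v \<le> 2 gives C v \<le> 1.\<close>

lemma badly_approximable_bound:
  assumes "badly_approximable C r" "0 < C" "C \<le> 1 / 2" "0 < u" "0 \<le> v" "v \<le> 2"
    "u = \<bar>of_int Q * r - of_int P\<bar>" "0 \<le> Q" "of_int Q * v \<le> 1"
  shows "C * v \<le> u"
proof (cases "Q = 0")
  case True
  then have "u = of_int \<bar>P\<bar>" using assms(7) by simp
  then have "1 \<le> u" using assms(4) by (metis of_int_0_less_iff of_int_1_le_iff int_one_le_iff_zero_less)
  moreover have "C * v \<le> 1 / 2 * 2" using assms by (intro mult_mono) auto
  ultimately show ?thesis by simp
next
  case False
  then have Q: "1 \<le> Q" using assms(8) by simp
  have "of_int Q * r \<noteq> of_int P" using assms(4,7) by auto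
  then have "C / of_int Q \<le> u" using assms(1,7) Q by (simp add: badly_approximable_def)
  moreover have "C * v \<le> C / of_int Q"
  proof -
    have "C * (of_int Q * v) \<le> C * 1" using assms by (intro mult_left_mono) auto
    then show ?thesis using Q by (simp add: field_simps)
  qed
  ultimately show ?thesis by simp
qed

lemma gauss_pair_le_2: "0 \<le> r \<Longrightarrow> r \<le> 1 \<Longrightarrow> gauss_fst k r + gauss_snd k r \<le> 2"
proof (induction k)
  case (Suc k)
  then show ?case unfolding gauss_pair_sum_Suc[OF Suc.prems(1)] using gauss_pair_nonneg[OF Suc.prems(1), of k] by auto
qed simp

text \<open>Each remainder is at least C times the other, so the larger one, which is the next sum,
  is at most the present sum divided by 1 + C. The factor 2 bounds the initial sum r + 1.\<close>

lemma positive_sum_geometric: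
  assumes "badly_approximable C r" "0 < C" "C \<le> 1 / 2" "0 \<le> r" "r \<le> 1"
  shows "positive_sum k r \<le> 2 * (1 / (1 + C)) ^ k"
proof -
  have "0 < gauss_fst k r \<and> 0 < gauss_snd k r \<longrightarrow> gauss_fst k r + gauss_snd k r \<le> 2 * (1 / (1 + C)) ^ k"
  proof (induction k)
    case 0
    then show ?case using assms by simp
  next
    case (Suc k)
    show ?case
    proof
      assume "0 < gauss_fst (Suc k) r \<and> 0 < gauss_snd (Suc k) r"
      then have pos: "0 < gauss_fst k r" "0 < gauss_snd k r" by (auto simp: gauss_fst_Suc)
      obtain Q Q' P P' :: int and \<sigma> where I: "\<sigma> \<in> {1, -1}" "0 \<le> Q" "0 \<le> Q'" "gauss_fst k r = \<sigma> * (of_int Q * r - of_int P)"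
        "gauss_snd k r = - \<sigma> * (of_int Q' * r - of_int P')" "of_int Q * gauss_snd k r + of_int Q' * gauss_fst k r = 1"
        using gauss_pair_unimodular[of k r] by blast
      have "gauss_fst k r = \<bar>of_int Q * r - of_int P\<bar>" "gauss_snd k r = \<bar>of_int Q' * r - of_int P'\<bar>" using I(1,4,5) pos by auto
      moreover have "0 \<le> of_int Q * gauss_snd k r" "0 \<le> of_int Q' * gauss_fst k r" using I(2,3) pos by auto
      then have "of_int Q * gauss_snd k r \<le> 1" "of_int Q' * gauss_fst k r \<le> 1" using I(6) by linarith+
      ultimately have "C * gauss_snd k r \<le> gauss_fst k r" "C * gauss_fst k r \<le> gauss_snd k r"
        using badly_approximable_bound[OF assms(1-3)] I(2,3) pos gauss_pair_le_2[OF assms(4,5), of k] by auto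
      then have "(1 + C) * max (gauss_fst k r) (gauss_snd k r) \<le> gauss_fst k r + gauss_snd k r"
        by (auto simp: max_def algebra_simps)
      also have "\<dots> \<le> 2 * (1 / (1 + C)) ^ k" using Suc pos by blast
      finally have "max (gauss_fst k r) (gauss_snd k r) \<le> 2 * (1 / (1 + C)) ^ k / (1 + C)"
        using assms(2) by (simp only: pos_le_divide_eq add_pos_pos zero_less_one mult.commute)
      then show "gauss_fst (Suc k) r + gauss_snd (Suc k) r \<le> 2 * (1 / (1 + C)) ^ Suc k"
        unfolding gauss_pair_sum_Suc[OF assms(4)] by simp
    qed
  qed
  then show ?thesis unfolding positive_sum_def using assms(2) by auto
qed

lemma positive_sum_nonneg: "0 \<le> positive_sum k r" by (simp add: positive_sum_def)

text \<open>Both components are positive at the irrational x, so for each k the cutoff in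
  \<open>positive_sum\<close> is eventually inactive along r. The geometric bound, uniform in n, is
  the dominating series.\<close>

lemma tendsto_suminf_positive_sum:
  assumes "r \<longlonglongrightarrow> x" "x \<notin> \<rat>" "0 \<le> x" "0 < C" "C \<le> 1 / 2"
    "\<And>n. badly_approximable C (r n)" "\<And>n. 0 \<le> r n" "\<And>n. r n \<le> 1"
  shows "(\<lambda>n. \<Sum>k. positive_sum k (r n)) \<longlonglongrightarrow> (\<Sum>k. positive_sum k x)"
proof -
  have "(\<lambda>n. positive_sum k (r n)) \<longlonglongrightarrow> positive_sum k x" for k
  proof -
    note pos = gauss_pair_pos[OF assms(2,3), of k]
    have "eventually (\<lambda>n. 0 < gauss_fst k (r n)) sequentially" "eventually (\<lambda>n. 0 < gauss_snd k (r n)) sequentially"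
      using tendsto_gauss_pair[OF assms(1), of k] pos order_tendstoD(1) by blast+
    then have ev: "eventually (\<lambda>n. positive_sum k (r n) = gauss_fst k (r n) + gauss_snd k (r n)) sequentially"
      by eventually_elim (simp add: positive_sum_def)
    have lim: "(\<lambda>n. gauss_fst k (r n) + gauss_snd k (r n)) \<longlonglongrightarrow> gauss_fst k x + gauss_snd k x"
      by (intro tendsto_add tendsto_gauss_pair assms(1))
    have "(\<lambda>n. positive_sum k (r n)) \<longlonglongrightarrow> gauss_fst k x + gauss_snd k x"
      by (rule iffD2[OF tendsto_cong[OF ev] lim])
    then show ?thesis using pos by (simp add: positive_sum_def)
  qed
  moreover have "eventually (\<lambda>(k, n). norm (positive_sum k (r n)) \<le> 2 * (1 / (1 + C)) ^ k) (at_top \<times>\<^sub>F sequentially)"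
    using positive_sum_geometric[OF assms(6,4,5,7,8)] positive_sum_nonneg by (intro always_eventually) auto
  moreover have "summable (\<lambda>k. 2 * (1 / (1 + C)) ^ k)"
    using assms(4) by (intro summable_mult summable_geometric) simp
  ultimately show ?thesis
    using tannerys_theorem[of "\<lambda>k n. positive_sum k (r n)" "\<lambda>k. positive_sum k x" sequentially "\<lambda>k. 2 * (1 / (1 + C)) ^ k"]
    by simp
qed

text \<open>Liouville's argument: uP^2 + vPQ + wQ^2 is a nonzero integer, and it factors as (P - Qx)
  d with d at most a constant times Q in absolute value.\<close>

lemma quadratic_badly_approximable:
  assumes "quadratic_irrational x"
  shows "\<exists>C>0. \<forall>Q P :: int. 1 \<le> Q \<longrightarrow> C / of_int Q \<le> \<bar>of_int Q * x - of_int P\<bar>"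
proof -
  from assms obtain u v w :: int where irr: "x \<notin> \<rat>" and u: "u \<noteq> 0" and
    x: "of_int u * x\<^sup>2 + of_int v * x + of_int w = 0" by (auto simp: quadratic_irrational_def)
  \<comment> \<open>Bounds |d|/Q: if |Qx - P| \<le> 1, then |P| \<le> Q|x| + 1. The case |Qx - P| >
    1 is covered by the 1 in the minimum for C.\<close>
  define M where "M = \<bar>of_int u\<bar> * (2 * \<bar>x\<bar> + 1) + \<bar>of_int v\<bar>"
  have "0 < \<bar>real_of_int u\<bar>" using u by simp
  moreover have "0 < 2 * \<bar>x\<bar> + 1" by linarith
  ultimately have "0 < \<bar>real_of_int u\<bar> * (2 * \<bar>x\<bar> + 1)" by (rule mult_pos_pos)
  then have M: "0 < M" unfolding M_def by linarith
  define C where "C = min 1 (1 / M)"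
  have "C / of_int Q \<le> \<bar>of_int Q * x - of_int P\<bar>" if Q: "1 \<le> Q" for Q P :: int
  proof (cases "\<bar>of_int Q * x - of_int P\<bar> \<le> 1")
    case False
    have "C / of_int Q \<le> 1" using Q by (simp add: C_def divide_le_eq)
    then show ?thesis using False by linarith
  next
    case True
    define q where "q = real_of_int Q"
    define p where "p = real_of_int P"
    have q: "1 \<le> q" using Q by (simp add: q_def)
    define N where "N = u * P\<^sup>2 + v * P * Q + w * Q\<^sup>2"
    define d where "d = of_int u * (p + q * x) + of_int v * q"
    have N: "of_int N = (p - q * x) * d"
    proof -
      have "of_int N = of_int u * p\<^sup>2 + of_int v * p * q + of_int w * q\<^sup>2"
        by (simp add: N_def p_def q_def)
      also have "of_int w = - of_int u * x\<^sup>2 - of_int v * x" using x by linarith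
      finally show ?thesis by (simp add: d_def algebra_simps power2_eq_square)
    qed
    have "p - q * x \<noteq> 0"
      using irrational_combination[OF irr, of Q P] Q by (auto simp: p_def q_def)
    moreover have "d \<noteq> 0"
    proof
      assume "d = 0"
      then have "of_int (u * Q) * x - of_int (- (u * P + v * Q)) = 0"
        by (simp add: d_def p_def q_def algebra_simps)
      then have "u * Q = 0" by (rule irrational_combination[OF irr])
      then show False using u Q by simp
    qed
    ultimately have "N \<noteq> 0" using N by (metis mult_eq_0_iff of_int_0)
    then have "1 \<le> \<bar>real_of_int N\<bar>" by linarith
    then have 1: "1 \<le> \<bar>q * x - p\<bar> * \<bar>d\<bar>" unfolding N abs_mult by (simp add: abs_minus_commute)
    have "\<bar>d\<bar> \<le> M * q"
    proof -
      have "\<bar>p\<bar> \<le> q * \<bar>x\<bar> + 1"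
      proof -
        have "\<bar>p\<bar> \<le> \<bar>q * x\<bar> + \<bar>q * x - p\<bar>" by linarith
        then show ?thesis using True q by (simp add: abs_mult p_def q_def)
      qed
      then have "\<bar>p + q * x\<bar> \<le> q * (2 * \<bar>x\<bar> + 1)"
        using q abs_triangle_ineq[of p "q * x"] by (simp add: abs_mult algebra_simps)
      then have "\<bar>of_int u\<bar> * \<bar>p + q * x\<bar> \<le> \<bar>of_int u\<bar> * (q * (2 * \<bar>x\<bar> + 1))" by (intro mult_left_mono) auto
      moreover have "\<bar>d\<bar> \<le> \<bar>of_int u\<bar> * \<bar>p + q * x\<bar> + \<bar>of_int v\<bar> * q"
        unfolding d_def using abs_triangle_ineq[of "of_int u * (p + q * x)" "of_int v * q"] q by (simp add: abs_mult)
      ultimately show ?thesis by (simp add: M_def algebra_simps)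
    qed
    then have "\<bar>q * x - p\<bar> * \<bar>d\<bar> \<le> \<bar>q * x - p\<bar> * (M * q)" by (intro mult_left_mono) auto
    then have "1 \<le> \<bar>q * x - p\<bar> * (M * q)" using 1 by linarith
    then have "1 / M / q \<le> \<bar>q * x - p\<bar>" using M q by (simp add: field_simps)
    moreover have "C / q \<le> 1 / M / q" using q by (intro divide_right_mono) (auto simp: C_def)
    ultimately show ?thesis by (simp add: p_def q_def)
  qed
  moreover have "0 < C" using M by (simp add: C_def)
  ultimately show ?thesis by blast
qed

text \<open>If 2q^2 \<le> C b^2, the error q/b^2 made by replacing x with a/b costs at most half of
  C/q. For larger q, a nonzero Q a/b - P is at least 1/b, and this is at least sqrt(C/2)/q. The
  bound 1/2 meets the requirement of \<open>badly_approximable_bound\<close>.\<close>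

lemma badly_approximable_nearby:
  fixes a b :: nat
  assumes C: "0 < C" "\<And>Q P :: int. 1 \<le> Q \<Longrightarrow> C / of_int Q \<le> \<bar>of_int Q * x - of_int P\<bar>"
    and b: "0 < b" "\<bar>x - real a / real b\<bar> \<le> 1 / (real b)\<^sup>2"
  shows "badly_approximable (min (1 / 2) (min (C / 2) (sqrt (C / 2)))) (real a / real b)"
  unfolding badly_approximable_def
proof (intro allI impI)
  fix Q P :: int
  assume Q: "1 \<le> Q" and ne: "of_int Q * (real a / real b) \<noteq> of_int P"
  let ?C = "min (1 / 2) (min (C / 2) (sqrt (C / 2)))"
  define q where "q = real_of_int Q"
  have q: "1 \<le> q" using Q by (simp add: q_def)
  have b0: "0 < real b" using b by simp
  show "?C / of_int Q \<le> \<bar>of_int Q * (real a / real b) - of_int P\<bar>"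
  proof (cases "2 * q\<^sup>2 \<le> C * (real b)\<^sup>2")
    case True
    have "q / (real b)\<^sup>2 \<le> C / (2 * q)"
      using True q b0 by (simp add: field_simps power2_eq_square)
    moreover have "q * \<bar>x - real a / real b\<bar> \<le> q / (real b)\<^sup>2" using mult_left_mono[OF b(2), of q] q by simp
    moreover have "\<bar>q * x - of_int P\<bar> \<le> \<bar>q * (real a / real b) - of_int P\<bar> + q * \<bar>x - real a / real b\<bar>"
    proof -
      have "q * \<bar>x - real a / real b\<bar> = \<bar>q * (x - real a / real b)\<bar>" using q by (simp add: abs_mult)
      then have "q * \<bar>x - real a / real b\<bar> = \<bar>q * x - q * (real a / real b)\<bar>"
        by (simp only: right_diff_distrib)
      then show ?thesis by linarith
    qed
    moreover have "C / q \<le> \<bar>q * x - of_int P\<bar>" using C(2)[OF Q] by (simp add: q_def)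
    moreover have "C / q = C / (2 * q) + C / (2 * q)" using q by (simp add: field_simps)
    ultimately have "C / (2 * q) \<le> \<bar>q * (real a / real b) - of_int P\<bar>" by linarith
    moreover have "?C / q \<le> C / 2 / q" using q by (intro divide_right_mono) auto
    ultimately show ?thesis by (simp add: q_def)
  next
    case False
    then have "C / 2 * (real b)\<^sup>2 \<le> q\<^sup>2" by simp
    then have "sqrt (C / 2 * (real b)\<^sup>2) \<le> q" using q by (intro real_le_lsqrt) auto
    then have "sqrt (C / 2) * real b \<le> q" by (simp only: real_sqrt_mult[of "C / 2"] real_sqrt_abs abs_of_nat)
    then have 1: "sqrt (C / 2) / q \<le> 1 / real b" using q b0 by (simp add: field_simps)
    have eq: "of_int Q * (real a / real b) - of_int P = of_int (Q * int a - P * int b) / real b"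
      using b0 by (simp add: field_simps)
    have "Q * int a - P * int b \<noteq> 0"
    proof
      assume z: "Q * int a - P * int b = 0"
      have "of_int Q * (real a / real b) - of_int P = 0" unfolding eq z by simp
      then show False using ne by simp
    qed
    then have "1 \<le> \<bar>real_of_int (Q * int a - P * int b)\<bar>" by linarith
    then have "1 / real b \<le> \<bar>of_int (Q * int a - P * int b) / real b\<bar>" using b0 by (simp add: divide_right_mono)
    then have "1 / real b \<le> \<bar>of_int Q * (real a / real b) - of_int P\<bar>" unfolding eq .
    moreover have "?C / q \<le> sqrt (C / 2) / q" using q by (intro divide_right_mono) auto
    ultimately show ?thesis using 1 by (simp add: q_def)
  qed
qed

section \<open>Asymptotics of the fold count\<close>

context cf_flower
begin

text \<open>Only the unordered pairs agree: \<open>nxt\<close> keeps each component in its place,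
  \<open>gauss_step\<close> does not.\<close>

lemma layer_scaled:
  "real b * gauss_fst k (a / b) = real (fst (ly k)) \<and> real b * gauss_snd k (a / b) = real (snd (ly k)) \<or>
   real b * gauss_fst k (a / b) = real (snd (ly k)) \<and> real b * gauss_snd k (a / b) = real (fst (ly k))"
proof (induction k)
  case 0
  then show ?case using a_less_b by simp
next
  case (Suc k)
  obtain m n where mn: "ly k = (m, n)" by (cases "ly k")
  have b: "0 \<le> real b" by simp
  have "real b * gauss_fst (Suc k) (a / b) = min (real b * gauss_fst k (a / b)) (real b * gauss_snd k (a / b))"
    unfolding gauss_fst_Suc by (rule min_mult_distrib_left[THEN trans]) simp
  moreover have "real b * gauss_snd (Suc k) (a / b) = \<bar>real b * gauss_fst k (a / b) - real b * gauss_snd k (a / b)\<bar>"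
    unfolding gauss_snd_Suc right_diff_distrib[symmetric] abs_mult by simp
  ultimately have "real b * gauss_fst (Suc k) (a / b) = min (real m) (real n)" "real b * gauss_snd (Suc k) (a / b) = \<bar>real m - real n\<bar>"
    using Suc by (auto simp: mn min.commute abs_minus_commute)
  then show ?case by (cases "n \<le> m") (auto simp: layer_Suc mn of_nat_diff)
qed

lemma b_pos: "0 < real b" using a_pos a_less_b by simp

lemma positive_sum_layer:
  "real b * positive_sum k (a / b) = (if k \<le> K then real (fst (ly k) + snd (ly k)) else 0)"
proof -
  have "0 < gauss_fst k (a / b) \<and> 0 < gauss_snd k (a / b) \<longleftrightarrow> 0 < real b * gauss_fst k (a / b) \<and> 0 < real b * gauss_snd k (a / b)"
    using b_pos by (simp add: zero_less_mult_iff)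
  also have "\<dots> \<longleftrightarrow> alive (ly k)" using layer_scaled[of k] by (auto simp: alive_def)
  finally have *: "0 < gauss_fst k (a / b) \<and> 0 < gauss_snd k (a / b) \<longleftrightarrow> k \<le> K" unfolding alive_iff .
  have "real b * (gauss_fst k (a / b) + gauss_snd k (a / b)) = real (fst (ly k) + snd (ly k))"
    using layer_scaled[of k] unfolding distrib_left by auto
  then show ?thesis unfolding positive_sum_def * by simp
qed

lemma layer_sum_suminf: "real layer_sum = real b * (\<Sum>k. positive_sum k (a / b))"
proof -
  have "positive_sum k (a / b) = 0" if "k \<notin> {..K}" for k
    using positive_sum_layer[of k] that b_pos by auto
  then have "(\<Sum>k. positive_sum k (a / b)) = (\<Sum>k\<le>K. positive_sum k (a / b))"
    by (intro suminf_finite) auto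
  also have "real b * \<dots> = (\<Sum>k\<le>K. real (fst (ly k) + snd (ly k)))"
    unfolding sum_distrib_left by (intro sum.cong) (auto simp: positive_sum_layer)
  finally show ?thesis by (simp add: layer_sum_def)
qed

abbreviation ls :: "nat \<Rightarrow> nat" where "ls k \<equiv> fst (ly k) + snd (ly k)"

lemma ls_Suc: "ls (Suc k) \<le> ls k" "k \<le> K \<Longrightarrow> ls (Suc k) + 1 \<le> ls k"
proof -
  obtain m n where mn: "ly k = (m, n)" by (cases "ly k")
  show "ls (Suc k) \<le> ls k" by (simp add: layer_Suc mn)
  show "ls (Suc k) + 1 \<le> ls k" if "k \<le> K" using alive_le_K[OF that] by (auto simp: layer_Suc mn alive_def)
qed

lemma ls_mono: "i \<le> j \<Longrightarrow> ls j \<le> ls i"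
  using lift_Suc_antimono_le[of ls] ls_Suc(1) by blast

lemma layer_sum_bound: "layer_sum \<le> j * (a + b) + ls j * ls j"
proof -
  have "layer_sum \<le> (\<Sum>k<j. ls k) + (\<Sum>k\<in>{j..K}. ls k)"
  proof -
    have "layer_sum \<le> sum ls ({..<j} \<union> {j..K})" unfolding layer_sum_def by (intro sum_mono2) auto
    also have "\<dots> = sum ls {..<j} + sum ls {j..K}" by (intro sum.union_disjoint) auto
    finally show ?thesis .
  qed
  also have "(\<Sum>k<j. ls k) \<le> j * (a + b)"
    using sum_bounded_above[of "{..<j}" ls "a + b"] ls_mono[of 0] by (simp add: add.commute)
  also have "(\<Sum>k\<in>{j..K}. ls k) \<le> ls j * ls j"
  proof (cases "j \<le> K")
    case True
    have dec: "ls (j + i) + i \<le> ls j" if "j + i \<le> Suc K" for i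
      using that
    proof (induction i)
      case (Suc i)
      then show ?case using ls_Suc(2)[of "j + i"] by simp
    qed simp
    \<comment> \<open>While necklaces remain, the sums drop by at least 1 per step, so there are at
      most \<open>ls j\<close> further layers.\<close>
    have "card {j..K} \<le> ls j" using dec[of "Suc K - j"] True by simp
    moreover have "sum ls {j..K} \<le> card {j..K} * ls j"
      using sum_bounded_above[of "{j..K}" ls "ls j"] ls_mono by simp
    ultimately show ?thesis by (meson mult_le_mono1 order_trans)
  qed simp
  finally show ?thesis by simp
qed

lemma layer_sum_bound_real:
  "real layer_sum \<le> 2 * real j * real b + (real b)\<^sup>2 * (gauss_fst j (a / b) + gauss_snd j (a / b))\<^sup>2"
proof -
  have "real layer_sum \<le> real (j * (a + b) + ls j * ls j)" using layer_sum_bound of_nat_le_iff by blast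
  also have "\<dots> = real j * (real a + real b) + (real (ls j))\<^sup>2" by (simp add: power2_eq_square)
  also have "real (ls j) = real b * (gauss_fst j (a / b) + gauss_snd j (a / b))"
    using layer_scaled[of j] unfolding distrib_left by auto
  also have "real j * (real a + real b) \<le> real j * (2 * real b)" using a_less_b by (intro mult_left_mono) auto
  finally show ?thesis by (simp add: power_mult_distrib mult.assoc mult.left_commute)
qed

end

section \<open>Fold counts and denominators along a sequence\<close>

lemma cf_flower_exists:
  assumes "0 < a" "a < b" "coprime a b"
  shows "\<exists>K. cf_flower a b K"
proof -
  obtain K where "(nxt ^^ K) (b, a) = (1, 1)" "\<forall>k\<le>K. alive ((nxt ^^ k) (b, a))"
    using layers_reach_1[of b a] assms by (auto simp: coprime_commute)
  then show ?thesis using assms by (intro exI[of _ K]) (simp add: cf_flower_def layer_def)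
qed

lemma fold_count_positive_sum:
  assumes "0 < a" "a < b" "coprime a b"
  shows "real (fold_count (eis a b) (cf_coloring a b)) = 2 * real b * (\<Sum>k. positive_sum k (a / b)) + 3"
proof -
  obtain K where "cf_flower a b K" using cf_flower_exists[OF assms] by blast
  then interpret cf_flower a b K .
  show ?thesis unfolding fold_count_eq using layer_sum_suminf by simp
qed

lemma fold_count_bound:
  assumes "0 < a" "a < b" "coprime a b"
  shows "real (fold_count (eis a b) (cf_coloring a b)) \<le> 4 * real j * real b + 2 * (real b)\<^sup>2 * (gauss_fst j (a / b) + gauss_snd j (a / b))\<^sup>2 + 3"
proof -
  obtain K where "cf_flower a b K" using cf_flower_exists[OF assms] by blast
  then interpret cf_flower a b K .
  show ?thesis unfolding fold_count_eq using layer_sum_bound_real[of j] by simp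
qed

text \<open>Only finitely many fractions below 1 have denominator at most M, and an irrational limit
  has positive distance from them.\<close>

lemma denominators_at_top:
  fixes a b :: "nat \<Rightarrow> nat"
  assumes "\<And>n. a n < b n" "(\<lambda>n. real (a n) / real (b n)) \<longlonglongrightarrow> x" "x \<notin> \<rat>"
  shows "filterlim b at_top sequentially"
  unfolding filterlim_at_top
proof
  fix M
  define S where "S = (\<lambda>(p, q). real p / real q) ` ({..M} \<times> {..M})"
  have "closed S" unfolding S_def by (intro finite_imp_closed) auto
  moreover have "x \<notin> S" using assms(3) by (auto simp: S_def)
  ultimately have "eventually (\<lambda>n. real (a n) / real (b n) \<in> - S) sequentially"
    using topological_tendstoD[OF assms(2), of "- S"] by (simp add: open_Compl)
  then show "eventually (\<lambda>n. M \<le> b n) sequentially"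
  proof eventually_elim
    case (elim n)
    show ?case
    proof (rule ccontr)
      assume "\<not> M \<le> b n"
      then have "(a n, b n) \<in> {..M} \<times> {..M}" using assms(1)[of n] by auto
      then show False using elim by (force simp: S_def)
    qed
  qed
qed

lemma inverse_denominators:
  fixes b :: "nat \<Rightarrow> nat"
  assumes "filterlim b at_top sequentially"
  shows "(\<lambda>n. c / real (b n)) \<longlonglongrightarrow> 0"
proof -
  have "filterlim (\<lambda>n. real (b n)) at_top sequentially"
    using filterlim_compose[OF filterlim_real_sequentially assms] .
  then show ?thesis by (intro tendsto_divide_0[OF tendsto_const] filterlim_at_top_imp_at_infinity)
qed

text \<open>x is the image of its tail t > 1 under a unimodular matrix whose columns play the role
  of two consecutive convergents. As \<open>cf_convergent\<close> unfolds from the outside, the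
  induction multiplies this matrix on the left by (A 1; 1 0), which flips the sign of the
  determinant and makes p and q grow.\<close>

lemma cf_convergent_greater_1:
  assumes "x \<notin> \<rat>" "1 < x"
  shows "\<exists>p q p' q' :: nat. \<exists>t>1. cf_convergent n x = real p / real q \<and> x = (real p * t + real p') / (real q * t + real q') \<and>
     \<bar>int p * int q' - int p' * int q\<bar> = 1 \<and> 1 \<le> q \<and> n < p \<and> n \<le> q"
  using assms
proof (induction n arbitrary: x)
  case 0
  define A where "A = nat \<lfloor>x\<rfloor>"
  have A: "1 \<le> A" "real A = of_int \<lfloor>x\<rfloor>" using 0(2) by (auto simp: A_def le_nat_iff le_floor_iff)
  have "x \<notin> \<int>" using 0(1) Ints_subset_Rats by blast
  then have fr: "0 < frac x" "frac x < 1" by (simp_all add: frac_gt_0_iff frac_lt_1)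
  have "x = (real A * (1 / frac x) + real 1) / (real 1 * (1 / frac x) + real 0)"
    using fr A(2) by (simp add: field_simps frac_def)
  moreover have "1 < 1 / frac x" using fr by simp
  ultimately show ?case
    using A by (intro exI[of _ A] exI[of _ 1] exI[of _ 1] exI[of _ 0] exI[of _ "1 / frac x"]) auto
next
  case (Suc n)
  define y where "y = 1 / frac x"
  define A where "A = nat \<lfloor>x\<rfloor>"
  have A: "1 \<le> A" "real A = of_int \<lfloor>x\<rfloor>" using Suc.prems(2) by (auto simp: A_def le_nat_iff le_floor_iff)
  have "x \<notin> \<int>" using Suc.prems(1) Ints_subset_Rats by blast
  then have fr: "0 < frac x" "frac x < 1" by (simp_all add: frac_gt_0_iff frac_lt_1)
  have x: "x = real A + 1 / y" using fr A(2) by (simp add: y_def frac_def)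
  have "y \<notin> \<rat>"
  proof
    assume "y \<in> \<rat>"
    then have "real A + 1 / y \<in> \<rat>" by (intro Rats_add Rats_divide) auto
    then show False using Suc.prems(1) x by simp
  qed
  moreover have "1 < y" using fr by (simp add: y_def)
  ultimately obtain p q p' q' t where IH: "1 < t" "cf_convergent n y = real p / real q"
     "y = (real p * t + real p') / (real q * t + real q')"
     "\<bar>int p * int q' - int p' * int q\<bar> = 1" "1 \<le> q" "n < p" "n \<le> q"
    using Suc.IH[of y] by blast
  have pos: "0 < real p * t + real p'" "0 < real q * t + real q'"
    using IH by (auto intro!: add_pos_nonneg mult_pos_pos)
  have "cf_convergent (Suc n) x = real (A * p + q) / real p"
    unfolding cf_convergent.simps y_def[symmetric] IH(2) A(2)[symmetric] using IH(5,6) by (simp add: field_simps)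
  moreover have "x = (real (A * p + q) * t + real (A * p' + q')) / (real p * t + real p')"
    unfolding x IH(3) using pos by (simp add: field_simps)
  moreover have "int (A * p + q) * int p' - int (A * p' + q') * int p = - (int p * int q' - int p' * int q)"
    by (simp add: algebra_simps)
  then have "\<bar>int (A * p + q) * int p' - int (A * p' + q') * int p\<bar> = 1" using IH(4) by simp
  moreover have "Suc n < A * p + q"
  proof -
    have "p \<le> A * p" using A(1) by simp
    then show ?thesis using IH(5,6) by linarith
  qed
  moreover have "1 \<le> p" "Suc n \<le> p" using IH(6) by auto
  ultimately show ?case using IH(1) by blast
qed

text \<open>For 0 < x < 1 the convergents are reciprocals of those of 1/x. The determinant 1 makes
  the error exactly 1/(p (p t + p')), where p is the denominator b, and t > 1 bounds it by
  1/b^2.\<close>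

lemma cf_convergent_approximation:
  fixes a b :: nat
  assumes "x \<notin> \<rat>" "0 < x" "x < 1" "0 < a" "0 < b" "coprime a b" "real a / real b = cf_convergent n x"
  shows "\<bar>x - real a / real b\<bar> \<le> 1 / (real b)\<^sup>2 \<and> n \<le> b"
proof (cases n)
  \<comment> \<open>The convergent of index 0 is 0, which contradicts a > 0.\<close>
  case 0
  have "\<lfloor>x\<rfloor> = 0" using assms(2,3) by (simp add: floor_eq_iff)
  then show ?thesis using assms(4,5,7) 0 by simp
next
  case (Suc k)
  define y where "y = 1 / x"
  have fl: "\<lfloor>x\<rfloor> = 0" using assms(2,3) by (simp add: floor_eq_iff)
  then have fr: "frac x = x" by (simp add: frac_def)
  have "y \<notin> \<rat>"
  proof
    assume "y \<in> \<rat>"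
    then have "1 / y \<in> \<rat>" by (intro Rats_divide) auto
    then show False using assms(1,2) by (simp add: y_def)
  qed
  moreover have "1 < y" using assms(2,3) by (simp add: y_def)
  ultimately obtain p q p' q' t where IH: "1 < t" "cf_convergent k y = real p / real q"
     "y = (real p * t + real p') / (real q * t + real q')"
     "\<bar>int p * int q' - int p' * int q\<bar> = 1" "1 \<le> q" "k < p" "k \<le> q"
    using cf_convergent_greater_1[of y k] by blast
  have pos: "0 < real p * t + real p'" "0 < real q * t + real q'"
    using IH by (auto intro!: add_pos_nonneg mult_pos_pos)
  have "cf_convergent n x = real q / real p" using IH(2) unfolding Suc by (simp add: fl fr y_def[symmetric])
  moreover have "coprime q p"
  proof (rule coprimeI)
    fix d assume "d dvd q" "d dvd p"
    then have "int d dvd int p * int q' - int p' * int q" by (intro dvd_diff dvd_mult2 dvd_mult) (simp_all)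
    then have "int d dvd 1" using IH(4) by (metis dvd_abs_iff)
    then show "d dvd 1" by (metis of_nat_1 of_nat_dvd_iff)
  qed
  ultimately have ab: "a = q" "b = p"
    using coprime_fraction_unique[OF assms(6), of q p] assms(5,7) IH(6) by auto
  have xy: "x = (real q * t + real q') / (real p * t + real p')"
  proof -
    have "x = 1 / y" using assms(2) by (simp add: y_def)
    then show ?thesis unfolding IH(3) by simp
  qed
  have det: "\<bar>real q' * real p - real q * real p'\<bar> = 1"
  proof -
    have "real_of_int \<bar>int p * int q' - int p' * int q\<bar> = 1" unfolding IH(4) by simp
    then show ?thesis by (simp add: mult.commute)
  qed
  have p0: "0 < real p" using IH(6) by simp
  have "x - real a / real b = (real q' * real p - real q * real p') / (real p * (real p * t + real p'))"
    unfolding xy ab using pos p0 by (simp add: divide_simps) (simp add: algebra_simps)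
  then have "\<bar>x - real a / real b\<bar> = 1 / (real p * (real p * t + real p'))"
    using pos p0 by (simp only: abs_divide det) simp
  also have "\<dots> \<le> 1 / (real p * real p)"
  proof -
    have "real p \<le> real p * t" using IH(1) p0 by simp
    then have "real p \<le> real p * t + real p'" by linarith
    then have "real p * real p \<le> real p * (real p * t + real p')" using p0 by (intro mult_left_mono) auto
    then show ?thesis using p0 by (intro divide_left_mono mult_pos_pos pos(1)) auto
  qed
  finally show ?thesis using IH(6) Suc unfolding ab by (simp add: power2_eq_square)
qed

text \<open>The offset m lets the sequence of convergents start late: the convergent of index 0 is 0
  and the next one is 1 if x > 1/2, and neither is a fraction in (0,1).\<close>

theorem theorem1p1:
  fixes a b f F :: "nat \<Rightarrow> nat"
  assumes a_pos: "\<And>n. 0 < a n"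
    and a_less_b: "\<And>n. a n < b n"
    and lowest_terms: "\<And>n. coprime (a n) (b n)"
    and f_eq: "\<And>n. f n = fold_count (eis (a n) (b n)) (cf_coloring (a n) (b n))"
    and F_eq: "\<And>n. F n = face_count (eis (a n) (b n))"
  shows "(\<forall>x::real. x \<notin> \<rat> \<and> (\<lambda>n. real (a n) / real (b n)) \<longlonglongrightarrow> x
            \<longrightarrow> (\<lambda>n. real (f n) / real (F n)) \<longlonglongrightarrow> 0)
       \<and> (\<forall>(x::real) (m::nat). quadratic_irrational x \<and> 0 < x \<and> x < 1 \<and>
              (\<forall>n. real (a n) / real (b n) = cf_convergent (n + m) x)
            \<longrightarrow> (\<exists>L::real. (\<lambda>n. (real (f n))\<^sup>2 / real (F n)) \<longlonglongrightarrow> L))"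
proof (intro conjI allI impI)
  define r where "r = (\<lambda>n. real (a n) / real (b n))"
  have b_pos: "0 < real (b n)" for n using a_less_b[of n] by simp
  have r01: "0 \<le> r n" "r n \<le> 1" for n using a_less_b[of n] by (simp_all add: r_def divide_le_eq)
  have F: "real (F n) = 2 * (real (b n))\<^sup>2 * ((r n)\<^sup>2 + r n + 1)" for n
  proof -
    have "real (a n) = real (b n) * r n" using b_pos[of n] by (simp add: r_def)
    moreover have "real (F n) = 2 * ((real (a n))\<^sup>2 + real (a n) * real (b n) + (real (b n))\<^sup>2)"
      unfolding F_eq using face_count_eq[OF lowest_terms, of n] b_pos[of n] by simp
    ultimately show ?thesis by (simp add: power2_eq_square algebra_simps)
  qed
  {
    fix x :: real
    assume *: "x \<notin> \<rat> \<and> (\<lambda>n. real (a n) / real (b n)) \<longlonglongrightarrow> x"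
    then have rx: "r \<longlonglongrightarrow> x" by (simp add: r_def)
    then have x0: "0 \<le> x" using r01(1) by (intro LIMSEQ_le_const) auto
    have top: "filterlim b at_top sequentially"
      by (rule denominators_at_top[OF _ conjunct2[OF *] conjunct1[OF *]]) (rule a_less_b)
    \<comment> \<open>After multiplication by 2b^2 the first summand becomes 4jb + 4b, which absorbs
      the constant 3 because b \<ge> 1.\<close>
    define u where "u = (\<lambda>j n. real (2 * j + 2) / real (b n) + (gauss_fst j (r n) + gauss_snd j (r n))\<^sup>2)"
    have le: "real (f n) / real (F n) \<le> u j n" for j n
    proof -
      have "real (f n) \<le> 4 * real j * real (b n) + 2 * (real (b n))\<^sup>2 * (gauss_fst j (r n) + gauss_snd j (r n))\<^sup>2 + 3"
        unfolding f_eq r_def by (rule fold_count_bound[OF a_pos a_less_b lowest_terms])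
      also have "\<dots> \<le> 2 * (real (b n))\<^sup>2 * u j n"
      proof -
        have "1 \<le> real (b n)" using b_pos[of n] by simp
        moreover have "2 * (real (b n))\<^sup>2 * u j n = 2 * real (b n) * real (2 * j + 2) + 2 * (real (b n))\<^sup>2 * (gauss_fst j (r n) + gauss_snd j (r n))\<^sup>2"
        proof -
          have "2 * (real (b n))\<^sup>2 * (c / real (b n)) = 2 * real (b n) * c" for c
            using b_pos[of n] by (simp add: power2_eq_square)
          then show ?thesis unfolding u_def distrib_left by simp
        qed
        ultimately show ?thesis by (simp add: algebra_simps)
      qed
      finally have 1: "real (f n) \<le> 2 * (real (b n))\<^sup>2 * u j n" .
      have 2: "2 * (real (b n))\<^sup>2 \<le> real (F n)"
        unfolding F using r01(1)[of n] by (simp add: mult_le_cancel_left1)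
      have "0 \<le> u j n" unfolding u_def by (intro add_nonneg_nonneg) auto
      then have "2 * (real (b n))\<^sup>2 * u j n \<le> u j n * real (F n)"
        using mult_right_mono[OF 2] by (simp only: mult.commute[of "u j n"])
      then have "real (f n) \<le> u j n * real (F n)" using 1 by linarith
      moreover have "0 < real (F n)" using 2 b_pos[of n] by (smt (verit) zero_less_power)
      ultimately show ?thesis by (simp add: pos_divide_le_eq)
    qed
    show "(\<lambda>n. real (f n) / real (F n)) \<longlonglongrightarrow> 0"
    proof (rule order_tendstoI)
      fix e :: real assume "0 < e"
      have "(\<lambda>j. (gauss_fst j x + gauss_snd j x)\<^sup>2) \<longlonglongrightarrow> 0\<^sup>2"
        using gauss_pair_sum_tendsto_0 * x0 by (intro tendsto_power) blast
      then have "eventually (\<lambda>j. (gauss_fst j x + gauss_snd j x)\<^sup>2 < e) sequentially"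
        using \<open>0 < e\<close> by (intro order_tendstoD(2)) auto
      \<comment> \<open>The cutoff j depends on e and the limit x only; n tends to infinity
        afterwards.\<close>
      then obtain j where j: "(gauss_fst j x + gauss_snd j x)\<^sup>2 < e" by (auto simp: eventually_sequentially)
      have "u j \<longlonglongrightarrow> 0 + (gauss_fst j x + gauss_snd j x)\<^sup>2"
        unfolding u_def by (intro tendsto_add tendsto_power tendsto_gauss_pair rx inverse_denominators top)
      then have "eventually (\<lambda>n. u j n < e) sequentially" using j by (intro order_tendstoD(2)) auto
      then show "eventually (\<lambda>n. real (f n) / real (F n) < e) sequentially"
        by eventually_elim (use le[of _ j] in \<open>auto intro: le_less_trans\<close>)
    next
      fix e :: real assume "e < 0"
      have "e < real (f n) / real (F n)" for n
        using \<open>e < 0\<close> divide_nonneg_nonneg[of "real (f n)" "real (F n)"] by linarith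
      then show "eventually (\<lambda>n. e < real (f n) / real (F n)) sequentially" by (intro always_eventually) blast
    qed
  next
    fix x :: real and m :: nat
    assume *: "quadratic_irrational x \<and> 0 < x \<and> x < 1 \<and> (\<forall>n. real (a n) / real (b n) = cf_convergent (n + m) x)"
    then have irr: "x \<notin> \<rat>" by (simp add: quadratic_irrational_def)
    have app: "\<bar>x - r n\<bar> \<le> 1 / (real (b n))\<^sup>2 \<and> n + m \<le> b n" for n
      unfolding r_def using cf_convergent_approximation[OF irr _ _ a_pos _ lowest_terms, of n "n + m"] * b_pos[of n] by simp
    have "filterlim b at_top sequentially"
      unfolding filterlim_at_top eventually_sequentially using app by (meson add_leE order_trans)
    note inv = inverse_denominators[OF this]
    have rx: "r \<longlonglongrightarrow> x"
    proof (rule Lim_null_comparison[THEN Lim_null[THEN iffD2]])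
      show "(\<lambda>n. (1 / real (b n)) * (1 / real (b n))) \<longlonglongrightarrow> 0" using tendsto_mult[OF inv[of 1] inv[of 1]] by simp
      show "eventually (\<lambda>n. norm (r n - x) \<le> (1 / real (b n)) * (1 / real (b n))) sequentially"
        using app by (intro always_eventually) (simp add: power2_eq_square abs_minus_commute)
    qed
    obtain C0 where C0: "0 < C0" "\<And>Q P :: int. 1 \<le> Q \<Longrightarrow> C0 / of_int Q \<le> \<bar>of_int Q * x - of_int P\<bar>"
      using quadratic_badly_approximable * by blast
    define C where "C = min (1 / 2) (min (C0 / 2) (sqrt (C0 / 2)))"
    have C: "0 < C" "C \<le> 1 / 2" using C0(1) by (auto simp: C_def)
    have "badly_approximable C (r n)" for n
      unfolding C_def r_def by (rule badly_approximable_nearby[OF C0]) (use app[of n] b_pos[of n] in \<open>auto simp: r_def\<close>)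
    then have S: "(\<lambda>n. \<Sum>k. positive_sum k (r n)) \<longlonglongrightarrow> (\<Sum>k. positive_sum k x)"
      using tendsto_suminf_positive_sum[OF rx irr _ C] * r01 by simp
    \<comment> \<open>Both f^2 and F are of order b^2. Cancelling it leaves an expression in r and
      1/b whose limit is 2 S^2/(x^2 + x + 1), with S the sum of the series at x.\<close>
    have "(real (f n))\<^sup>2 / real (F n) = (2 * (\<Sum>k. positive_sum k (r n)) + 3 / real (b n))\<^sup>2 / (2 * ((r n)\<^sup>2 + r n + 1))" for n
    proof -
      have "real (f n) = real (b n) * (2 * (\<Sum>k. positive_sum k (r n)) + 3 / real (b n))"
        unfolding f_eq fold_count_positive_sum[OF a_pos a_less_b lowest_terms] r_def
        using b_pos[of n] by (simp add: distrib_left)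
      then show ?thesis unfolding F using b_pos[of n] by (simp add: power_mult_distrib)
    qed
    moreover have "(\<lambda>n. (2 * (\<Sum>k. positive_sum k (r n)) + 3 / real (b n))\<^sup>2 / (2 * ((r n)\<^sup>2 + r n + 1)))
        \<longlonglongrightarrow> (2 * (\<Sum>k. positive_sum k x) + 0)\<^sup>2 / (2 * (x\<^sup>2 + x + 1))"
    proof -
      have "0 < x\<^sup>2 + x + 1" using * by (intro add_pos_pos) auto
      then show ?thesis by (intro tendsto_intros S inv rx) auto
    qed
    ultimately show "\<exists>L. (\<lambda>n. (real (f n))\<^sup>2 / real (F n)) \<longlonglongrightarrow> L" by auto
  }
qed

end
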